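(* There is an injective morphism of commutative dg algebras $$j:(\mathcal A,\mathrm d')\hookrightarrow\big(\mathcal A^{(0);\bullet}(\mathbf C\times\mathbf R-\{0\}),\mathrm d'\big)$$ which is a dense embedding in cohomology. On degree zero generators it is defined by $j(z)=z$, $j(\lambda)=\dfrac{\bar z}{r^2}$, $j(x)=\dfrac tr$, where $r^2=z\bar z+t^2$, and on the degree one generator by $$j(\omega)=\frac{t\,\mathrm d\bar z-2\bar z\,\mathrm dt}{r^3}.$$
   Context: The algebraic dg algebra. $\mathcal R=\mathbf C[z,\lambda,x]/(z\lambda+x^2-1)$. $\mathcal A$ is the graded commutative algebra freely generated over $\mathcal R$ by an element $\omega$ of degree $+1$, so $\mathcal A=\mathcal R\oplus\mathcal R\,\omega$. Its differential $\mathrm d'$ is the degree 1 graded derivation determined by $\mathrm d'z=0$, $\mathrm d'\lambda=x\omega$, $\mathrm d'x=-\tfrac12z\omega$ (and $\mathrm d'\omega=0$). The analytic dg algebra. On $M=\mathbf C\times\mathbf R-\{0\}$ with coordinates $(z,t)$, $\mathcal A^{(0);\bullet}(M)$ is the graded commutative algebra over $C^\infty(M)$ (complex-valued smooth functions, degree 0) freely generated by $\mathrm d\bar z,\mathrm dt$ in degree 1, with differential $\mathrm d'f=\frac{\partial f}{\partial\bar z}\mathrm d\bar z+\frac{\partial f}{\partial t}\mathrm dt$ extended as a graded derivation with $\mathrm d'\mathrm d\bar z=\mathrm d'\mathrm dt=0$. "Dense embedding in cohomology" means the induced map on cohomology is injective with dense image, the cohomology of $\mathcal A^{(0);\bullet}(M)$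 carrying the topology induced from the usual Fréchet topology ($C^\infty$ topology) on smooth forms. *)

theory Defs
  imports "HOL-Analysis.Analysis" "HOL-Computational_Algebra.Polynomial"
begin

section \<open>Commutative dg algebras over the complex numbers\<close>

text \<open>
  A dg algebra lives on a whole type; the ring structure is that of the type, and the record adds
  the scalar action, the homogeneous components (in nonnegative degrees) and the differential.
\<close>

record 'a dga =
  scal :: "complex \<Rightarrow> 'a \<Rightarrow> 'a"
  homog :: "nat \<Rightarrow> 'a set"
  differential :: "'a \<Rightarrow> 'a"

locale cdga =
  fixes A :: "'a::ring_1 dga"
  assumes scalars: "vector_space (scal A)"
    and scal_mult_left: "scal A c a * b = scal A c (a * b)"
    and scal_mult_right: "a * scal A c b = scal A c (a * b)"
    and comp_subspace: "module.subspace (scal A) (homog A n)"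
    and decomposition: "\<exists>!f. finite {n. f n \<noteq> 0} \<and> (\<forall>n. f n \<in> homog A n) \<and>
                              a = (\<Sum>n | f n \<noteq> 0. f n)"
    and one_comp: "1 \<in> homog A 0"
    and mult_comp: "a \<in> homog A m \<Longrightarrow> b \<in> homog A n \<Longrightarrow> a * b \<in> homog A (m + n)"
    and graded_commute: "a \<in> homog A m \<Longrightarrow> b \<in> homog A n \<Longrightarrow> a * b = (- 1) ^ (m * n) * (b * a)"
    and diff_linear: "Vector_Spaces.linear (scal A) (scal A) (differential A)"
    and diff_comp: "a \<in> homog A n \<Longrightarrow> differential A a \<in> homog A (Suc n)"
    and diff_mult: "a \<in> homog A m \<Longrightarrow> 
      differential A (a * b) = differential A a * b + (- 1) ^ m * (a * differential A b)"
    and diff_diff: "differential A (differential A a) = 0"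

locale cdga_hom = source: cdga A + target: cdga B
  for A :: "'a::ring_1 dga" and B :: "'b::ring_1 dga" +
  fixes j :: "'a \<Rightarrow> 'b"
  assumes hom_linear: "Vector_Spaces.linear (scal A) (scal B) j"
    and hom_one: "j 1 = 1"
    and hom_mult: "j (a * b) = j a * j b"
    and hom_comp: "a \<in> homog A n \<Longrightarrow> j a \<in> homog B n"
    and hom_diff: "j (differential A a) = differential B (j a)"


section \<open>Cohomology\<close>

definition cocycles :: "'a::ring_1 dga \<Rightarrow> nat \<Rightarrow> 'a set" where
  "cocycles A n = {a \<in> homog A n. differential A a = 0}"

definition coboundaries :: "'a::ring_1 dga \<Rightarrow> nat \<Rightarrow> 'a set" where
  "coboundaries A n = (case n of 0 \<Rightarrow> {0} | Suc m \<Rightarrow> differential A ` homog A m)"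

definition cohomologous :: "'a::ring_1 dga \<Rightarrow> nat \<Rightarrow> ('a \<times> 'a) set" where
  "cohomologous A n =
     {(a, b). a \<in> cocycles A n \<and> b \<in> cocycles A n \<and> a - b \<in> coboundaries A n}"

definition cohomology :: "'a::ring_1 dga \<Rightarrow> nat \<Rightarrow> 'a set set" where
  "cohomology A n = cocycles A n // cohomologous A n"

definition cohomology_map ::
  "'b::ring_1 dga \<Rightarrow> nat \<Rightarrow> ('a \<Rightarrow> 'b) \<Rightarrow> 'a set \<Rightarrow> 'b set" where
  "cohomology_map B n j X = (\<Union>a\<in>X. cohomologous B n `` {j a})"

text \<open>
  The topology on cohomology induced by a topology \<open>T\<close> on the algebra: the quotient topology of the
  subspace topology on cocycles. The preimage in the cocycles of a set \<open>U\<close> of classes is \<open>\<Union>U\<close>.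
\<close>

definition cohomology_topology :: "'a::ring_1 dga \<Rightarrow> 'a topology \<Rightarrow> nat \<Rightarrow> 'a set topology" where
  "cohomology_topology A T n =
     topology (\<lambda>U. U \<subseteq> cohomology A n \<and> openin (subtopology T (cocycles A n)) (\<Union>U))"

lemma (in cdga) equiv_cohomologous: "equiv (cocycles A n) (cohomologous A n)"
proof -
  interpret V: vector_space "scal A" by (rule scalars)
  interpret D: Vector_Spaces.linear "scal A" "scal A" "differential A" by (rule diff_linear)
  have diff: "a - b \<in> homog A m" if "a \<in> homog A m" "b \<in> homog A m" for a b m
    using V.subspace_diff[OF comp_subspace] that by blast
  have "0 \<in> homog A m" for m using V.subspace_0[OF comp_subspace] .
  then have 0: "0 \<in> coboundaries A n"
    unfolding coboundaries_def by (cases n) (auto simp: image_iff intro: bexI[of _ 0])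
  have sub: "a - b \<in> coboundaries A n" if "a \<in> coboundaries A n" "b \<in> coboundaries A n" for a b
    using that diff unfolding coboundaries_def
    by (cases n) (auto simp: image_iff simp flip: D.diff)
  have neg: "- a \<in> coboundaries A n" if "a \<in> coboundaries A n" for a
    using sub[OF 0 that] by simp
  show ?thesis
  proof (rule equivI)
    show "refl_on (cocycles A n) (cohomologous A n)"
      using 0 by (auto simp: refl_on_def cohomologous_def)
    show "sym (cohomologous A n)"
      using neg by (fastforce simp: sym_def cohomologous_def)
    show "trans (cohomologous A n)"
    proof (rule transI)
      fix a b c assume *: "(a, b) \<in> cohomologous A n" "(b, c) \<in> cohomologous A n"
      then have "(a - b) - - (b - c) \<in> coboundaries A n"
        by (intro sub[of "a - b" "- (b - c)"] neg[of "b - c"]) (simp_all add: cohomologous_def)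
      then show "(a, c) \<in> cohomologous A n" using * by (simp add: cohomologous_def)
    qed
  qed (auto simp: cohomologous_def)
qed

lemma (in cdga) openin_cohomology_topology:
  "openin (cohomology_topology A T n) U \<longleftrightarrow>
     U \<subseteq> cohomology A n \<and> openin (subtopology T (cocycles A n)) (\<Union>U)"
proof -
  have Int: "\<Union>(U \<inter> V) = \<Union>U \<inter> \<Union>V" if "U \<subseteq> cohomology A n" "V \<subseteq> cohomology A n" for U V
    using that quotient_disj[OF equiv_cohomologous, of _ n] unfolding cohomology_def
    by (auto; metis IntI empty_iff subsetD)
  have Union: "\<Union>(\<Union>K) = \<Union>(Union ` K)" for K :: "'a set set set" by blast
  have "istopology (\<lambda>U. U \<subseteq> cohomology A n \<and> openin (subtopology T (cocycles A n)) (\<Union>U))"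
    unfolding istopology_def by (auto simp: Int openin_Int Union simp del: Union_iff)
  then show ?thesis by (simp add: cohomology_topology_def)
qed

definition dense_embedding_in_cohomology ::
  "'a::ring_1 dga \<Rightarrow> 'b::ring_1 dga \<Rightarrow> 'b topology \<Rightarrow> ('a \<Rightarrow> 'b) \<Rightarrow> bool" where
  "dense_embedding_in_cohomology A B T j \<longleftrightarrow>
     (\<forall>n. inj_on (cohomology_map B n j) (cohomology A n) \<and>
          cohomology_topology B T n closure_of (cohomology_map B n j ` cohomology A n)
            = cohomology B n)"


section \<open>The algebraic dg algebra\<close>

text \<open>
  \<^typ>\<open>complex poly poly poly\<close> is \<open>\<complex>[z][\<lambda>][x]\<close>: the innermost variable is \<open>z\<close>, the outermost is \<open>x\<close>.
\<close>

type_synonym pol = "complex poly poly poly"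

definition pol_const :: "complex \<Rightarrow> pol" where "pol_const c = [:[:[:c:]:]:]"
definition pol_z :: pol where "pol_z = [:[:[:0, 1:]:]:]"
definition pol_lambda :: pol where "pol_lambda = [:[:0, 1:]:]"
definition pol_x :: pol where "pol_x = [:0, 1:]"

definition quadric :: pol where "quadric = pol_z * pol_lambda + pol_x ^ 2 - 1"

definition quadric_rel :: "pol \<Rightarrow> pol \<Rightarrow> bool" where
  "quadric_rel p q \<longleftrightarrow> quadric dvd p - q"

lemma equivp_quadric_rel: "equivp quadric_rel"
proof (rule equivpI)
  show "reflp quadric_rel" by (simp add: reflp_def quadric_rel_def)
  show "symp quadric_rel" by (metis sympI quadric_rel_def minus_diff_eq dvd_minus_iff)
  show "transp quadric_rel"
  proof (rule transpI)
    fix p q r assume "quadric_rel p q" "quadric_rel q r"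
    then have "quadric dvd (p - q) + (q - r)" unfolding quadric_rel_def by (rule dvd_add)
    then show "quadric_rel p r" by (simp add: quadric_rel_def)
  qed
qed

quotient_type qring = pol / quadric_rel
  by (rule equivp_quadric_rel)

lemma quadric_eq: "quadric = [:[:- 1, [:0, 1:]:], 0, 1:]"
  by (simp add: quadric_def pol_z_def pol_lambda_def pol_x_def power2_eq_square one_pCons)

lemma not_quadric_dvd_1: "\<not> quadric dvd 1"
proof
  assume "quadric dvd 1"
  then have "degree quadric \<le> degree (1::pol)" by (rule dvd_imp_degree_le) simp
  then show False by (simp add: quadric_eq)
qed

instantiation qring :: comm_ring_1
begin
lift_definition zero_qring :: qring is 0 .
lift_definition one_qring :: qring is 1 .
lift_definition plus_qring :: "qring \<Rightarrow> qring \<Rightarrow> qring" is "(+)"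
proof -
  fix p p' q q' :: pol
  assume "quadric_rel p p'" "quadric_rel q q'"
  then have "quadric dvd (p - p') + (q - q')"
    unfolding quadric_rel_def by (rule dvd_add)
  then show "quadric_rel (p + q) (p' + q')"
    by (simp add: quadric_rel_def algebra_simps)
qed
lift_definition minus_qring :: "qring \<Rightarrow> qring \<Rightarrow> qring" is "(-)"
proof -
  fix p p' q q' :: pol
  assume "quadric_rel p p'" "quadric_rel q q'"
  then have "quadric dvd (p - p') - (q - q')"
    unfolding quadric_rel_def by (rule dvd_diff)
  then show "quadric_rel (p - q) (p' - q')"
    by (simp add: quadric_rel_def algebra_simps)
qed
lift_definition uminus_qring :: "qring \<Rightarrow> qring" is uminus
proof -
  fix p p' :: pol
  assume "quadric_rel p p'"
  then have "quadric dvd - (p - p')" unfolding quadric_rel_def by (simp only: dvd_minus_iff)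
  then show "quadric_rel (- p) (- p')" by (simp add: quadric_rel_def)
qed
lift_definition times_qring :: "qring \<Rightarrow> qring \<Rightarrow> qring" is "(*)"
proof -
  fix p p' q q' :: pol
  assume "quadric_rel p p'" "quadric_rel q q'"
  moreover have "p * q - p' * q' = (p - p') * q + p' * (q - q')" by (simp add: algebra_simps)
  ultimately show "quadric_rel (p * q) (p' * q')"
    unfolding quadric_rel_def by (metis dvd_add dvd_mult dvd_mult2)
qed
instance
proof
  show "(0::qring) \<noteq> 1"
    by transfer (metis quadric_rel_def diff_0 dvd_minus_iff not_quadric_dvd_1)
qed (transfer; simp add: quadric_rel_def algebra_simps)+
end

text \<open>The derivation \<open>\<partial>\<close> of \<open>\<complex>[z,\<lambda>,x]\<close> over \<open>\<complex>\<close> with \<open>\<partial>z = 0\<close>, \<open>\<partial>\<lambda> = x\<close>, \<open>\<partial>x = - z/2\<close>.\<close>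

definition pol_deriv :: "pol \<Rightarrow> pol" where
  "pol_deriv p = pol_x * map_poly pderiv p - pol_const (1/2) * pol_z * pderiv p"

lemma map_poly_pderiv_add:
  "map_poly pderiv (p + q) = map_poly pderiv p + map_poly pderiv (q :: 'a::idom poly poly)"
  by (intro poly_eqI) (simp add: coeff_map_poly pderiv_add)

lemma map_poly_pderiv_diff:
  "map_poly pderiv (p - q) = map_poly pderiv p - map_poly pderiv (q :: 'a::idom poly poly)"
  by (intro poly_eqI) (simp add: coeff_map_poly pderiv_diff)

lemma pderiv_sum': "pderiv (sum f A) = (\<Sum>i\<in>A. pderiv (f i))"
  by (induction A rule: infinite_finite_induct) (simp_all add: pderiv_add)

lemma map_poly_pderiv_mult:
  "map_poly pderiv (p * q) = map_poly pderiv p * q + p * map_poly pderiv (q :: 'a::idom poly poly)"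
proof -
  have "pderiv (a * b) = pderiv a * b + a * pderiv b" for a b :: "'a poly"
    by (simp add: pderiv_mult)
  then show ?thesis
    by (intro poly_eqI) (simp add: coeff_map_poly coeff_mult pderiv_sum' sum.distrib)
qed

lemma pol_deriv_add: "pol_deriv (p + q) = pol_deriv p + pol_deriv q"
  and pol_deriv_diff: "pol_deriv (p - q) = pol_deriv p - pol_deriv q"
  and pol_deriv_mult: "pol_deriv (p * q) = pol_deriv p * q + p * pol_deriv q"
  by (simp_all add: pol_deriv_def map_poly_pderiv_add map_poly_pderiv_diff map_poly_pderiv_mult
      pderiv_add pderiv_diff pderiv_mult algebra_simps)

lemma pol_deriv_const: "pol_deriv (pol_const c) = 0"
  and pol_deriv_z: "pol_deriv pol_z = 0"
  and pol_deriv_lambda: "pol_deriv pol_lambda = pol_x"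
  and pol_deriv_x: "pol_deriv pol_x = - (pol_const (1/2) * pol_z)"
  by (simp_all add: pol_deriv_def pol_const_def pol_z_def pol_lambda_def pol_x_def
      map_poly_pCons pderiv_pCons one_pCons)

lemma pol_deriv_quadric: "pol_deriv quadric = 0"
proof -
  have one: "(1::pol) = pol_const 1" by (simp add: pol_const_def one_pCons)
  have "pol_const (1/2) + pol_const (1/2) = 1" by (simp add: pol_const_def one_pCons)
  then have "pol_x * (pol_const (1/2) * pol_z) + pol_x * (pol_const (1/2) * pol_z)
      = pol_x * pol_z"
    by (metis distrib_left distrib_right mult_1)
  then show ?thesis
    unfolding quadric_def pol_deriv_diff
    by (simp add: pol_deriv_add pol_deriv_mult power2_eq_square
        pol_deriv_z pol_deriv_lambda pol_deriv_x)
      (simp add: one pol_deriv_const algebra_simps)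
qed

lift_definition qring_const :: "complex \<Rightarrow> qring" is pol_const .
lift_definition qring_z :: qring is pol_z .
lift_definition qring_lambda :: qring is pol_lambda .
lift_definition qring_x :: qring is pol_x .

lift_definition qring_deriv :: "qring \<Rightarrow> qring" is pol_deriv
proof -
  fix p q assume "quadric_rel p q"
  then obtain r where "p - q = quadric * r" by (auto simp: quadric_rel_def)
  then have "pol_deriv p - pol_deriv q = quadric * pol_deriv r"
    by (metis pol_deriv_diff pol_deriv_mult pol_deriv_quadric mult_zero_left add_0)
  then show "quadric_rel (pol_deriv p) (pol_deriv q)" by (simp add: quadric_rel_def)
qed

text \<open>\<open>Alg a b\<close> stands for \<open>a + b \<omega>\<close>; note \<open>\<omega>\<^sup>2 = 0\<close> since \<open>\<omega>\<close> is odd.\<close>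

datatype alg = Alg (alg0: qring) (alg1: qring)

instantiation alg :: ring_1
begin
definition "0 = Alg 0 0"
definition "1 = Alg 1 0"
definition "a + b = Alg (alg0 a + alg0 b) (alg1 a + alg1 b)"
definition "a - b = Alg (alg0 a - alg0 b) (alg1 a - alg1 b)"
definition "- a = Alg (- alg0 a) (- alg1 a)"
definition "a * b = Alg (alg0 a * alg0 b) (alg0 a * alg1 b + alg1 a * alg0 b)"
instance
  by standard
    (simp_all add: zero_alg_def one_alg_def plus_alg_def minus_alg_def uminus_alg_def times_alg_def
      alg.expand algebra_simps)
end

definition gen_z :: alg where "gen_z = Alg qring_z 0"
definition gen_lambda :: alg where "gen_lambda = Alg qring_lambda 0"
definition gen_x :: alg where "gen_x = Alg qring_x 0"
definition gen_omega :: alg where "gen_omega = Alg 0 1"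

definition alg_dga :: "alg dga" where
  "alg_dga = \<lparr>
     scal = (\<lambda>c a. Alg (qring_const c * alg0 a) (qring_const c * alg1 a)),
     homog = (\<lambda>n. if n = 0 then {Alg f 0 | f. True} else if n = 1 then {Alg 0 g | g. True} else {0}),
     differential = (\<lambda>a. Alg 0 (qring_deriv (alg0 a)))\<rparr>"

lemma diff_generators:
  "differential alg_dga gen_z = 0"
  "differential alg_dga gen_lambda = gen_x * gen_omega"
  "differential alg_dga gen_x = scal alg_dga (- 1/2) (gen_z * gen_omega)"
  "differential alg_dga gen_omega = 0"
proof -
  have 1: "qring_deriv qring_z = 0"
    by transfer (simp add: pol_deriv_z quadric_rel_def)
  have 2: "qring_deriv qring_lambda = qring_x"
    by transfer (simp add: pol_deriv_lambda quadric_rel_def)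
  have 3: "qring_deriv qring_x = qring_const (- 1/2) * qring_z"
    by transfer (simp add: pol_deriv_x quadric_rel_def pol_const_def flip: smult_minus_left)
  have 4: "qring_deriv 0 = 0"
    by transfer (simp add: pol_deriv_def quadric_rel_def)
  show "differential alg_dga gen_z = 0" "differential alg_dga gen_lambda = gen_x * gen_omega"
    "differential alg_dga gen_x = scal alg_dga (- 1/2) (gen_z * gen_omega)"
    "differential alg_dga gen_omega = 0"
    using 1 2 3 4
    by (simp_all add: alg_dga_def gen_z_def gen_lambda_def gen_x_def gen_omega_def
        times_alg_def zero_alg_def)
qed


section \<open>Smooth functions on \<open>(\<complex> \<times> \<real>) - {0}\<close>\<close>

primrec Ck_on :: "nat \<Rightarrow> 'a::real_normed_vector set \<Rightarrow> ('a \<Rightarrow> 'b::real_normed_vector) \<Rightarrow> bool" where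
  "Ck_on 0 S f \<longleftrightarrow> continuous_on S f"
| "Ck_on (Suc k) S f \<longleftrightarrow> (\<forall>x\<in>S. f differentiable (at x)) \<and>
     (\<forall>v. Ck_on k S (\<lambda>x. frechet_derivative f (at x) v))"

definition smooth_on :: "'a::real_normed_vector set \<Rightarrow> ('a \<Rightarrow> 'b::real_normed_vector) \<Rightarrow> bool" where
  "smooth_on S f \<longleftrightarrow> (\<forall>k. Ck_on k S f)"

lemma Ck_on_cong:
  assumes "open S" "Ck_on k S f" "\<And>x. x \<in> S \<Longrightarrow> f x = g x"
  shows "Ck_on k S g"
  using assms(2,3)
proof (induction k arbitrary: f g)
  case 0
  then show ?case by (simp cong: continuous_on_cong)
next
  case (Suc k)
  have diffble: "g differentiable (at x)" and
    eq: "frechet_derivative f (at x) = frechet_derivative g (at x)" if "x \<in> S" for x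
  proof -
    have d: "f differentiable (at x)" using Suc.prems(1) that by simp
    then show "frechet_derivative f (at x) = frechet_derivative g (at x)"
      using frechet_derivative_transform_within_open[OF d assms(1) that] Suc.prems(2) by blast
    show "g differentiable (at x)"
      using d has_derivative_transform_within_open[OF _ assms(1) that] Suc.prems(2)
      unfolding differentiable_def by blast
  qed
  have "Ck_on k S (\<lambda>x. frechet_derivative g (at x) v)" for v
    using Suc.IH[of "\<lambda>x. frechet_derivative f (at x) v"] Suc.prems(1) eq by simp
  then show ?case using diffble by simp
qed

lemma Ck_on_Suc: "Ck_on (Suc k) S f \<Longrightarrow> Ck_on k S f"
proof (induction k arbitrary: f)
  case 0
  then show ?case
    by (auto intro!: continuous_at_imp_continuous_on differentiable_imp_continuous_within)
next
  case (Suc k)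
  then show ?case by (metis Ck_on.simps(2))
qed

lemma Ck_on_const: "Ck_on k S (\<lambda>x. c)"
  by (induction k arbitrary: c) simp_all

lemma Ck_on_add:
  assumes "open S" "Ck_on k S f" "Ck_on k S g"
  shows "Ck_on k S (\<lambda>x. f x + g x)"
  using assms(2,3)
proof (induction k arbitrary: f g)
  case 0
  then show ?case by (simp add: continuous_on_add)
next
  case (Suc k)
  have "Ck_on k S (\<lambda>x. frechet_derivative (\<lambda>x. f x + g x) (at x) v)" for v
  proof (rule Ck_on_cong[OF assms(1)])
    show "Ck_on k S (\<lambda>x. frechet_derivative f (at x) v + frechet_derivative g (at x) v)"
      using Suc by simp
    fix x assume "x \<in> S"
    then have "(f has_derivative frechet_derivative f (at x)) (at x)"
      "(g has_derivative frechet_derivative g (at x)) (at x)"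
      using Suc.prems by (simp_all add: frechet_derivative_works)
    from frechet_derivative_at[OF has_derivative_add[OF this]]
    show "frechet_derivative f (at x) v + frechet_derivative g (at x) v
      = frechet_derivative (\<lambda>x. f x + g x) (at x) v" by metis
  qed
  then show ?case using Suc.prems by simp
qed

lemma Ck_on_mult:
  fixes f g :: "'a::real_normed_vector \<Rightarrow> 'b::real_normed_algebra"
  assumes "open S" "Ck_on k S f" "Ck_on k S g"
  shows "Ck_on k S (\<lambda>x. f x * g x)"
  using assms(2,3)
proof (induction k arbitrary: f g)
  case 0
  then show ?case by (simp add: continuous_on_mult)
next
  case (Suc k)
  have "Ck_on k S (\<lambda>x. frechet_derivative (\<lambda>x. f x * g x) (at x) v)" for v
  proof (rule Ck_on_cong[OF assms(1)])
    show "Ck_on k S (\<lambda>x. f x * frechet_derivative g (at x) v + frechet_derivative f (at x) v * g x)"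
      using Suc.prems Suc.prems[THEN Ck_on_Suc]
      by (intro Ck_on_add[OF assms(1)] Suc.IH) simp_all
    fix x assume "x \<in> S"
    then have "(f has_derivative frechet_derivative f (at x)) (at x)"
      "(g has_derivative frechet_derivative g (at x)) (at x)"
      using Suc.prems by (simp_all add: frechet_derivative_works)
    from frechet_derivative_at[OF has_derivative_mult[OF this]]
    show "f x * frechet_derivative g (at x) v + frechet_derivative f (at x) v * g x
      = frechet_derivative (\<lambda>x. f x * g x) (at x) v" by metis
  qed
  then show ?case using Suc.prems by simp
qed

lemma Ck_on_minus:
  fixes f :: "'a::real_normed_vector \<Rightarrow> 'b::real_normed_algebra_1"
  assumes "open S" "Ck_on k S f"
  shows "Ck_on k S (\<lambda>x. - f x)"
  using Ck_on_mult[OF assms(1) Ck_on_const[of _ _ "- 1"] assms(2)] by simp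

definition punctured :: "(complex \<times> real) set" where "punctured = UNIV - {0}"

lemma open_punctured: "open punctured"
  by (simp add: punctured_def open_Diff)

text \<open>A function on \<open>punctured\<close> is represented by its extension by \<open>0\<close> to the origin.\<close>

typedef smooth = "{f :: complex \<times> real \<Rightarrow> complex. smooth_on punctured f \<and> (\<forall>p. p \<notin> punctured \<longrightarrow> f p = 0)}"
  morphisms at_point Abs_smooth
  by (rule exI[of _ "\<lambda>_. 0"]) (simp add: smooth_on_def Ck_on_const)

setup_lifting type_definition_smooth

instantiation smooth :: comm_ring_1
begin
lift_definition zero_smooth :: smooth is "\<lambda>_. 0"
  by (simp add: smooth_on_def Ck_on_const)
lift_definition one_smooth :: smooth is "\<lambda>p. if p \<in> punctured then 1 else 0"
  by (auto simp: smooth_on_def intro: Ck_on_cong[OF open_punctured Ck_on_const[of _ _ 1]])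
lift_definition plus_smooth :: "smooth \<Rightarrow> smooth \<Rightarrow> smooth" is "\<lambda>f g p. f p + g p"
  by (simp add: smooth_on_def Ck_on_add open_punctured)
lift_definition times_smooth :: "smooth \<Rightarrow> smooth \<Rightarrow> smooth" is "\<lambda>f g p. f p * g p"
  by (simp add: smooth_on_def Ck_on_mult open_punctured)
lift_definition uminus_smooth :: "smooth \<Rightarrow> smooth" is "\<lambda>f p. - f p"
  by (simp add: smooth_on_def Ck_on_minus open_punctured)
lift_definition minus_smooth :: "smooth \<Rightarrow> smooth \<Rightarrow> smooth" is "\<lambda>f g p. f p - g p"
proof -
  fix f g :: "complex \<times> real \<Rightarrow> complex"
  assume "smooth_on punctured f \<and> (\<forall>p. p \<notin> punctured \<longrightarrow> f p = 0)"
    "smooth_on punctured g \<and> (\<forall>p. p \<notin> punctured \<longrightarrow> g p = 0)"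
  moreover from this have "Ck_on k punctured (\<lambda>p. f p + - g p)" for k
    by (intro Ck_on_add Ck_on_minus open_punctured) (simp_all add: smooth_on_def)
  ultimately show "smooth_on punctured (\<lambda>p. f p - g p) \<and>
      (\<forall>p. p \<notin> punctured \<longrightarrow> f p - g p = 0)"
    by (simp add: smooth_on_def)
qed
instance
proof
  show "(0::smooth) \<noteq> 1"
  proof transfer
    have "(0, 1) \<in> punctured" by (simp add: punctured_def zero_prod_def)
    then show "(\<lambda>_. 0) \<noteq> (\<lambda>p. if p \<in> punctured then 1 else (0::complex))" by (metis zero_neq_one)
  qed
qed (transfer; force simp: algebra_simps)+
end

lift_definition smooth_scale :: "complex \<Rightarrow> smooth \<Rightarrow> smooth" is "\<lambda>c f p. c * f p"
  by (simp add: smooth_on_def Ck_on_mult Ck_on_const open_punctured)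

text \<open>The derivative in the direction of a fixed (real) tangent vector.\<close>

lift_definition dir_deriv :: "complex \<times> real \<Rightarrow> smooth \<Rightarrow> smooth" is
  "\<lambda>v f p. if p \<in> punctured then frechet_derivative f (at p) v else 0"
proof -
  fix v and f :: "complex \<times> real \<Rightarrow> complex"
  assume f: "smooth_on punctured f \<and> (\<forall>p. p \<notin> punctured \<longrightarrow> f p = 0)"
  have "Ck_on k punctured (\<lambda>p. frechet_derivative f (at p) v)" for k
    using f by (metis Ck_on.simps(2) smooth_on_def)
  then have "Ck_on k punctured (\<lambda>p. if p \<in> punctured then frechet_derivative f (at p) v else 0)" for k
    by (rule Ck_on_cong[OF open_punctured]) simp
  then show "smooth_on punctured (\<lambda>p. if p \<in> punctured then frechet_derivative f (at p) v else 0) \<and>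
      (\<forall>p. p \<notin> punctured \<longrightarrow> (if p \<in> punctured then frechet_derivative f (at p) v else 0) = 0)"
    by (simp add: smooth_on_def)
qed

definition d_zbar :: "smooth \<Rightarrow> smooth" where
  "d_zbar f = smooth_scale (1/2) (dir_deriv (1, 0) f + smooth_scale \<i> (dir_deriv (\<i>, 0) f))"

definition d_t :: "smooth \<Rightarrow> smooth" where
  "d_t f = dir_deriv (0, 1) f"

text \<open>
  The Frechet topology: uniform convergence on compact sets of all iterated partial
  derivatives.
\<close>

definition smooth_topology :: "smooth topology" where
  "smooth_topology = topology_generated_by
     {{g. \<forall>p\<in>K. cmod (at_point (fold dir_deriv vs (g - f)) p) < \<epsilon>} | f vs K \<epsilon>.
        set vs \<subseteq> Basis \<and> compact K \<and> K \<subseteq> punctured \<and> 0 < \<epsilon>}"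


section \<open>The analytic dg algebra\<close>

text \<open>\<open>Form f g h k\<close> stands for \<open>f + g dzbar + h dt + k dzbar dt\<close>.\<close>

datatype form = Form (form_1: smooth) (form_zbar: smooth) (form_t: smooth) (form_zbar_t: smooth)

instantiation form :: ring_1
begin
definition "0 = Form 0 0 0 0"
definition "1 = Form 1 0 0 0"
definition "a + b = Form (form_1 a + form_1 b) (form_zbar a + form_zbar b)
  (form_t a + form_t b) (form_zbar_t a + form_zbar_t b)"
definition "a - b = Form (form_1 a - form_1 b) (form_zbar a - form_zbar b)
  (form_t a - form_t b) (form_zbar_t a - form_zbar_t b)"
definition "- a = Form (- form_1 a) (- form_zbar a) (- form_t a) (- form_zbar_t a)"
definition "a * b = Form
  (form_1 a * form_1 b)
  (form_1 a * form_zbar b + form_zbar a * form_1 b)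
  (form_1 a * form_t b + form_t a * form_1 b)
  (form_1 a * form_zbar_t b + form_zbar a * form_t b - form_t a * form_zbar b
     + form_zbar_t a * form_1 b)"
instance
  by standard
    (simp_all add: zero_form_def one_form_def plus_form_def minus_form_def uminus_form_def
      times_form_def form.expand algebra_simps)
end

definition form_dga :: "form dga" where
  "form_dga = \<lparr>
     scal = (\<lambda>c a. Form (smooth_scale c (form_1 a)) (smooth_scale c (form_zbar a))
                        (smooth_scale c (form_t a)) (smooth_scale c (form_zbar_t a))),
     homog = (\<lambda>n. if n = 0 then {Form f 0 0 0 | f. True}
                 else if n = 1 then {Form 0 g h 0 | g h. True}
                 else if n = 2 then {Form 0 0 0 k | k. True}
                 else {0}),
     differential = (\<lambda>a. Form 0 (d_zbar (form_1 a)) (d_t (form_1 a))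
                        (d_zbar (form_t a) - d_t (form_zbar a)))\<rparr>"

definition form_topology :: "form topology" where
  "form_topology = pullback_topology UNIV
     (\<lambda>a. (form_1 a, form_zbar a, form_t a, form_zbar_t a))
     (prod_topology smooth_topology (prod_topology smooth_topology
       (prod_topology smooth_topology smooth_topology)))"

text \<open>The value of a form at a point, in the basis \<open>1\<close>, \<open>dzbar\<close>, \<open>dt\<close>, \<open>dzbar dt\<close>.\<close>

definition form_at :: "form \<Rightarrow> complex \<times> real \<Rightarrow> complex \<times> complex \<times> complex \<times> complex" where
  "form_at a p = (at_point (form_1 a) p, at_point (form_zbar a) p,
                  at_point (form_t a) p, at_point (form_zbar_t a) p)"

definition radius :: "complex \<Rightarrow> real \<Rightarrow> real" where
  "radius z t = sqrt (Re (z * cnj z) + t\<^sup>2)"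

end

theory Submission
  imports Defs "HOL-Complex_Analysis.Complex_Analysis"
begin

text \<open>
  Write \<open>\<alpha> \<sim> \<beta>\<close> if \<open>\<alpha> - \<beta>\<close> is exact,
  \<open>M = (\<complex> \<times> \<real>) - {0}\<close>, \<open>x = t/r\<close> and \<open>\<lambda> = zbar/r\<^sup>2\<close>. The prescribed
  images of the generators satisfy \<open>z \<lambda> + x\<^sup>2 = 1\<close>, so polynomials can be evaluated on
  them modulo the quadric. Compatibility with the differentials only has to be seen on generators,
  because both sides are derivations; there all identities follow by differentiating
  \<open>\<rho>\<^sup>2 (z zbar + t\<^sup>2) = 1\<close> for \<open>\<rho> = 1/r\<close> (\<open>d_generators\<close>, \<open>d_qfun\<close>). The map is
  injective because an element of the quadric ring has the form \<open>A(z,\<lambda>) + B(z,\<lambda>) x\<close>,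
  where the reflection \<open>t \<mapsto> -t\<close> separates \<open>A\<close> from \<open>B\<close>, and for fixed \<open>z \<noteq> 0\<close> the function
  \<open>\<lambda>\<close> takes infinitely many values (\<open>qfun_eq_0_iff\<close>).

  In degree 0, a cocycle on \<open>M\<close> does not depend on \<open>t\<close> and is holomorphic in \<open>z\<close>; hence it is an entire
  function, the limit of its Taylor polynomials. In degree 2 the algebraic cohomology vanishes and
  it must be shown that coboundaries are dense: near a compact set every top form agrees with one
  that is smooth on all of \<open>\<complex> \<times> \<real>\<close>, and that one is a \<open>t\<close>-derivative
  (\<open>top_form_approximation\<close>).

  Degree 1 is the essential case. Algebraically, the classes of \<open>\<lambda>\<^sup>k \<omega>\<close> span
  the cohomology (\<open>qring_eq_deriv_plus_lambda_polynomial\<close>). Where \<open>z \<noteq> 0\<close> these forms have a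
  primitive: \<open>\<lambda>\<^sup>k \<omega> = d'(-2 z\<^sup>-\<^sup>k\<^sup>-\<^sup>1 P\<^sub>k(x))\<close>
  with \<open>P\<^sub>k' = (1 - x\<^sup>2)\<^sup>k\<close>, because \<open>d'x = -z \<omega>/2\<close> and
  \<open>1 - x\<^sup>2 = z \<lambda>\<close>. If a combination of them with coefficients \<open>c\<^sub>k\<close>, the last one
  being \<open>c\<^sub>n\<close>, is \<open>d'f\<close> on \<open>M\<close>, then the leading term of \<open>f(z,1) - f(z,-1)\<close> at \<open>z = 0\<close> is
  \<open>-2 c\<^sub>n z\<^sup>-\<^sup>n\<^sup>-\<^sup>1 (P\<^sub>n(1) - P\<^sub>n(-1))\<close>. But \<open>f\<close> is
  continuous at \<open>(0,1)\<close> and \<open>(0,-1)\<close>, and \<open>P\<^sub>n(1) \<noteq> P\<^sub>n(-1)\<close>, so \<open>c\<^sub>n = 0\<close>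
  (\<open>lambda_omega_not_exact\<close>).

  For density, let \<open>\<alpha>\<close> be a closed one-form and consider only \<open>|z| < N\<close>. Off either of the two
  halves of the axis \<open>z = 0\<close>, \<open>\<alpha>\<close> has a primitive: integrate its \<open>dt\<close> part vertically, and repair
  the remaining \<open>dzbar\<close> part, which is a form on a disc, with the Cauchy transform
  (\<open>primitive_on_slit\<close>, \<open>dbar_solution_on_ball\<close>). The two primitives differ by a holomorphic function
  \<open>\<phi>\<close> on the punctured disc, and if \<open>\<chi>\<close> is a cutoff, 0 near one half-axis and 1 near the
  other, then \<open>\<alpha> \<sim> \<phi> d'\<chi>\<close> (\<open>closed_one_form_decomposition\<close>). On the support of
  \<open>d'\<chi>\<close> in a compact set, \<open>\<phi>\<close> is a limit of Laurent polynomials. Finally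
  \<open>z\<^sup>k d'\<chi> \<sim> 0\<close> for \<open>k \<ge> 0\<close>, and \<open>z\<^sup>-\<^sup>k\<^sup>-\<^sup>1 d'\<chi>\<close> is
  cohomologous to a multiple of \<open>\<lambda>\<^sup>k \<omega>\<close>, by the primitive above
  (\<open>cutoff_class_multiple_of_lambda_omega\<close>).
\<close>

section \<open>Smooth maps\<close>

lemma Ck_on_SucI:
  assumes "open S" "\<And>x. x \<in> S \<Longrightarrow> (f has_derivative f' x) (at x)"
    and "\<And>v. Ck_on k S (\<lambda>x. f' x v)"
  shows "Ck_on (Suc k) S f"
proof -
  have "frechet_derivative f (at x) = f' x" if "x \<in> S" for x
    using frechet_derivative_at[OF assms(2)[OF that]] by simp
  then have "Ck_on k S (\<lambda>x. frechet_derivative f (at x) v)" for v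
    by (intro Ck_on_cong[OF assms(1) assms(3)[of v]]) simp
  then show ?thesis
    using assms(2) by (auto simp: differentiable_def)
qed

lemma smooth_on_differentiable: "smooth_on S f \<Longrightarrow> x \<in> S \<Longrightarrow> f differentiable (at x)"
  unfolding smooth_on_def by (metis Ck_on.simps(2))

lemma smooth_on_has_derivative:
  "smooth_on S f \<Longrightarrow> x \<in> S \<Longrightarrow> (f has_derivative frechet_derivative f (at x)) (at x)"
  using smooth_on_differentiable frechet_derivative_works by blast

lemma smooth_on_frechet_derivative:
  "smooth_on S f \<Longrightarrow> smooth_on S (\<lambda>x. frechet_derivative f (at x) v)"
  unfolding smooth_on_def by (metis Ck_on.simps(2))

lemma smooth_on_continuous: "smooth_on S f \<Longrightarrow> continuous_on S f"
  unfolding smooth_on_def by (metis Ck_on.simps(1))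

lemma smooth_on_cong:
  assumes "open S" "smooth_on S f" "\<And>x. x \<in> S \<Longrightarrow> f x = g x"
  shows "smooth_on S g"
  using Ck_on_cong[OF assms(1) _ assms(3)] assms(2) by (auto simp: smooth_on_def)

lemma Ck_on_subset: "Ck_on k S f \<Longrightarrow> T \<subseteq> S \<Longrightarrow> Ck_on k T f"
  by (induction k arbitrary: f) (auto intro: continuous_on_subset)

lemma smooth_on_subset: "smooth_on S f \<Longrightarrow> T \<subseteq> S \<Longrightarrow> smooth_on T f"
  by (auto simp: smooth_on_def intro: Ck_on_subset)

text \<open>
  Being of class \<open>C\<^sup>k\<close> is a local property since the derivative at a point only depends on the
  germ of the function. This is what allows smooth functions to be glued from pieces below.
\<close>

lemma Ck_on_local:
  assumes "\<And>x. x \<in> S \<Longrightarrow> \<exists>T. open T \<and> x \<in> T \<and> Ck_on k T f"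
  shows "Ck_on k S f"
  using assms
proof (induction k arbitrary: f)
  case 0
  then show ?case
    by (auto intro!: continuous_at_imp_continuous_on) (metis continuous_on_eq_continuous_at)
next
  case (Suc k)
  have "f differentiable at x" if "x \<in> S" for x
    using Suc.prems[OF that] by auto
  moreover have "Ck_on k S (\<lambda>x. frechet_derivative f (at x) v)" for v
    by (rule Suc.IH) (use Suc.prems in \<open>auto; metis\<close>)
  ultimately show ?case by simp
qed

lemma smooth_on_local:
  assumes "\<And>x. x \<in> S \<Longrightarrow> \<exists>T. open T \<and> x \<in> T \<and> smooth_on T f"
  shows "smooth_on S f"
  unfolding smooth_on_def
proof
  fix k show "Ck_on k S f"
    by (rule Ck_on_local) (use assms in \<open>auto simp: smooth_on_def; metis\<close>)
qed

lemma smooth_on_Un: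
  assumes "open S" "open T" "smooth_on S f" "smooth_on T f"
  shows "smooth_on (S \<union> T) f"
  by (rule smooth_on_local) (use assms in auto)

lemma Ck_on_linear:
  assumes "bounded_linear L" "open S" 
  shows "Ck_on k S L"
proof (cases k)
  case 0 then show ?thesis using assms(1) by (simp add: linear_continuous_on)
next
  case (Suc n)
  show ?thesis unfolding Suc
    by (rule Ck_on_SucI[OF assms(2) bounded_linear_imp_has_derivative[OF assms(1)] Ck_on_const])
qed

lemma Ck_on_bilinear:
  assumes "bounded_bilinear mul" "open S" "Ck_on k S f" "Ck_on k S g"
  shows "Ck_on k S (\<lambda>x. mul (f x) (g x))"
  using assms(3,4)
proof (induction k arbitrary: f g)
  case 0
  then show ?case using bounded_bilinear.continuous_on[OF assms(1)] by simp
next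
  case (Suc k)
  show ?case
  proof (rule Ck_on_SucI[OF assms(2)])
    fix x assume "x \<in> S"
    then have "(f has_derivative frechet_derivative f (at x)) (at x)"
      "(g has_derivative frechet_derivative g (at x)) (at x)"
      using Suc.prems by (simp_all add: frechet_derivative_works)
    from bounded_bilinear.FDERIV[OF assms(1) this]
    show "((\<lambda>x. mul (f x) (g x)) has_derivative (\<lambda>v. mul (f x) (frechet_derivative g (at x) v) +
            mul (frechet_derivative f (at x) v) (g x))) (at x)" .
  next
    fix v
    show "Ck_on k S (\<lambda>x. mul (f x) (frechet_derivative g (at x) v) +
            mul (frechet_derivative f (at x) v) (g x))"
      using Suc.prems Suc.prems[THEN Ck_on_Suc]
      by (intro Ck_on_add[OF assms(2)] Suc.IH) simp_all
  qed
qed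

lemma Ck_on_sum:
  assumes "open S" "\<And>i. i \<in> I \<Longrightarrow> Ck_on k S (f i)"
  shows "Ck_on k S (\<lambda>x. \<Sum>i\<in>I. f i x)"
  using assms(2)
  by (induction I rule: infinite_finite_induct) (auto intro: Ck_on_const Ck_on_add[OF assms(1)])

lemma Ck_on_inner_const:
  assumes "open S" "Ck_on k S f"
  shows "Ck_on k S (\<lambda>x. f x \<bullet> b)"
  using Ck_on_bilinear[OF bounded_bilinear_inner assms Ck_on_const] .

text \<open>
  By the chain rule the derivative of \<open>g \<circ> f\<close> in direction \<open>v\<close> is a sum, over a basis of the
  middle space, of products of components of the derivative of \<open>f\<close> and partial derivatives of \<open>g\<close>
  along \<open>f\<close>; the induction hypothesis applies to each factor.
\<close>

lemma Ck_on_compose: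
  fixes f :: "'a::real_normed_vector \<Rightarrow> 'b::euclidean_space"
  assumes "open S" "open T" "f ` S \<subseteq> T" "Ck_on k S f" "Ck_on k T g"
  shows "Ck_on k S (\<lambda>x. g (f x))"
  using assms(3-5)
proof (induction k arbitrary: g)
  case 0
  then show ?case by (auto intro: continuous_on_compose2)
next
  case (Suc k)
  have df: "(f has_derivative frechet_derivative f (at x)) (at x)" if "x \<in> S" for x
    using Suc.prems that by (simp add: frechet_derivative_works)
  have dg: "(g has_derivative frechet_derivative g (at y)) (at y)" if "y \<in> T" for y
    using Suc.prems that by (simp add: frechet_derivative_works)
  show ?case
  proof (rule Ck_on_SucI[OF assms(1)])
    fix x assume x: "x \<in> S"
    then have y: "f x \<in> T" using Suc.prems by auto
    have lin: "linear (frechet_derivative g (at (f x)))"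
      using dg[OF y] by (simp add: has_derivative_linear)
    have "(\<lambda>v. frechet_derivative g (at (f x)) (frechet_derivative f (at x) v)) =
      (\<lambda>v. \<Sum>b\<in>Basis. (frechet_derivative f (at x) v \<bullet> b) *\<^sub>R frechet_derivative g (at (f x)) b)"
      (is "?l = ?r")
    proof
      fix v
      have "?l v = frechet_derivative g (at (f x)) (\<Sum>b\<in>Basis. (frechet_derivative f (at x) v \<bullet> b) *\<^sub>R b)"
        by (simp only: euclidean_representation)
      also have "\<dots> = ?r v"
        by (simp add: linear_sum[OF lin] linear_cmul[OF lin])
      finally show "?l v = ?r v" .
    qed
    then show "((\<lambda>x. g (f x)) has_derivative
      (\<lambda>v. \<Sum>b\<in>Basis. (frechet_derivative f (at x) v \<bullet> b) *\<^sub>R frechet_derivative g (at (f x)) b)) (at x)"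
      using has_derivative_compose[OF df[OF x] dg[OF y]] by simp
  next
    fix v
    show "Ck_on k S (\<lambda>x. \<Sum>b\<in>Basis. (frechet_derivative f (at x) v \<bullet> b) *\<^sub>R
        frechet_derivative g (at (f x)) b)"
    proof (intro Ck_on_sum[OF assms(1)] Ck_on_bilinear[OF bounded_bilinear_scaleR assms(1)]
        Ck_on_inner_const[OF assms(1)])
      show "Ck_on k S (\<lambda>x. frechet_derivative f (at x) v)" using Suc.prems by simp
      show "Ck_on k S (\<lambda>x. frechet_derivative g (at (f x)) b)" for b
        by (rule Suc.IH) (use Suc.prems Ck_on_Suc[OF Suc.prems(2)] in auto)
    qed
  qed
qed

context
  fixes S :: "'a::real_normed_vector set"
  assumes S: "open S"
begin

lemma smooth_on_const: "smooth_on S (\<lambda>x. c)"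
  by (simp add: smooth_on_def Ck_on_const)

lemma smooth_on_linear: "bounded_linear L \<Longrightarrow> smooth_on S L"
  by (simp add: smooth_on_def Ck_on_linear S)

lemma smooth_on_bilinear:
  "bounded_bilinear mul \<Longrightarrow> smooth_on S f \<Longrightarrow> smooth_on S g \<Longrightarrow> smooth_on S (\<lambda>x. mul (f x) (g x))"
  by (simp add: smooth_on_def Ck_on_bilinear S)

lemma smooth_on_add: "smooth_on S f \<Longrightarrow> smooth_on S g \<Longrightarrow> smooth_on S (\<lambda>x. f x + g x)"
  by (simp add: smooth_on_def Ck_on_add S)

lemma smooth_on_scaleR:
  "smooth_on S f \<Longrightarrow> smooth_on S g \<Longrightarrow> smooth_on S (\<lambda>x. f x *\<^sub>R g x)"
  using smooth_on_bilinear[OF bounded_bilinear_scaleR] .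

lemma smooth_on_minus: "smooth_on S f \<Longrightarrow> smooth_on S (\<lambda>x. - f x)"
  using smooth_on_scaleR[OF smooth_on_const[of "- 1"]] by simp

lemma smooth_on_diff: "smooth_on S f \<Longrightarrow> smooth_on S g \<Longrightarrow> smooth_on S (\<lambda>x. f x - g x)"
  using smooth_on_add[OF _ smooth_on_minus] by fastforce

lemma smooth_on_mult:
  fixes f :: "'a \<Rightarrow> 'b::real_normed_algebra"
  shows "smooth_on S f \<Longrightarrow> smooth_on S g \<Longrightarrow> smooth_on S (\<lambda>x. f x * g x)"
  by (simp add: smooth_on_def Ck_on_mult S)

lemma smooth_on_power:
  fixes f :: "'a \<Rightarrow> 'b::real_normed_algebra_1"
  shows "smooth_on S f \<Longrightarrow> smooth_on S (\<lambda>x. f x ^ n)"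
  by (induction n) (auto intro: smooth_on_const smooth_on_mult)

lemma smooth_on_compose:
  fixes f :: "'a \<Rightarrow> 'b::euclidean_space"
  shows "smooth_on T g \<Longrightarrow> smooth_on S f \<Longrightarrow> f ` S \<subseteq> T \<Longrightarrow> open T \<Longrightarrow> smooth_on S (\<lambda>x. g (f x))"
  using Ck_on_compose[OF S] by (metis smooth_on_def)

lemma smooth_on_linear_compose:
  fixes f :: "'a \<Rightarrow> 'b::real_normed_vector"
  assumes "bounded_linear L" "smooth_on S f" 
  shows "smooth_on S (\<lambda>x. L (f x))"
proof -
  have b: "bounded_bilinear (\<lambda>(r::real) y. r *\<^sub>R L y)"
    using bounded_bilinear.comp[OF bounded_bilinear_scaleR bounded_linear_ident assms(1)] .
  show ?thesis using smooth_on_bilinear[OF b smooth_on_const[of 1] assms(2)] by simp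
qed

lemma smooth_on_Pair:
  fixes f :: "'a \<Rightarrow> 'b::real_normed_vector" and g :: "'a \<Rightarrow> 'c::real_normed_vector"
  assumes "smooth_on S f" "smooth_on S g"
  shows "smooth_on S (\<lambda>x. (f x, g x))"
proof -
  have "smooth_on S (\<lambda>x. (f x, 0::'c) + (0::'b, g x))"
    by (intro smooth_on_add smooth_on_linear_compose[OF _ assms(1)] smooth_on_linear_compose[OF _ assms(2)]
        bounded_linear_Pair bounded_linear_ident bounded_linear_zero)
  then show ?thesis by simp
qed

lemma smooth_on_fst: 
  fixes f :: "'a \<Rightarrow> 'b::real_normed_vector \<times> 'c::real_normed_vector"
  shows "smooth_on S f \<Longrightarrow> smooth_on S (\<lambda>x. fst (f x))"
  by (rule smooth_on_linear_compose[OF bounded_linear_fst])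

lemma smooth_on_snd: 
  fixes f :: "'a \<Rightarrow> 'b::real_normed_vector \<times> 'c::real_normed_vector"
  shows "smooth_on S f \<Longrightarrow> smooth_on S (\<lambda>x. snd (f x))"
  by (rule smooth_on_linear_compose[OF bounded_linear_snd])

lemma smooth_on_ident: "smooth_on S (\<lambda>x. x)"
  by (rule smooth_on_linear[OF bounded_linear_ident])

lemma smooth_on_cnj: "smooth_on S f \<Longrightarrow> smooth_on S (\<lambda>x. cnj (f x))"
  by (rule smooth_on_linear_compose[OF bounded_linear_cnj])

lemma smooth_on_of_real: "smooth_on S f \<Longrightarrow> smooth_on S (\<lambda>x. of_real (f x) :: complex)"
  by (rule smooth_on_linear_compose[OF bounded_linear_of_real])

end

lemma smooth_on_inverse_nonzero:
  "smooth_on (UNIV - {0}) (inverse :: 'a::{real_normed_field} \<Rightarrow> 'a)"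
  unfolding smooth_on_def
proof
  have op: "open (UNIV - {0::'a})" by (simp add: open_Diff)
  fix k show "Ck_on k (UNIV - {0}) (inverse :: 'a \<Rightarrow> 'a)"
  proof (induction k)
    case 0
    then show ?case by (simp add: continuous_on_inverse continuous_on_id)
  next
    case (Suc k)
    show ?case
    proof (rule Ck_on_SucI[OF op])
      fix x :: 'a assume "x \<in> UNIV - {0}"
      then show "(inverse has_derivative (\<lambda>h. - (inverse x * h * inverse x))) (at x)"
        using has_derivative_inverse'[of x] by simp
    next
      fix v :: 'a
      have "Ck_on k (UNIV - {0}) (\<lambda>x. - (v * (inverse x * inverse x)))"
        using Ck_on_mult[OF op Ck_on_const[of _ _ "-v"] Ck_on_mult[OF op Suc Suc]] by simp
      then show "Ck_on k (UNIV - {0}) (\<lambda>x. - (inverse x * v * inverse x))"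
        by (simp add: mult_ac)
    qed
  qed
qed

lemma smooth_on_inverse:
  fixes f :: "'a::real_normed_vector \<Rightarrow> 'b::{real_normed_field,euclidean_space}"
  assumes "open S" "smooth_on S f" "\<And>x. x \<in> S \<Longrightarrow> f x \<noteq> 0"
  shows "smooth_on S (\<lambda>x. inverse (f x))"
  by (rule smooth_on_compose[OF assms(1) smooth_on_inverse_nonzero assms(2)])
     (use assms(3) in \<open>auto simp: open_Diff\<close>)

lemma smooth_on_divide:
  fixes f :: "'a::real_normed_vector \<Rightarrow> 'b::{real_normed_field,euclidean_space}"
  assumes "open S" "smooth_on S f" "smooth_on S g" "\<And>x. x \<in> S \<Longrightarrow> g x \<noteq> 0"
  shows "smooth_on S (\<lambda>x. f x / g x)"
  unfolding divide_inverse using assms by (intro smooth_on_mult smooth_on_inverse)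

lemma smooth_on_sqrt_pos: "smooth_on {0<..} sqrt"
  unfolding smooth_on_def
proof
  fix k show "Ck_on k {0<..} sqrt"
  proof (induction k)
    case 0
    then show ?case by (simp add: continuous_on_real_sqrt continuous_on_id)
  next
    case (Suc k)
    show ?case
    proof (rule Ck_on_SucI[OF open_greaterThan])
      fix x :: real assume "x \<in> {0<..}"
      then show "(sqrt has_derivative (\<lambda>v. v * (inverse (sqrt x) / 2))) (at x)"
        using DERIV_real_sqrt[of x] unfolding has_field_derivative_def
        by (auto intro: has_derivative_eq_rhs simp: fun_eq_iff simp del: times_divide_eq_right)
    next
      fix v :: real
      have "Ck_on k {0<..} (\<lambda>x. inverse (sqrt x))"
        using smooth_on_inverse_nonzero[where 'a=real]
        by (intro Ck_on_compose[OF open_greaterThan _ _ Suc, of "UNIV - {0}"])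
           (auto simp: open_Diff smooth_on_def)
      from Ck_on_mult[OF open_greaterThan Ck_on_const[of _ _ "v/2"] this]
      show "Ck_on k {0<..} (\<lambda>x. v * (inverse (sqrt x) / 2))" by (simp add: mult_ac)
    qed
  qed
qed

lemma smooth_on_sqrt:
  assumes "open S" "smooth_on S f" "\<And>x. x \<in> S \<Longrightarrow> f x > 0"
  shows "smooth_on S (\<lambda>x. sqrt (f x))"
  by (rule smooth_on_compose[OF assms(1) smooth_on_sqrt_pos assms(2)])
     (use assms(3) in \<open>auto\<close>)

lemma smooth_on_holomorphic:
  assumes "open W" "f holomorphic_on W"
  shows "smooth_on W f"
  unfolding smooth_on_def
proof
  fix k show "Ck_on k W f"
    using assms(2)
  proof (induction k arbitrary: f)
    case 0
    then show ?case by (simp add: holomorphic_on_imp_continuous_on)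
  next
    case (Suc k)
    show ?case
    proof (rule Ck_on_SucI[OF assms(1)])
      fix x assume "x \<in> W"
      then have "(f has_field_derivative deriv f x) (at x)"
        using Suc.prems assms(1) by (rule holomorphic_derivI[rotated 2])
      then show "(f has_derivative (\<lambda>v. v * deriv f x)) (at x)"
        unfolding has_field_derivative_def by (rule has_derivative_eq_rhs) (simp add: fun_eq_iff)
    next
      fix v
      show "Ck_on k W (\<lambda>x. v * deriv f x)"
        by (intro Ck_on_mult[OF assms(1)] Ck_on_const Suc.IH holomorphic_deriv Suc.prems assms(1))
    qed
  qed
qed

section \<open>Smooth step functions\<close>

text \<open>
  The functions \<open>p(1/x) exp(-1/x)\<close>, extended by 0 to \<open>x \<le> 0\<close>. Allowing all polynomials \<open>p\<close> makes
  this family closed under differentiation, so that smoothness follows by induction.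
\<close>

definition flat :: "real poly \<Rightarrow> real \<Rightarrow> real" where
  "flat p x = (if x > 0 then poly p (1 / x) * exp (- (1 / x)) else 0)"

lemma poly_exp_decay: "((\<lambda>y. poly p y * exp (- y)) \<longlongrightarrow> 0) at_top" for p :: "real poly"
proof -
  have "((\<lambda>y. \<Sum>i\<le>degree p. coeff p i * (y ^ i / exp y)) \<longlongrightarrow> (\<Sum>i\<le>degree p. coeff p i * 0)) at_top"
    by (intro tendsto_intros tendsto_power_div_exp_0)
  then show ?thesis
    by (simp add: poly_altdef sum_distrib_right exp_minus divide_inverse mult.assoc)
qed

lemma flat_tendsto_0: "(flat p \<longlongrightarrow> 0) (at_right 0)"
proof -
  have "((\<lambda>x. poly p (inverse x) * exp (- inverse x)) \<longlongrightarrow> 0) (at_right 0)"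
    using filterlim_compose[OF poly_exp_decay filterlim_inverse_at_top_right] .
  moreover have "\<forall>\<^sub>F x in at_right 0. poly p (inverse x) * exp (- inverse x) = flat p x"
    by (auto simp: eventually_at_filter flat_def inverse_eq_divide)
  ultimately show ?thesis by (rule Lim_transform_eventually)
qed

lemma flat_has_derivative:
  "(flat p has_real_derivative flat ([:0, 0, 1:] * (p - pderiv p)) x) (at x)"
proof -
  consider "x > 0" | "x < 0" | "x = 0" by linarith
  then show ?thesis
  proof cases
    case 1
    have "((\<lambda>x. poly p (1 / x) * exp (- (1 / x))) has_real_derivative
       flat ([:0, 0, 1:] * (p - pderiv p)) x) (at x)"
      using 1 by (auto intro!: derivative_eq_intros DERIV_chain2[OF poly_DERIV]
          simp: flat_def field_simps power2_eq_square)
    then show ?thesis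
      by (rule has_field_derivative_transform_within_open[of _ _ _ "{0<..}"])
         (use 1 in \<open>auto simp: flat_def\<close>)
  next
    case 2
    have "((\<lambda>x. 0) has_real_derivative flat ([:0, 0, 1:] * (p - pderiv p)) x) (at x)"
      using 2 by (simp add: flat_def)
    then show ?thesis
      by (rule has_field_derivative_transform_within_open[of _ _ _ "{..<0}"])
         (use 2 in \<open>auto simp: flat_def\<close>)
  next
    case 3
    have "((\<lambda>h. (flat p (0 + h) - flat p 0) / h) \<longlongrightarrow> 0) (at 0)"
    proof (rule filterlim_split_at)
      have "\<forall>\<^sub>F x in at_right 0. flat (pCons 0 p) x = (flat p (0 + x) - flat p 0) / x"
        by (auto simp: eventually_at_filter flat_def)
      from Lim_transform_eventually[OF flat_tendsto_0 this]
      show "((\<lambda>h. (flat p (0 + h) - flat p 0) / h) \<longlongrightarrow> 0) (at_right 0)" .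
      have "\<forall>\<^sub>F x in at_left 0. 0 = (flat p (0 + x) - flat p 0) / x"
        by (auto simp: eventually_at_filter flat_def)
      from Lim_transform_eventually[OF tendsto_const this]
      show "((\<lambda>h. (flat p (0 + h) - flat p 0) / h) \<longlongrightarrow> 0) (at_left 0)" .
    qed
    then show ?thesis using 3 by (simp add: DERIV_def flat_def)
  qed
qed

lemma smooth_on_flat: "smooth_on UNIV (flat p)"
  unfolding smooth_on_def
proof
  fix k show "Ck_on k UNIV (flat p)"
  proof (induction k arbitrary: p)
    case 0
    then show ?case
      using DERIV_isCont[OF flat_has_derivative] by (auto intro: continuous_at_imp_continuous_on)
  next
    case (Suc k)
    show ?case
    proof (rule Ck_on_SucI[OF open_UNIV])
      fix x show "(flat p has_derivative (\<lambda>v. v * flat ([:0, 0, 1:] * (p - pderiv p)) x)) (at x)"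
        using flat_has_derivative[of p x] unfolding has_field_derivative_def
        by (rule has_derivative_eq_rhs) (simp add: fun_eq_iff)
      show "Ck_on k UNIV (\<lambda>x. v * flat ([:0, 0, 1:] * (p - pderiv p)) x)" for v
        by (intro Ck_on_mult Ck_on_const Suc open_UNIV)
    qed
  qed
qed

text \<open>
  With \<open>f = flat 1\<close>, the quotient of \<open>f(b - x)\<close> by \<open>f(b - x) + f(x - a)\<close> has the required values, and
  its denominator never vanishes because \<open>a < b\<close>.
\<close>

lemma smooth_step_exists:
  fixes a b :: real assumes "a < b"
  obtains s :: "real \<Rightarrow> real" where "smooth_on UNIV s" "\<And>x. x \<le> a \<Longrightarrow> s x = 1" "\<And>x. x \<ge> b \<Longrightarrow> s x = 0"
proof
  let ?f = "flat 1"
  define s where "s = (\<lambda>x. ?f (b - x) / (?f (b - x) + ?f (x - a)))"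
  have pos: "?f x > 0" if "x > 0" for x using that by (simp add: flat_def)
  have nn: "?f x \<ge> 0" for x by (simp add: flat_def)
  have "?f (b - x) + ?f (x - a) > 0" for x
    using pos[of "b-x"] pos[of "x-a"] nn[of "b-x"] nn[of "x-a"] assms by (cases "x < b") auto
  then have nz: "?f (b - x) + ?f (x - a) \<noteq> 0" for x
    by (metis less_irrefl)
  show "smooth_on UNIV s"
    unfolding s_def using nz
    by (intro smooth_on_divide smooth_on_add smooth_on_compose[OF _ smooth_on_flat] 
        smooth_on_diff smooth_on_const smooth_on_ident open_UNIV) auto
  show "s x = 1" if "x \<le> a" for x
    using that assms pos[of "b - x"] unfolding s_def by (simp add: flat_def)
  show "s x = 0" if "x \<ge> b" for x
    using that unfolding s_def by (simp add: flat_def)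
qed

section \<open>Integrals depending on a parameter\<close>

text \<open>
  Differentiation under the integral sign, on a ball around \<open>p\<close>, where the derivative of the
  integrand in the direction of the parameter is continuous as a map into bounded linear
  operators.
\<close>

lemma has_derivative_param_integral:
  fixes H :: "'a::euclidean_space \<times> real \<Rightarrow> 'b::euclidean_space"
  assumes "open \<Omega>" "open S" "S \<times> {a..b} \<subseteq> \<Omega>" and H: "Ck_on (Suc 0) \<Omega> H" and "p \<in> S"
  shows "((\<lambda>p. integral {a..b} (\<lambda>s. H (p, s))) has_derivative
    (\<lambda>v. integral {a..b} (\<lambda>s. frechet_derivative H (at (p, s)) (v, 0)))) (at p)"
proof -
  obtain e where e: "e > 0" "ball p e \<subseteq> S" using assms openE by blast
  define fx where "fx = (\<lambda>p s. Blinfun (\<lambda>v. frechet_derivative H (at (p, s)) (v, 0)))"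
  have in\<Omega>: "(q, s) \<in> \<Omega>" if "q \<in> ball p e" "s \<in> {a..b}" for q s
  proof -
    have "q \<in> S" using e that by auto
    then show ?thesis using assms(3) that by blast
  qed
  have dH: "(H has_derivative frechet_derivative H (at x)) (at x)" if "x \<in> \<Omega>" for x
    using H that by (simp add: frechet_derivative_works)
  have fx: "blinfun_apply (fx q s) = (\<lambda>v. frechet_derivative H (at (q, s)) (v, 0))"
    if "q \<in> ball p e" "s \<in> {a..b}" for q s
  proof -
    have "bounded_linear (frechet_derivative H (at (q, s)))"
      using dH[OF in\<Omega>[OF that]] by (rule has_derivative_bounded_linear)
    then have "bounded_linear (\<lambda>v. frechet_derivative H (at (q, s)) (v, 0))"
      by (rule bounded_linear_compose[of _ "\<lambda>v. (v, 0)"]) (intro bounded_linear_Pair bounded_linear_ident bounded_linear_zero)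
    then show ?thesis unfolding fx_def by (rule bounded_linear_Blinfun_apply)
  qed
  have cfx: "continuous_on (ball p e \<times> cbox a b) (\<lambda>(q, s). fx q s)"
  proof (rule continuous_on_blinfun_componentwise)
    fix i :: 'a
    have "continuous_on (ball p e \<times> cbox a b) (\<lambda>x. frechet_derivative H (at x) (i, 0))"
      by (rule continuous_on_subset[of \<Omega>]) (use H in\<Omega> in auto)
    then show "continuous_on (ball p e \<times> cbox a b) (\<lambda>x. blinfun_apply (case x of (q, s) \<Rightarrow> fx q s) i)"
      by (rule continuous_on_eq) (auto simp: fx)
  qed
  have cont: "continuous_on {a..b} (\<lambda>s. H (q, s))" if "q \<in> ball p e" for q
    by (rule continuous_on_compose2[of \<Omega> H])
       (use H in\<Omega> that in \<open>auto intro!: continuous_intros differentiable_imp_continuous_on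
          simp: differentiable_on_def differentiable_at_withinI\<close>)
  have "((\<lambda>q. integral (cbox a b) (\<lambda>s. H (q, s))) has_derivative
    blinfun_apply (integral (cbox a b) (fx p))) (at p within ball p e)"
  proof (rule leibniz_rule[OF _ _ cfx])
    fix q s assume qs: "q \<in> ball p e" "s \<in> cbox a b"
    then have s: "s \<in> {a..b}" by simp
    have "((\<lambda>q. (q, s)) has_derivative (\<lambda>v. (v, 0))) (at q)"
      by (auto intro!: derivative_eq_intros)
    from has_derivative_compose[OF this dH[OF in\<Omega>[OF qs(1) s]]]
    show "((\<lambda>q. H (q, s)) has_derivative blinfun_apply (fx q s)) (at q within ball p e)"
      unfolding fx[OF qs(1) s] by (rule has_derivative_at_withinI)
  next
    fix q assume "q \<in> ball p e"
    then show "(\<lambda>s. H (q, s)) integrable_on cbox a b"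
      using cont by (auto intro!: integrable_continuous_real)
  qed (use e in auto)
  then have 1: "((\<lambda>q. integral {a..b} (\<lambda>s. H (q, s))) has_derivative
    blinfun_apply (integral {a..b} (fx p))) (at p)"
    using e by (simp add: at_within_open[of p "ball p e"])
  have int: "fx p integrable_on {a..b}"
  proof (rule integrable_continuous_real)
    have "continuous_on {a..b} (\<lambda>s. (\<lambda>(q, s). fx q s) (p, s))"
      by (rule continuous_on_compose2[OF cfx]) (use e in \<open>auto intro!: continuous_intros\<close>)
    then show "continuous_on {a..b} (fx p)" by simp
  qed
  have "blinfun_apply (integral {a..b} (fx p)) =
     (\<lambda>v. integral {a..b} (\<lambda>s. frechet_derivative H (at (p, s)) (v, 0)))"
  proof
    fix v
    have "blinfun_apply (integral {a..b} (fx p)) v = integral {a..b} (\<lambda>s. blinfun_apply (fx p s) v)"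
      using blinfun_apply_integral[OF int] by simp
    also have "\<dots> = integral {a..b} (\<lambda>s. frechet_derivative H (at (p, s)) (v, 0))"
      by (rule Henstock_Kurzweil_Integration.integral_cong) (use fx e in auto)
    finally show "blinfun_apply (integral {a..b} (fx p)) v = \<dots>" .
  qed
  with 1 show ?thesis by simp
qed

lemma Ck_on_param_integral:
  fixes H :: "'a::euclidean_space \<times> real \<Rightarrow> 'b::euclidean_space"
  assumes "open \<Omega>" "open S" "S \<times> {a..b} \<subseteq> \<Omega>" "Ck_on k \<Omega> H"
  shows "Ck_on k S (\<lambda>p. integral {a..b} (\<lambda>s. H (p, s)))"
  using assms(4)
proof (induction k arbitrary: H)
  case 0
  then have "continuous_on (S \<times> cbox a b) (\<lambda>(p, s). H (p, s))"
    using assms(3) by (auto intro: continuous_on_subset)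
  from integral_continuous_on_param[OF this] show ?case by simp
next
  case (Suc k)
  have "Ck_on (Suc 0) \<Omega> H"
    using Suc.prems by (induction k) (auto dest: Ck_on_Suc simp del: Ck_on.simps)
  from has_derivative_param_integral[OF assms(1-3) this]
  show ?case
  proof (rule Ck_on_SucI[OF assms(2)])
    show "Ck_on k S (\<lambda>p. integral {a..b} (\<lambda>s. frechet_derivative H (at (p, s)) (v, 0)))" for v
      using Suc.IH[of "\<lambda>x. frechet_derivative H (at x) (v, 0)"] Suc.prems by simp
  qed
qed

lemma smooth_on_param_integral:
  fixes H :: "'a::euclidean_space \<times> real \<Rightarrow> 'b::euclidean_space"
  assumes "open \<Omega>" "open S" "S \<times> {a..b} \<subseteq> \<Omega>" "smooth_on \<Omega> H"
  shows "smooth_on S (\<lambda>p. integral {a..b} (\<lambda>s. H (p, s)))"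
  using Ck_on_param_integral[OF assms(1-3), of _ H] assms(4) by (simp add: smooth_on_def)

lemma frechet_derivative_param_integral:
  fixes H :: "'a::euclidean_space \<times> real \<Rightarrow> 'b::euclidean_space"
  assumes "open \<Omega>" "open S" "S \<times> {a..b} \<subseteq> \<Omega>" "smooth_on \<Omega> H" "p \<in> S"
  shows "frechet_derivative (\<lambda>p. integral {a..b} (\<lambda>s. H (p, s))) (at p) v =
    integral {a..b} (\<lambda>s. frechet_derivative H (at (p, s)) (v, 0))"
  using frechet_derivative_at[OF has_derivative_param_integral[OF assms(1-3) _ assms(5)]] assms(4)
  unfolding smooth_on_def by metis

lemma frechet_derivative_compose:
  assumes "(f has_derivative f') (at x)" "smooth_on T g" "f x \<in> T"
  shows "frechet_derivative (\<lambda>x. g (f x)) (at x) v = frechet_derivative g (at (f x)) (f' v)"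
  using frechet_derivative_at[OF has_derivative_compose[OF assms(1) smooth_on_has_derivative[OF assms(2,3)]]]
  by metis

section \<open>Primitives along the vertical direction\<close>

text \<open>
  The integral of \<open>h(z, s)\<close> over \<open>s\<close> from \<open>\<tau>\<close> to \<open>t\<close>, rescaled to the unit interval so that it is an
  integral with a parameter over a fixed domain.
\<close>

definition vertical_primitive :: "real \<Rightarrow> (complex \<times> real \<Rightarrow> complex) \<Rightarrow> complex \<times> real \<Rightarrow> complex" where
  "vertical_primitive \<tau> h p = of_real (snd p - \<tau>) * integral {0..1} (\<lambda>s. h (fst p, \<tau> + s * (snd p - \<tau>)))"

definition pd_t :: "(complex \<times> real \<Rightarrow> complex) \<Rightarrow> complex \<times> real \<Rightarrow> complex" where
  "pd_t f p = frechet_derivative f (at p) (0, 1)"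

definition pd_zbar :: "(complex \<times> real \<Rightarrow> complex) \<Rightarrow> complex \<times> real \<Rightarrow> complex" where
  "pd_zbar f p = (frechet_derivative f (at p) (1, 0) + \<i> * frechet_derivative f (at p) (\<i>, 0)) / 2"

lemma smooth_on_pd_t: "smooth_on S f \<Longrightarrow> smooth_on S (pd_t f)"
  unfolding pd_t_def using smooth_on_frechet_derivative by blast

lemma pd_t_vector_derivative:
  assumes "smooth_on \<Omega> f" "(z, t) \<in> \<Omega>"
  shows "((\<lambda>t. f (z, t)) has_vector_derivative pd_t f (z, t)) (at t within A)"
proof -
  have "((\<lambda>t. (z, t)) has_derivative (\<lambda>v. (0, v))) (at t)"
    by (auto intro!: derivative_eq_intros)
  from has_derivative_compose[OF this smooth_on_has_derivative[OF assms]]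
  have "((\<lambda>t. f (z, t)) has_derivative (\<lambda>v. frechet_derivative f (at (z, t)) (0, v))) (at t within A)"
    by (rule has_derivative_at_withinI)
  moreover have "frechet_derivative f (at (z, t)) (0, v) = v *\<^sub>R pd_t f (z, t)" for v
    using linear_cmul[OF has_derivative_linear[OF smooth_on_has_derivative[OF assms]], of v "(0, 1)"]
    by (simp add: pd_t_def)
  ultimately show ?thesis unfolding has_vector_derivative_def by simp
qed

context
  fixes \<Omega> S :: "(complex \<times> real) set" and \<tau> :: real and h :: "complex \<times> real \<Rightarrow> complex"
  assumes op: "open \<Omega>" "open S"
    and seg: "\<And>z t s. (z, t) \<in> S \<Longrightarrow> 0 \<le> s \<Longrightarrow> s \<le> 1 \<Longrightarrow> (z, \<tau> + s * (t - \<tau>)) \<in> \<Omega>"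
    and h: "smooth_on \<Omega> h"
begin

lemma vertical_primitive_of_pd_t: "p \<in> S \<Longrightarrow> vertical_primitive \<tau> (pd_t h) p = h p - h (fst p, \<tau>)"
proof -
  assume "p \<in> S"
  then obtain z t where p: "p = (z, t)" "(z, t) \<in> S" by (cases p) auto
  have "((\<lambda>s. of_real (t - \<tau>) * pd_t h (z, \<tau> + s * (t - \<tau>))) has_integral
      h (z, \<tau> + 1 * (t - \<tau>)) - h (z, \<tau> + 0 * (t - \<tau>))) {0..1}"
  proof (rule fundamental_theorem_of_calculus)
    fix s :: real assume s: "s \<in> {0..1}"
    have "((\<lambda>s. \<tau> + s * (t - \<tau>)) has_vector_derivative (t - \<tau>)) (at s within {0..1})"
      by (auto intro!: derivative_eq_intros)
    from vector_diff_chain_within[OF this pd_t_vector_derivative[OF h seg[OF p(2)]]] s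
    show "((\<lambda>s. h (z, \<tau> + s * (t - \<tau>))) has_vector_derivative
      of_real (t - \<tau>) * pd_t h (z, \<tau> + s * (t - \<tau>))) (at s within {0..1})"
      by (simp add: o_def scaleR_conv_of_real)
  qed simp
  from integral_unique[OF this] show ?thesis
    by (simp add: vertical_primitive_def p)
qed

text \<open>
  The integrand of a vertical primitive lives on the preimage of \<open>\<Omega>\<close> under
  \<open>((z, t), s) \<mapsto> (z, \<tau> + s (t - \<tau>))\<close>.
\<close>

lemma vertical_integrand_smooth:
  defines "H \<equiv> \<lambda>x. h (fst (fst x), \<tau> + snd x * (snd (fst x) - \<tau>))"
  shows "\<exists>\<Omega>'. open \<Omega>' \<and> S \<times> {0..1} \<subseteq> \<Omega>' \<and> smooth_on \<Omega>' H \<and>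
     (\<forall>x\<in>\<Omega>'. (fst (fst x), \<tau> + snd x * (snd (fst x) - \<tau>)) \<in> \<Omega>)"
proof -
  define f :: "(complex \<times> real) \<times> real \<Rightarrow> complex \<times> real"
    where "f = (\<lambda>x. (fst (fst x), \<tau> + snd x * (snd (fst x) - \<tau>)))"
  have sf: "smooth_on UNIV f" unfolding f_def
    by (intro smooth_on_Pair smooth_on_fst smooth_on_snd smooth_on_add smooth_on_mult smooth_on_diff
        smooth_on_const smooth_on_ident open_UNIV)
  have o: "open (f -` \<Omega>)"
    using open_vimage[OF op(1)] smooth_on_continuous[OF sf] by blast
  moreover have "S \<times> {0..1} \<subseteq> f -` \<Omega>" using seg by (auto simp: f_def)
  moreover have "smooth_on (f -` \<Omega>) (\<lambda>x. h (f x))"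
    by (rule smooth_on_compose[OF o h smooth_on_subset[OF sf]]) (auto simp: op)
  ultimately show ?thesis unfolding H_def f_def by (intro exI[of _ "f -` \<Omega>"]) (auto simp: f_def)
qed

lemma smooth_on_vertical_primitive: "smooth_on S (vertical_primitive \<tau> h)"
proof -
  from vertical_integrand_smooth obtain \<Omega>' where O: "open \<Omega>'" "S \<times> {0..1} \<subseteq> \<Omega>'"
    "smooth_on \<Omega>' (\<lambda>x. h (fst (fst x), \<tau> + snd x * (snd (fst x) - \<tau>)))" by blast
  from smooth_on_param_integral[OF O(1) op(2) O(2,3)]
  have "smooth_on S (\<lambda>p. integral {0..1} (\<lambda>s. h (fst p, \<tau> + s * (snd p - \<tau>))))" by simp
  then show ?thesis unfolding vertical_primitive_def
    by (intro smooth_on_mult smooth_on_of_real smooth_on_diff smooth_on_snd smooth_on_ident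
        smooth_on_const op)
qed

text \<open>
  The horizontal derivative passes under the integral. For the vertical one, differentiation under
  the integral produces the \<open>s\<close>-derivative of \<open>s h(z, \<tau> + s (t - \<tau>))\<close>.
\<close>

lemma frechet_derivative_vertical_primitive:
  assumes "p \<in> S"
  shows "frechet_derivative (vertical_primitive \<tau> h) (at p) (w, 0) =
           vertical_primitive \<tau> (\<lambda>q. frechet_derivative h (at q) (w, 0)) p" (is ?th1)
    and "frechet_derivative (vertical_primitive \<tau> h) (at p) (0, 1) = h p" (is ?th2)
proof -
  obtain z t where p: "p = (z, t)" by (cases p)
  from vertical_integrand_smooth obtain \<Omega>' where O: "open \<Omega>'" "S \<times> {0..1} \<subseteq> \<Omega>'"
    "smooth_on \<Omega>' (\<lambda>x. h (fst (fst x), \<tau> + snd x * (snd (fst x) - \<tau>)))"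
     "\<forall>x\<in>\<Omega>'. (fst (fst x), \<tau> + snd x * (snd (fst x) - \<tau>)) \<in> \<Omega>" by blast
  let ?H = "\<lambda>x. h (fst (fst x), \<tau> + snd x * (snd (fst x) - \<tau>))"
  let ?I = "\<lambda>p. integral {0..1} (\<lambda>s. ?H (p, s))"
  have dH: "frechet_derivative ?H (at (p, s)) (v, 0) =
      frechet_derivative h (at (z, \<tau> + s * (t - \<tau>))) (fst v, s * snd v)" if "s \<in> {0..1}" for s v
  proof -
    have m: "(p, s) \<in> \<Omega>'" using O(2) assms that by auto
    have d: "((\<lambda>x :: (complex \<times> real) \<times> real. (fst (fst x), \<tau> + snd x * (snd (fst x) - \<tau>))) has_derivative
      (\<lambda>v. (fst (fst v), snd v * (t - \<tau>) + s * snd (fst v)))) (at (p, s))"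
      by (auto intro!: derivative_eq_intros simp: p fun_eq_iff)
    show ?thesis
      using frechet_derivative_compose[OF d h, of "(v, 0)"] O(4) m by (force simp: p)
  qed
  have dI: "(?I has_derivative (\<lambda>v. integral {0..1} (\<lambda>s. frechet_derivative ?H (at (p, s)) (v, 0)))) (at p)"
    by (rule has_derivative_param_integral[OF O(1) op(2) O(2) _ assms])
       (use O(3) in \<open>simp add: smooth_on_def del: Ck_on.simps\<close>)
  have "((\<lambda>p. of_real (snd p - \<tau>) * ?I p) has_derivative
    (\<lambda>v. of_real (snd p - \<tau>) * integral {0..1} (\<lambda>s. frechet_derivative ?H (at (p, s)) (v, 0)) +
       of_real (snd v) * ?I p)) (at p)"
    by (rule has_derivative_mult[OF _ dI]) (auto intro!: derivative_eq_intros)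
  then have fd: "frechet_derivative (vertical_primitive \<tau> h) (at p) =
    (\<lambda>v. of_real (snd p - \<tau>) * integral {0..1} (\<lambda>s. frechet_derivative ?H (at (p, s)) (v, 0)) +
       of_real (snd v) * ?I p)"
    using frechet_derivative_at by (fastforce simp: vertical_primitive_def[abs_def])
  have "integral {0..1} (\<lambda>s. frechet_derivative ?H (at (p, s)) ((w, 0), 0)) = 
    integral {0..1} (\<lambda>s. frechet_derivative h (at (z, \<tau> + s * (t - \<tau>))) (w, 0))"
    by (rule Henstock_Kurzweil_Integration.integral_cong) (simp add: dH)
  then show ?th1 unfolding fd by (simp add: vertical_primitive_def p)
  have "((\<lambda>s. of_real (t - \<tau>) * frechet_derivative ?H (at (p, s)) ((0, 1), 0) + ?H (p, s)) has_integral
      of_real 1 * h (z, \<tau> + 1 * (t - \<tau>)) - of_real 0 * h (z, \<tau> + 0 * (t - \<tau>))) {0..1}"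
  proof (rule fundamental_theorem_of_calculus)
    fix s :: real assume s: "s \<in> {0..1}"
    then have m: "(z, \<tau> + s * (t - \<tau>)) \<in> \<Omega>" using seg assms p by auto
    have "((\<lambda>s. \<tau> + s * (t - \<tau>)) has_vector_derivative (t - \<tau>)) (at s within {0..1})"
      by (auto intro!: derivative_eq_intros)
    from vector_diff_chain_within[OF this pd_t_vector_derivative[OF h m]]
    have 1: "((\<lambda>s. h (z, \<tau> + s * (t - \<tau>))) has_vector_derivative
      of_real (t - \<tau>) * pd_t h (z, \<tau> + s * (t - \<tau>))) (at s within {0..1})"
      by (simp add: o_def scaleR_conv_of_real)
    have 2: "((\<lambda>s. complex_of_real s) has_vector_derivative 1) (at s within {0..1})"
      by (auto intro!: derivative_eq_intros)
    have lin: "frechet_derivative h (at (z, \<tau> + s * (t - \<tau>))) (0, s) =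
        of_real s * pd_t h (z, \<tau> + s * (t - \<tau>))"
      using linear_cmul[OF has_derivative_linear[OF smooth_on_has_derivative[OF h m]], of s "(0, 1)"]
      by (simp add: pd_t_def scaleR_conv_of_real)
    show "((\<lambda>s. of_real s * h (z, \<tau> + s * (t - \<tau>))) has_vector_derivative
       (of_real (t - \<tau>) * frechet_derivative ?H (at (p, s)) ((0, 1), 0) + ?H (p, s))) (at s within {0..1})"
      using has_vector_derivative_mult[OF 2 1] dH[OF s, of "(0, 1)"]
      by (simp add: p lin mult_ac)
  qed simp
  from integral_unique[OF this]
  have 3: "integral {0..1} (\<lambda>s. of_real (t - \<tau>) * frechet_derivative ?H (at (p, s)) ((0, 1), 0) + ?H (p, s)) = h p"
    by (simp add: p)
  have c1: "continuous_on {0..1} (\<lambda>s. frechet_derivative ?H (at (p, s)) ((0, 1), 0))"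
    by (rule continuous_on_compose2[OF smooth_on_continuous[OF smooth_on_frechet_derivative[OF O(3)]]])
       (use O(2) assms in \<open>auto intro!: continuous_intros\<close>)
  have c2: "continuous_on {0..1} (\<lambda>s. ?H (p, s))"
    by (rule continuous_on_compose2[OF smooth_on_continuous[OF O(3)]])
       (use O(2) assms in \<open>auto intro!: continuous_intros\<close>)
  have "integral {0..1} (\<lambda>s. of_real (t - \<tau>) * frechet_derivative ?H (at (p, s)) ((0, 1), 0) + ?H (p, s))
    = of_real (t - \<tau>) * integral {0..1} (\<lambda>s. frechet_derivative ?H (at (p, s)) ((0, 1), 0)) + ?I p"
    by (subst Henstock_Kurzweil_Integration.integral_add)
       (intro integrable_continuous_real continuous_intros c1 c2, intro integrable_continuous_real c2,
        simp)
  with 3 show ?th2 unfolding fd by (simp add: p)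
qed

lemma pd_t_vertical_primitive: "p \<in> S \<Longrightarrow> pd_t (vertical_primitive \<tau> h) p = h p"
  using frechet_derivative_vertical_primitive(2) by (simp add: pd_t_def)

lemma pd_zbar_vertical_primitive: "p \<in> S \<Longrightarrow> pd_zbar (vertical_primitive \<tau> h) p = vertical_primitive \<tau> (pd_zbar h) p"
proof -
  assume p: "p \<in> S"
  have c: "continuous_on {0..1} (\<lambda>s. frechet_derivative h (at (fst p, \<tau> + s * (snd p - \<tau>))) v)" for v
    by (rule continuous_on_compose2[OF smooth_on_continuous[OF smooth_on_frechet_derivative[OF h]]])
       (use seg p in \<open>auto intro!: continuous_intros simp: prod.expand\<close>)
  have "vertical_primitive \<tau> (pd_zbar h) p = (vertical_primitive \<tau> (\<lambda>q. frechet_derivative h (at q) (1, 0)) p +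
     \<i> * vertical_primitive \<tau> (\<lambda>q. frechet_derivative h (at q) (\<i>, 0)) p) / 2"
  proof -
    let ?D = "\<lambda>v s. frechet_derivative h (at (fst p, \<tau> + s * (snd p - \<tau>))) v"
    have "integral {0..1} (\<lambda>s. ?D (1, 0) s + \<i> * ?D (\<i>, 0) s) =
       integral {0..1} (?D (1, 0)) + \<i> * integral {0..1} (?D (\<i>, 0))"
      by (subst Henstock_Kurzweil_Integration.integral_add)
         (intro integrable_continuous_real continuous_intros c, intro integrable_continuous_real
           continuous_intros c, simp)
    then show ?thesis
      unfolding pd_zbar_def vertical_primitive_def by (simp add: algebra_simps)
  qed
  then show ?thesis using frechet_derivative_vertical_primitive(1)[OF p] by (simp add: pd_zbar_def)
qed

end

text \<open>
  Symmetry of second derivatives, from differentiation under the integral: the horizontal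
  derivative of \<open>f(z,t) - f(z,t\<^sub>0)\<close>, written as a vertical primitive of \<open>\<partial>\<^sub>t f\<close>,
  is the vertical primitive of the horizontal derivative of \<open>\<partial>\<^sub>t f\<close>; then take the
  \<open>t\<close>-derivative.
\<close>

lemma frechet_derivative_commute_t:
  fixes f :: "complex \<times> real \<Rightarrow> complex"
  assumes "open \<Omega>" "smooth_on \<Omega> f" "p \<in> \<Omega>"
  shows "frechet_derivative (\<lambda>q. frechet_derivative f (at q) (w, 0)) (at p) (0, 1) =
         frechet_derivative (\<lambda>q. frechet_derivative f (at q) (0, 1)) (at p) (w, 0)"
proof -
  obtain z0 t0 where p: "p = (z0, t0)" by (cases p)
  obtain A B where AB: "open A" "open B" "z0 \<in> A" "t0 \<in> B" "A \<times> B \<subseteq> \<Omega>"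
    using open_prod_elim[OF assms(1,3)] p by (metis mem_Sigma_iff)
  obtain e where e: "e > 0" "ball t0 e \<subseteq> B" using AB openE by blast
  \<comment> \<open>A neighbourhood that contains the vertical segments from height \<open>t\<^sub>0\<close>.\<close>
  define S where "S = A \<times> ball t0 e"
  have S: "open S" "p \<in> S" "S \<subseteq> \<Omega>" using AB e by (auto simp: S_def open_Times p)
  have seg: "(z, t0 + s * (t - t0)) \<in> \<Omega>" if "(z, t) \<in> S" "0 \<le> s" "s \<le> 1" for z t s
  proof -
    have "\<bar>s * (t - t0)\<bar> \<le> 1 * \<bar>t - t0\<bar>"
      unfolding abs_mult by (rule mult_right_mono) (use that in auto)
    then have "t0 + s * (t - t0) \<in> ball t0 e"
      using that by (auto simp: S_def dist_real_def)
    then show ?thesis using that AB(5) e by (auto simp: S_def)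
  qed
  define D where "D = (\<lambda>q. frechet_derivative f (at q) (w, 0))"
  define G where "G = pd_t f"
  have G: "smooth_on \<Omega> G" unfolding G_def using assms smooth_on_pd_t by blast
  have D: "smooth_on \<Omega> D" unfolding D_def using assms smooth_on_frechet_derivative by blast
  have 1: "vertical_primitive t0 (\<lambda>q. frechet_derivative G (at q) (w, 0)) q = D q - D (fst q, t0)" if q: "q \<in> S" for q
  proof -
    have m: "(fst q, t0) \<in> \<Omega>" using seg[of "fst q" "snd q" 0] q by simp
    have "vertical_primitive t0 (\<lambda>q. frechet_derivative G (at q) (w, 0)) q = frechet_derivative (vertical_primitive t0 G) (at q) (w, 0)"
      using frechet_derivative_vertical_primitive(1)[OF assms(1) S(1) seg G q] by simp
    also have "\<dots> = frechet_derivative (\<lambda>q. f q - f (fst q, t0)) (at q) (w, 0)"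
    proof -
      have d: "vertical_primitive t0 G differentiable (at q)"
        using smooth_on_differentiable[OF smooth_on_vertical_primitive[OF assms(1) S(1) seg G] q] .
      show ?thesis
        by (subst frechet_derivative_transform_within_open[OF d S(1) q, of "\<lambda>q. f q - f (fst q, t0)"])
           (use vertical_primitive_of_pd_t[OF assms(1) S(1) seg assms(2)] in \<open>auto simp: G_def\<close>)
    qed
    also have "\<dots> = D q - D (fst q, t0)"
    proof -
      have "((\<lambda>q. (fst q, t0)) has_derivative (\<lambda>v. (fst v, 0))) (at q)"
        by (auto intro!: derivative_eq_intros)
      note has_derivative_compose[OF this smooth_on_has_derivative[OF assms(2) m]]
      from has_derivative_diff[OF smooth_on_has_derivative[OF assms(2) subsetD[OF S(3) q]] this]
      have "((\<lambda>q. f q - f (fst q, t0)) has_derivative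
        (\<lambda>v. frechet_derivative f (at q) v - frechet_derivative f (at (fst q, t0)) (fst v, 0))) (at q)" .
      from frechet_derivative_at[OF this, symmetric] show ?thesis by (simp add: D_def)
    qed
    finally show ?thesis .
  qed
  have E: "smooth_on \<Omega> (\<lambda>q. frechet_derivative G (at q) (w, 0))"
    using G by (rule smooth_on_frechet_derivative)
  have "frechet_derivative G (at p) (w, 0) = pd_t (vertical_primitive t0 (\<lambda>q. frechet_derivative G (at q) (w, 0))) p"
    using pd_t_vertical_primitive[OF assms(1) S(1) seg E S(2)] by simp
  also have "\<dots> = pd_t (\<lambda>q. D q - D (fst q, t0)) p"
  proof -
    have d: "vertical_primitive t0 (\<lambda>q. frechet_derivative G (at q) (w, 0)) differentiable (at p)"
      using smooth_on_differentiable[OF smooth_on_vertical_primitive[OF assms(1) S(1) seg E] S(2)] .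
    show ?thesis unfolding pd_t_def
      by (subst frechet_derivative_transform_within_open[OF d S(1,2), of "\<lambda>q. D q - D (fst q, t0)"])
         (use 1 in auto)
  qed
  also have "\<dots> = pd_t D p"
  proof -
    have m: "(fst p, t0) \<in> \<Omega>" using assms p by simp
    have "((\<lambda>q. (fst q, t0)) has_derivative (\<lambda>v. (fst v, 0))) (at p)"
      by (auto intro!: derivative_eq_intros)
    from has_derivative_compose[OF this smooth_on_has_derivative[OF D m]]
    have "((\<lambda>q. D q - D (fst q, t0)) has_derivative
        (\<lambda>v. frechet_derivative D (at p) v - frechet_derivative D (at (fst p, t0)) (fst v, 0))) (at p)"
      using smooth_on_has_derivative[OF D] assms
      by (intro has_derivative_diff) auto
    from frechet_derivative_at[OF this, symmetric]
    show ?thesis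
      using linear_0[OF has_derivative_linear[OF smooth_on_has_derivative[OF D m]]]
      by (simp add: pd_t_def zero_prod_def)
  qed
  finally show ?thesis by (simp add: pd_t_def[abs_def] D_def G_def)
qed

section \<open>The inhomogeneous Cauchy-Riemann equation on discs\<close>

definition pd_cbar :: "(complex \<Rightarrow> complex) \<Rightarrow> complex \<Rightarrow> complex" where
  "pd_cbar f z = (frechet_derivative f (at z) 1 + \<i> * frechet_derivative f (at z) \<i>) / 2"

lemma complex_linear_eq:
  assumes "linear D" shows "D w = of_real (Re w) * D 1 + of_real (Im w) * (D \<i> :: complex)"
proof -
  have w: "w = Re w *\<^sub>R 1 + Im w *\<^sub>R \<i>" by (simp add: complex_eq_iff)
  have "D w = D (Re w *\<^sub>R 1 + Im w *\<^sub>R \<i>)" by (rule arg_cong[OF w])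
  also have "\<dots> = of_real (Re w) * D 1 + of_real (Im w) * D \<i>"
    unfolding linear_add[OF assms] linear_cmul[OF assms] by (simp add: scaleR_conv_of_real)
  finally show ?thesis .
qed

text \<open>
  In polar coordinates
  \<open>exp(-i\<theta>) \<partial>/\<partial>zbar = (\<partial>/\<partial>\<rho> + (i/\<rho>) \<partial>/\<partial>\<theta>)/2\<close>.
\<close>

lemma dbar_polar:
  assumes "linear D"
  shows "cis (- \<theta>) * (D 1 + \<i> * D \<i>) = D (cis \<theta>) + \<i> * (D (\<i> * cis \<theta>) :: complex)"
  unfolding complex_linear_eq[OF assms, of "cis \<theta>"] complex_linear_eq[OF assms, of "\<i> * cis \<theta>"]
  by (simp add: cis.ctr complex_eq_iff) (simp add: algebra_simps)

lemma cis_vector_derivative: "(cis has_vector_derivative \<i> * cis \<theta>) (at \<theta> within A)"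
  unfolding has_vector_derivative_def
  using has_derivative_cis[OF has_derivative_ident] by simp

text \<open>
  The solution is the Cauchy transform \<open>-(1/\<pi>) \<integral> G(z + w)/w dw\<close>. In polar coordinates
  around \<open>z\<close> the singular kernel disappears, and it becomes
  \<open>-(1/\<pi>) \<integral> \<integral> G(z + \<rho> exp(i\<theta>)) exp(-i\<theta>) d\<theta> d\<rho>\<close>.
  Its \<open>zbar\<close>-derivative is the integral of
  \<open>(\<partial>/\<partial>\<rho> + (i/\<rho>) \<partial>/\<partial>\<theta>)/2\<close> applied to
  \<open>G(z + \<rho> exp(i\<theta>))\<close>; the angular part integrates to 0 over a period and the radial one
  to \<open>-G(z)/2\<close> for each angle.
\<close>

lemma dbar_solution_compact_support:
  assumes G: "smooth_on UNIV G" and R: "R > 0" and supp: "\<And>z. norm z \<ge> R \<Longrightarrow> G z = 0"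
  obtains u where "smooth_on UNIV u" "\<And>z. z \<in> ball 0 R \<Longrightarrow> pd_cbar u z = G z"
proof -
  define H :: "(complex \<times> real) \<times> real \<Rightarrow> complex" where
    "H = (\<lambda>x. cis (- snd x) * G (fst (fst x) + of_real (snd (fst x)) * cis (snd x)))"
  have cis_eq: "cis = (\<lambda>\<theta>. exp (\<i> * complex_of_real \<theta>))" by (simp add: fun_eq_iff cis_conv_exp)
  have "smooth_on (UNIV :: real set) (\<lambda>x. exp (\<i> * complex_of_real x))"
    by (rule smooth_on_compose[OF _ smooth_on_holomorphic[of UNIV exp]])
       (auto intro!: smooth_on_mult smooth_on_const smooth_on_of_real smooth_on_ident holomorphic_intros)
  then have cis: "smooth_on UNIV cis" by (simp add: cis_eq)
  have sH: "smooth_on UNIV H" unfolding H_def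
    by (intro smooth_on_mult smooth_on_compose[OF _ cis] smooth_on_compose[OF _ G] smooth_on_add
        smooth_on_minus smooth_on_of_real smooth_on_snd smooth_on_fst smooth_on_ident) auto
  define P where "P = (\<lambda>x. integral {0..2*pi} (\<lambda>\<theta>. H (x, \<theta>)))"
  have sP: "smooth_on UNIV P" unfolding P_def
    by (rule smooth_on_param_integral[OF open_UNIV open_UNIV _ sH]) auto
  define U where "U = (\<lambda>z. integral {0..2*R} (\<lambda>\<rho>. P (z, \<rho>)))"
  have sU: "smooth_on UNIV U" unfolding U_def
    by (rule smooth_on_param_integral[OF open_UNIV open_UNIV _ sP]) auto
  let ?D = "\<lambda>z. frechet_derivative G (at z)"
  have dG: "(G has_derivative ?D z) (at z)" for z
    using smooth_on_has_derivative[OF G] by simp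
  have lin: "linear (?D z)" for z using has_derivative_linear[OF dG] .
  have contD: "continuous_on UNIV (\<lambda>z. ?D z v)" for v
    using smooth_on_continuous[OF smooth_on_frechet_derivative[OF G]] .
  have contDw: "continuous_on X (\<lambda>x. ?D (f x) (g x))" if "continuous_on X f" "continuous_on X g"
    for X :: "(real \<times> real) set" and f g
    unfolding complex_linear_eq[OF lin, of _ "g _"]
    using that by (intro continuous_intros continuous_on_compose2[OF contD]) auto
  have contDw': "continuous_on X (\<lambda>x. ?D (f x) (g x))" if "continuous_on X f" "continuous_on X g"
    for X :: "real set" and f g
    unfolding complex_linear_eq[OF lin, of _ "g _"]
    using that by (intro continuous_intros continuous_on_compose2[OF contD]) auto
  have contcis: "continuous_on X (\<lambda>x. cis (f x))" if "continuous_on X f" for X :: "'x::topological_space set" and f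
    using that by (intro continuous_on_compose2[OF smooth_on_continuous[OF cis]]) auto
  note cint = continuous_intros contcis contDw contDw'
  have dU: "frechet_derivative U (at z) w =
     integral {0..2*R} (\<lambda>\<rho>. integral {0..2*pi} (\<lambda>\<theta>. cis (- \<theta>) * ?D (z + of_real \<rho> * cis \<theta>) w))" for z w
  proof -
    have dH: "frechet_derivative H (at ((z, \<rho>), \<theta>)) ((w, 0), 0) = cis (- \<theta>) * ?D (z + of_real \<rho> * cis \<theta>) w"
      for \<rho> \<theta>
    proof -
      have "((\<lambda>w. H ((w, \<rho>), \<theta>)) has_derivative (\<lambda>v. frechet_derivative H (at ((z, \<rho>), \<theta>)) ((v, 0), 0))) (at z)"
      proof (rule has_derivative_compose[OF _ smooth_on_has_derivative[OF sH]])
        show "((\<lambda>w. ((w, \<rho>), \<theta>)) has_derivative (\<lambda>v. ((v, 0), 0))) (at z)"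
          by (auto intro!: derivative_eq_intros)
      qed simp
      moreover have "((\<lambda>w. H ((w, \<rho>), \<theta>)) has_derivative (\<lambda>v. cis (- \<theta>) * ?D (z + of_real \<rho> * cis \<theta>) v)) (at z)"
      proof -
        have "((\<lambda>w. w + of_real \<rho> * cis \<theta>) has_derivative (\<lambda>v. v)) (at z)"
          by (auto intro!: derivative_eq_intros)
        from has_derivative_mult_right[OF has_derivative_compose[OF this dG], of "cis (- \<theta>)"]
        show ?thesis by (simp add: H_def)
      qed
      ultimately show ?thesis by (metis has_derivative_unique)
    qed
    have "frechet_derivative U (at z) w = integral {0..2*R} (\<lambda>\<rho>. frechet_derivative P (at (z, \<rho>)) (w, 0))"
      unfolding U_def by (rule frechet_derivative_param_integral[OF open_UNIV open_UNIV _ sP]) auto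
    also have "(\<lambda>\<rho>. frechet_derivative P (at (z, \<rho>)) (w, 0)) =
      (\<lambda>\<rho>. integral {0..2*pi} (\<lambda>\<theta>. frechet_derivative H (at ((z, \<rho>), \<theta>)) ((w, 0), 0)))"
      unfolding P_def by (rule ext, rule frechet_derivative_param_integral[OF open_UNIV open_UNIV _ sH]) auto
    finally show ?thesis by (simp add: dH)
  qed
  have main: "pd_cbar U z = - of_real pi * G z" if z: "z \<in> ball 0 R" for z
  proof -
    let ?A = "\<lambda>\<rho> \<theta>. ?D (z + of_real \<rho> * cis \<theta>) (cis \<theta>)"
    let ?Q = "\<lambda>\<rho> \<theta>. ?D (z + of_real \<rho> * cis \<theta>) (\<i> * cis \<theta>)"
    let ?I = "\<lambda>f. integral {0..2*R} (\<lambda>\<rho>. integral {0..2*pi} (\<lambda>\<theta>. f \<rho> \<theta> :: complex))"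
    have int1: "(\<lambda>\<theta>. f \<rho> \<theta>) integrable_on {0..2*pi}"
      if "continuous_on UNIV (\<lambda>x. f (fst x) (snd x))" for f :: "real \<Rightarrow> real \<Rightarrow> complex" and \<rho>
    proof (rule integrable_continuous_real)
      have "continuous_on {0..2*pi} (\<lambda>\<theta>. (\<lambda>x. f (fst x) (snd x)) (\<rho>, \<theta>))"
        by (rule continuous_on_compose2[OF that]) (auto intro!: continuous_intros)
      then show "continuous_on {0..2*pi} (\<lambda>\<theta>. f \<rho> \<theta>)" by simp
    qed
    have int2: "(\<lambda>\<rho>. integral {0..2*pi} (f \<rho>)) integrable_on {0..2*R}"
      if "continuous_on UNIV (\<lambda>x. f (fst x) (snd x))" for f :: "real \<Rightarrow> real \<Rightarrow> complex"
    proof (rule integrable_continuous_real)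
      have "continuous_on ({0..2*R} \<times> cbox 0 (2*pi)) (\<lambda>(\<rho>, \<theta>). f \<rho> \<theta>)"
        using continuous_on_subset[OF that] by (simp add: case_prod_unfold)
      from integral_continuous_on_param[OF this]
      show "continuous_on {0..2*R} (\<lambda>\<rho>. integral {0..2*pi} (f \<rho>))" by simp
    qed
    have cD: "continuous_on UNIV (\<lambda>x. cis (- snd x) * ?D (z + of_real (fst x) * cis (snd x)) w)" for w
      by (intro cint)
    have cA: "continuous_on UNIV (\<lambda>x. ?A (fst x) (snd x))" by (intro cint)
    have cQ: "continuous_on UNIV (\<lambda>x. ?Q (fst x) (snd x))" by (intro cint)
    have add: "?I (\<lambda>\<rho> \<theta>. f \<rho> \<theta> + c * g \<rho> \<theta>) = ?I f + c * ?I g"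
      if "continuous_on UNIV (\<lambda>x. f (fst x) (snd x))" "continuous_on UNIV (\<lambda>x. g (fst x) (snd x))" for f g c
    proof -
      have "continuous_on UNIV (\<lambda>x. c * g (fst x) (snd x))" using that by (intro continuous_intros)
      from int1[OF this] int2[OF this] int1[OF that(1)] int2[OF that(1)]
      show ?thesis by (simp add: Henstock_Kurzweil_Integration.integral_add)
    qed
    \<comment> \<open>\<open>?A\<close> is the radial derivative of \<open>G(z + \<rho> exp(i\<theta>))\<close> and \<open>\<rho> ?Q\<close> the angular one.\<close>
    have "pd_cbar U z = ?I (\<lambda>\<rho> \<theta>. cis (- \<theta>) * ?D (z + of_real \<rho> * cis \<theta>) 1 +
       \<i> * (cis (- \<theta>) * ?D (z + of_real \<rho> * cis \<theta>) \<i>)) / 2"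
      unfolding pd_cbar_def dU add[OF cD cD] ..
    also have "\<dots> = ?I (\<lambda>\<rho> \<theta>. ?A \<rho> \<theta> + \<i> * ?Q \<rho> \<theta>) / 2"
    proof -
      have "cis (- \<theta>) * ?D (z + of_real \<rho> * cis \<theta>) 1 + \<i> * (cis (- \<theta>) * ?D (z + of_real \<rho> * cis \<theta>) \<i>) =
        ?A \<rho> \<theta> + \<i> * ?Q \<rho> \<theta>" for \<rho> \<theta>
        using dbar_polar[OF lin, of \<theta> "z + of_real \<rho> * cis \<theta>"] by (simp add: algebra_simps)
      then show ?thesis by simp
    qed
    also have "\<dots> = (?I ?A + \<i> * ?I ?Q) / 2" unfolding add[OF cA cQ] ..
    also have "?I ?Q = 0"
    proof -
      have "integral {0..2*pi} (?Q \<rho>) = 0" for \<rho>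
      proof (cases "\<rho> = 0")
        case True
        have "(?Q 0 has_integral (?D z (cis (2*pi)) - ?D z (cis 0))) {0..2*pi}"
        proof (rule fundamental_theorem_of_calculus)
          fix \<theta> :: real
          show "((\<lambda>\<theta>. ?D z (cis \<theta>)) has_vector_derivative ?Q 0 \<theta>) (at \<theta> within {0..2*pi})"
            using bounded_linear.has_vector_derivative[OF has_derivative_bounded_linear[OF dG] cis_vector_derivative]
            by simp
        qed simp
        then show ?thesis using True by (simp add: integral_unique)
      next
        case False
        have "((\<lambda>\<theta>. of_real \<rho> * ?Q \<rho> \<theta>) has_integral 
          (G (z + of_real \<rho> * cis (2*pi)) - G (z + of_real \<rho> * cis 0))) {0..2*pi}"
        proof (rule fundamental_theorem_of_calculus)
          fix \<theta> :: real
          have "((\<lambda>\<theta>. z + of_real \<rho> * cis \<theta>) has_vector_derivative \<rho> *\<^sub>R (\<i> * cis \<theta>)) (at \<theta> within {0..2*pi})"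
            by (auto intro!: derivative_eq_intros cis_vector_derivative simp: scaleR_conv_of_real)
          from vector_derivative_diff_chain_within[OF this has_derivative_at_withinI[OF dG]]
          show "((\<lambda>\<theta>. G (z + of_real \<rho> * cis \<theta>)) has_vector_derivative of_real \<rho> * ?Q \<rho> \<theta>) (at \<theta> within {0..2*pi})"
            using linear_cmul[OF lin, of _ \<rho> "\<i> * cis \<theta>"] by (simp add: o_def scaleR_conv_of_real)
        qed simp
        from integral_unique[OF this] show ?thesis using False by simp
      qed
      then show ?thesis by simp
    qed
    also have "?I ?A = integral {0..2*pi} (\<lambda>\<theta>. integral {0..2*R} (\<lambda>\<rho>. ?A \<rho> \<theta>))"
    proof -
      have "continuous_on (cbox (0,0) (2*R, 2*pi)) (\<lambda>(\<rho>, \<theta>). ?A \<rho> \<theta>)"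
        using continuous_on_subset[OF cA] by (simp add: case_prod_unfold)
      from integral_swap_continuous[OF this] show ?thesis by simp
    qed
    also have "\<dots> = integral {0..2*pi} (\<lambda>\<theta>. - G z)"
    proof (rule Henstock_Kurzweil_Integration.integral_cong)
      fix \<theta> :: real
      have "((\<lambda>\<rho>. ?A \<rho> \<theta>) has_integral (G (z + of_real (2*R) * cis \<theta>) - G (z + of_real 0 * cis \<theta>))) {0..2*R}"
      proof (rule fundamental_theorem_of_calculus)
        fix \<rho> :: real
        have "((\<lambda>\<rho>. z + of_real \<rho> * cis \<theta>) has_vector_derivative cis \<theta>) (at \<rho> within {0..2*R})"
          by (auto intro!: derivative_eq_intros simp: has_vector_derivative_def scaleR_conv_of_real)
        from vector_derivative_diff_chain_within[OF this has_derivative_at_withinI[OF dG]]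
        show "((\<lambda>\<rho>. G (z + of_real \<rho> * cis \<theta>)) has_vector_derivative ?A \<rho> \<theta>) (at \<rho> within {0..2*R})"
          by (simp add: o_def)
      qed (use R in simp)
      moreover have "G (z + of_real (2*R) * cis \<theta>) = 0"
      proof (rule supp)
        have "2 * R - norm z \<le> norm (z + of_real (2*R) * cis \<theta>)"
          using norm_triangle_ineq2[of "of_real (2*R) * cis \<theta>" "- z"] R by (simp add: norm_mult add.commute)
        then show "norm (z + of_real (2*R) * cis \<theta>) \<ge> R" using z by simp
      qed
      ultimately show "integral {0..2*R} (\<lambda>\<rho>. ?A \<rho> \<theta>) = - G z"
        by (simp add: integral_unique)
    qed
    also have "\<dots> = - (2 * of_real pi * G z)" by (simp add: scaleR_conv_of_real)
    finally show ?thesis by simp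
  qed
  let ?u = "\<lambda>z. (- 1 / of_real pi) * U z"
  have "pd_cbar ?u z = (- 1 / of_real pi) * pd_cbar U z" for z
  proof -
    have "frechet_derivative ?u (at z) = (\<lambda>v. (- 1 / of_real pi) * frechet_derivative U (at z) v)"
      using frechet_derivative_at[OF has_derivative_mult_right[OF smooth_on_has_derivative[OF sU UNIV_I]],
          symmetric] .
    then show ?thesis by (simp add: pd_cbar_def field_simps)
  qed
  moreover have "smooth_on UNIV ?u" by (intro smooth_on_mult smooth_on_const sU open_UNIV)
  ultimately show thesis using main by (intro that[of ?u]) auto
qed

lemma smooth_cutoff_exists:
  assumes "0 \<le> a" "a < b"
  obtains \<kappa> :: "'a::euclidean_space \<Rightarrow> real" where "smooth_on UNIV \<kappa>" "\<And>x. norm x \<le> a \<Longrightarrow> \<kappa> x = 1"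
    "\<And>x. norm x \<ge> b \<Longrightarrow> \<kappa> x = 0"
proof -
  have "a\<^sup>2 < b\<^sup>2" using assms by (simp add: power_strict_mono)
  from smooth_step_exists[OF this] obtain s :: "real \<Rightarrow> real" where s: "smooth_on UNIV s"
    "\<And>x. x \<le> a\<^sup>2 \<Longrightarrow> s x = 1" "\<And>x. x \<ge> b\<^sup>2 \<Longrightarrow> s x = 0" by blast
  have sm: "smooth_on UNIV (\<lambda>x::'a. s (x \<bullet> x))"
    by (rule smooth_on_compose[OF _ s(1)])
       (auto intro!: smooth_on_bilinear[OF _ bounded_bilinear_inner] smooth_on_ident)
  show thesis
  proof (rule that[OF sm])
    show "s (x \<bullet> x) = 1" if "norm x \<le> a" for x :: 'a
      using that assms by (intro s(2)) (simp add: power2_norm_eq_inner[symmetric] power_mono)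
    show "s (x \<bullet> x) = 0" if "norm x \<ge> b" for x :: 'a
      using that assms by (intro s(3)) (simp add: power2_norm_eq_inner[symmetric] power_mono)
  qed
qed

lemma dbar_solution_on_ball:
  assumes g: "smooth_on UNIV g" and N: "N > 0"
  obtains u where "smooth_on UNIV u" "\<And>z. z \<in> ball 0 N \<Longrightarrow> pd_cbar u z = g z"
proof -
  obtain \<kappa> :: "complex \<Rightarrow> real" where k: "smooth_on UNIV \<kappa>" "\<And>x. norm x \<le> N \<Longrightarrow> \<kappa> x = 1"
    "\<And>x. norm x \<ge> N + 1 \<Longrightarrow> \<kappa> x = 0"
    using smooth_cutoff_exists[of N "N + 1"] N by auto
  define G where "G = (\<lambda>z. of_real (\<kappa> z) * g z)"
  have "smooth_on UNIV G" unfolding G_def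
    by (intro smooth_on_mult smooth_on_of_real k g open_UNIV)
  from dbar_solution_compact_support[OF this, of "N + 1"] k(3) N
  obtain u where u: "smooth_on UNIV u" "\<And>z. z \<in> ball 0 (N + 1) \<Longrightarrow> pd_cbar u z = G z"
    by (auto simp: G_def)
  show thesis
    by (rule that[OF u(1)]) (use u(2) k(2) in \<open>auto simp: G_def\<close>)
qed

text \<open>
  The Cauchy-Riemann equation makes the real derivative complex linear.
\<close>

lemma holomorphic_on_if_pd_cbar_0:
  assumes "open W" "smooth_on W f" "\<And>z. z \<in> W \<Longrightarrow> pd_cbar f z = 0"
  shows "f holomorphic_on W"
proof -
  have "(f has_field_derivative frechet_derivative f (at z) 1) (at z)" if z: "z \<in> W" for z
  proof -
    let ?D = "frechet_derivative f (at z)"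
    have d: "(f has_derivative ?D) (at z)" using smooth_on_has_derivative[OF assms(2) z] .
    have i: "?D \<i> = \<i> * ?D 1" using assms(3)[OF z] by (simp add: pd_cbar_def add_eq_0_iff2 complex_eq_iff)
    have "?D w = ?D 1 * w" for w
      unfolding complex_linear_eq[OF has_derivative_linear[OF d], of w] i
      by (subst (5) complex_eq) (simp add: algebra_simps)
    then have "?D = (*) (?D 1)" by (rule ext)
    with d show ?thesis unfolding has_field_derivative_def by simp
  qed
  then show ?thesis using assms(1) by (auto simp: holomorphic_on_open)
qed

section \<open>Approximation by Laurent polynomials\<close>

lemma uniform_limit_geometric:
  fixes s :: "nat \<Rightarrow> 'a \<Rightarrow> complex"
  assumes "\<And>n z. z \<in> S \<Longrightarrow> norm (s n z - l z) \<le> C * q ^ n" "0 \<le> q" "q < 1"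
  shows "uniform_limit S s l sequentially"
proof (rule uniform_limitI)
  fix e :: real assume "e > 0"
  have "(\<lambda>n. C * q ^ n) \<longlonglongrightarrow> C * 0"
    using assms by (intro tendsto_intros LIMSEQ_realpow_zero)
  then have "\<forall>\<^sub>F n in sequentially. C * q ^ n < e"
    using \<open>e > 0\<close> by (intro order_tendstoD) auto
  then show "\<forall>\<^sub>F n in sequentially. \<forall>x\<in>S. dist (s n x) (l x) < e"
    by eventually_elim (use assms(1) in \<open>auto simp: dist_norm intro: le_less_trans\<close>)
qed

text \<open>
  A finite geometric sum, with its remainder.
\<close>

lemma cauchy_kernel_expansion:
  fixes z w :: complex
  assumes "w \<noteq> 0" "w \<noteq> z"
  shows "1 / (w - z) - (\<Sum>k<n. z ^ k / w ^ (k + 1)) = (z / w) ^ n / (w - z)"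
proof -
  have "z / w \<noteq> 1" using assms by (simp add: divide_eq_1_iff)
  then have geo: "(\<Sum>k<n. (z / w) ^ k) = ((z / w) ^ n - 1) / (z / w - 1)"
    by (rule geometric_sum)
  have "(\<Sum>k<n. z ^ k / w ^ (k + 1)) = (\<Sum>k<n. (z / w) ^ k) / w"
    by (simp add: sum_divide_distrib power_divide mult.commute)
  also note geo
  also have "((z / w) ^ n - 1) / (z / w - 1) / w = ((z / w) ^ n - 1) / (z - w)"
    using assms by (simp add: divide_divide_eq_left left_diff_distrib)
  finally have *: "(\<Sum>k<n. z ^ k / w ^ (k + 1)) = ((z / w) ^ n - 1) / (z - w)" .
  have "w - z \<noteq> 0" "z - w \<noteq> 0" using assms by auto
  then show ?thesis unfolding * by (simp add: divide_simps) (simp add: algebra_simps)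
qed

text \<open>
  A kernel with an expansion into products of functions of \<open>w\<close> and of \<open>z\<close> that converges geometrically
  can be integrated term by term. Applied to the Cauchy kernel it gives the Taylor part and the
  principal part of a Laurent series.
\<close>

lemma circle_integral_series:
  fixes \<phi> :: "complex \<Rightarrow> complex" and u :: "nat \<Rightarrow> complex \<Rightarrow> complex" and D q :: real
  assumes \<phi>: "continuous_on (sphere 0 r) \<phi>" and r: "r > 0"
    and G: "\<And>z. z \<in> S \<Longrightarrow> continuous_on (sphere 0 r) (G z)" and u: "\<And>k. continuous_on (sphere 0 r) (u k)"
    and bound: "\<And>n z w. z \<in> S \<Longrightarrow> norm w = r \<Longrightarrow> norm (G z w - (\<Sum>k<n. u k w * v k z)) \<le> D * q ^ n"
    and q: "0 \<le> q" "q < 1"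
  shows "uniform_limit S (\<lambda>n z. \<Sum>k<n. contour_integral (circlepath 0 r) (\<lambda>w. \<phi> w * u k w) * v k z)
    (\<lambda>z. contour_integral (circlepath 0 r) (\<lambda>w. \<phi> w * G z w)) sequentially"
proof -
  have "compact (\<phi> ` sphere 0 r)" using \<phi> by (simp add: compact_continuous_image)
  then obtain M where M: "\<And>w. norm w = r \<Longrightarrow> norm (\<phi> w) \<le> M"
    using compact_imp_bounded bounded_iff by (metis dist_0_norm imageI mem_sphere)
  have int: "(\<lambda>w. \<phi> w * f w) contour_integrable_on circlepath 0 r" if "continuous_on (sphere 0 r) f" for f
    using that r \<phi> by (intro contour_integrable_continuous_circlepath continuous_intros) auto
  let ?c = "\<lambda>k. contour_integral (circlepath 0 r) (\<lambda>w. \<phi> w * u k w)"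
  show ?thesis
  proof (rule uniform_limit_geometric[OF _ q])
    fix n z assume z: "z \<in> S"
    have 1: "((\<lambda>w. \<Sum>k<n. \<phi> w * u k w * v k z) has_contour_integral (\<Sum>k<n. ?c k * v k z)) (circlepath 0 r)"
      by (intro has_contour_integral_sum has_contour_integral_rmul has_contour_integral_integral int u) simp
    note 2 = has_contour_integral_integral[OF int[OF G[OF z]]]
    have "norm (contour_integral (circlepath 0 r) (\<lambda>w. \<phi> w * G z w) - (\<Sum>k<n. ?c k * v k z))
        \<le> (M * (D * q ^ n)) * (2 * pi * r)"
    proof (rule has_contour_integral_bound_circlepath[OF has_contour_integral_diff[OF 2 1] _ r])
      fix w :: complex assume "norm (w - 0) = r"
      then have w: "norm w = r" by simp
      have "\<phi> w * G z w - (\<Sum>k<n. \<phi> w * u k w * v k z) = \<phi> w * (G z w - (\<Sum>k<n. u k w * v k z))"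
        by (simp add: right_diff_distrib sum_distrib_left mult.assoc)
      then show "norm (\<phi> w * G z w - (\<Sum>k<n. \<phi> w * u k w * v k z)) \<le> M * (D * q ^ n)"
        using M[OF w] bound[OF z w] by (auto simp: norm_mult intro!: mult_mono intro: order_trans[OF norm_ge_zero])
    next
      have "norm (complex_of_real r) = r" using r by simp
      then have "0 \<le> M" "0 \<le> D * q ^ n"
        using M bound[OF z] by (blast intro: order_trans[OF norm_ge_zero])+
      then show "0 \<le> M * (D * q ^ n)" by (rule mult_nonneg_nonneg)
    qed
    then show "norm ((\<Sum>k<n. ?c k * v k z) - contour_integral (circlepath 0 r) (\<lambda>w. \<phi> w * G z w))
      \<le> (M * D * (2 * pi * r)) * q ^ n"
      by (subst norm_minus_commute) (simp add: mult_ac)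
  qed
qed

lemma cauchy_integral_expansion_inside:
  assumes \<phi>: "continuous_on (sphere 0 B) \<phi>" and "0 \<le> b" "b < B"
  shows "uniform_limit (cball 0 b)
    (\<lambda>n z. \<Sum>k<n. contour_integral (circlepath 0 B) (\<lambda>w. \<phi> w / w ^ (k + 1)) * z ^ k)
    (\<lambda>z. contour_integral (circlepath 0 B) (\<lambda>w. \<phi> w / (w - z))) sequentially"
proof -
  have B: "B > 0" using assms by simp
  have "uniform_limit (cball 0 b)
    (\<lambda>n z. \<Sum>k<n. contour_integral (circlepath 0 B) (\<lambda>w. \<phi> w * (1 / w ^ (k + 1))) * z ^ k)
    (\<lambda>z. contour_integral (circlepath 0 B) (\<lambda>w. \<phi> w * (1 / (w - z)))) sequentially"
  proof (rule circle_integral_series[OF \<phi> B, where D = "1 / (B - b)" and q = "b / B"])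
    fix n and z w :: complex assume z: "z \<in> cball 0 b" and w: "norm w = B"
    have nz: "w \<noteq> z" "w \<noteq> 0" using z w assms by auto
    have "1 / (w - z) - (\<Sum>k<n. 1 / w ^ (k + 1) * z ^ k) = 1 / (w - z) * (z / w) ^ n"
      using cauchy_kernel_expansion[OF nz(2,1), of n] by simp
    then have "norm (1 / (w - z) - (\<Sum>k<n. 1 / w ^ (k + 1) * z ^ k)) = 1 / norm (w - z) * (norm z / B) ^ n"
      by (simp add: norm_mult norm_divide norm_power w)
    also have "\<dots> \<le> 1 / (B - b) * (b / B) ^ n"
    proof (intro mult_mono frac_le power_mono divide_right_mono)
      show "B - b \<le> norm (w - z)" using norm_triangle_ineq2[of w z] w z by simp
    qed (use z assms in auto)
    finally show "norm (1 / (w - z) - (\<Sum>k<n. 1 / w ^ (k + 1) * z ^ k)) \<le> 1 / (B - b) * (b / B) ^ n" .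
  qed (use assms in \<open>auto intro!: continuous_intros\<close>)
  then show ?thesis by simp
qed

lemma cauchy_integral_expansion_outside:
  assumes \<phi>: "continuous_on (sphere 0 A) \<phi>" and "0 < A" "A < a"
  shows "uniform_limit (- ball 0 a)
    (\<lambda>n z. \<Sum>k<n. contour_integral (circlepath 0 A) (\<lambda>w. \<phi> w * w ^ k) / z ^ (k + 1))
    (\<lambda>z. contour_integral (circlepath 0 A) (\<lambda>w. \<phi> w / (z - w))) sequentially"
proof -
  have "uniform_limit (- ball 0 a)
    (\<lambda>n z. \<Sum>k<n. contour_integral (circlepath 0 A) (\<lambda>w. \<phi> w * w ^ k) * (1 / z ^ (k + 1)))
    (\<lambda>z. contour_integral (circlepath 0 A) (\<lambda>w. \<phi> w * (1 / (z - w)))) sequentially"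
  proof (rule circle_integral_series[OF \<phi> assms(2), where D = "1 / (a - A)" and q = "A / a"])
    fix z :: complex assume "z \<in> - ball 0 a"
    then have "norm z \<noteq> A" using assms by auto
    then show "continuous_on (sphere 0 A) (\<lambda>w. 1 / (z - w))" by (intro continuous_intros) auto
  next
    fix n and z w :: complex assume z: "z \<in> - ball 0 a" and w: "norm w = A"
    have nz: "z \<noteq> w" "z \<noteq> 0" using z w assms by auto
    have "1 / (z - w) - (\<Sum>k<n. w ^ k * (1 / z ^ (k + 1))) = 1 / (z - w) * (w / z) ^ n"
      using cauchy_kernel_expansion[OF nz(2,1), of n] by simp
    then have "norm (1 / (z - w) - (\<Sum>k<n. w ^ k * (1 / z ^ (k + 1)))) = 1 / norm (z - w) * (A / norm z) ^ n"
      by (simp add: norm_mult norm_divide norm_power w)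
    also have "\<dots> \<le> 1 / (a - A) * (A / a) ^ n"
    proof (intro mult_mono frac_le power_mono divide_right_mono)
      show "a - A \<le> norm (z - w)" using norm_triangle_ineq2[of z w] w z by simp
    qed (use z assms in auto)
    finally show "norm (1 / (z - w) - (\<Sum>k<n. w ^ k * (1 / z ^ (k + 1)))) \<le> 1 / (a - A) * (A / a) ^ n" .
  qed (use assms in \<open>auto intro!: continuous_intros\<close>)
  then show ?thesis by simp
qed

text \<open>
  The quotient \<open>(\<phi>(w) - \<phi>(z))/(w - z)\<close> is holomorphic in the annulus, where the two
  circles are homotopic. Hence its integrals over them agree, and \<open>\<integral> 1/(w - z) dw\<close> is
  \<open>2\<pi>i\<close> over the outer circle and 0 over the inner one.
\<close>

lemma cauchy_formula_annulus:
  assumes hol: "\<phi> holomorphic_on (ball 0 N - {0})" and "0 < A" "A < norm z" "norm z < B" "B < N"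
  shows "2 * of_real pi * \<i> * \<phi> z = contour_integral (circlepath 0 B) (\<lambda>w. \<phi> w / (w - z)) +
     contour_integral (circlepath 0 A) (\<lambda>w. \<phi> w / (z - w))"
proof -
  let ?W = "ball 0 N - {0 :: complex}"
  \<comment> \<open>The difference quotient, with its removable singularity filled in.\<close>
  define F where "F = (\<lambda>w. if w = z then deriv \<phi> z else (\<phi> w - \<phi> z) / (w - z))"
  have op: "open ?W" by (simp add: open_Diff)
  have F: "F holomorphic_on ?W" unfolding F_def by (rule pole_lemma_open[OF hol op])
  have sph: "sphere 0 r \<subseteq> ?W" if "0 < r" "r < N" for r :: real using that by auto
  have contF: "continuous_on (sphere 0 r) \<phi>" if "0 < r" "r < N" for r
    using holomorphic_on_imp_continuous_on[OF hol] continuous_on_subset sph[OF that] by blast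
  have hl: "homotopic_loops ?W (circlepath 0 B) (circlepath 0 A)"
  proof (rule homotopic_loops_linear)
    fix t :: real
    define e where "e = exp (2 * of_real pi * \<i> * of_real t)"
    have e: "norm e = 1" by (simp add: e_def norm_exp_eq_Re)
    show "closed_segment (circlepath 0 B t) (circlepath 0 A t) \<subseteq> ?W"
    proof
      fix x assume "x \<in> closed_segment (circlepath 0 B t) (circlepath 0 A t)"
      then obtain u where u: "0 \<le> u" "u \<le> 1" "x = (1 - u) *\<^sub>R (B * e) + u *\<^sub>R (A * e)"
        by (auto simp: closed_segment_def circlepath e_def)
      then have x: "x = of_real ((1 - u) * B + u * A) * e"
        by (simp add: scaleR_conv_of_real algebra_simps)
      have "(1 - u) * B + u * A \<le> (1 - u) * B + u * B" using assms u by (intro add_left_mono mult_left_mono) auto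
      then have 1: "(1 - u) * B + u * A \<le> B" by (simp add: algebra_simps)
      have "(1 - u) * A + u * A \<le> (1 - u) * B + u * A" using assms u by (intro add_right_mono mult_left_mono) auto
      then have 2: "(1 - u) * B + u * A \<ge> A" by (simp add: algebra_simps)
      have "norm x = (1 - u) * B + u * A"
        using 2 assms unfolding x norm_mult e norm_of_real by simp
      then show "x \<in> ?W" using 1 2 assms by auto
    qed
  qed auto
  have eq: "contour_integral (circlepath 0 B) F = contour_integral (circlepath 0 A) F"
    by (rule Cauchy_theorem_homotopic_loops[OF hl op F]) auto
  have split: "contour_integral (circlepath 0 r) F =
      contour_integral (circlepath 0 r) (\<lambda>w. \<phi> w / (w - z)) - \<phi> z * c"
    if r: "0 < r" "r < N" "norm z \<noteq> r" and c: "((\<lambda>w. 1 / (w - z)) has_contour_integral c) (circlepath 0 r)" for r c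
  proof -
    have "(\<lambda>w. \<phi> w / (w - z)) contour_integrable_on circlepath 0 r"
      using r contF[OF r(1,2)] by (intro contour_integrable_continuous_circlepath continuous_intros) auto
    from has_contour_integral_diff[OF has_contour_integral_integral[OF this] has_contour_integral_lmul[OF c, of "\<phi> z"]]
    have "(F has_contour_integral contour_integral (circlepath 0 r) (\<lambda>w. \<phi> w / (w - z)) - \<phi> z * c) (circlepath 0 r)"
      by (rule has_contour_integral_eq) (use r in \<open>auto simp: F_def diff_divide_distrib\<close>)
    then show ?thesis by (rule contour_integral_unique)
  qed
  have "((\<lambda>w. 1 / (w - z)) has_contour_integral (2 * of_real pi * \<i> * 1)) (circlepath 0 B)"
    by (rule Cauchy_integral_circlepath) (use assms in auto)
  moreover have "((\<lambda>w. 1 / (w - z)) has_contour_integral 0) (circlepath 0 A)"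
    by (rule Cauchy_theorem_disc_simple[of _ 0 "norm z"])
       (use assms in \<open>auto intro!: holomorphic_intros\<close>)
  ultimately have "2 * of_real pi * \<i> * \<phi> z = contour_integral (circlepath 0 B) (\<lambda>w. \<phi> w / (w - z)) -
     contour_integral (circlepath 0 A) (\<lambda>w. \<phi> w / (w - z))"
    using eq split[of B "2 * of_real pi * \<i> * 1"] split[of A 0] assms by (simp add: algebra_simps)
  moreover have "(\<lambda>w. \<phi> w / (z - w)) = (\<lambda>w. - (\<phi> w / (w - z)))"
    by (metis minus_diff_eq minus_divide_right)
  ultimately show ?thesis by (simp add: contour_integral_neg)
qed

lemma laurent_approximation:
  assumes hol: "\<phi> holomorphic_on (ball 0 N - {0})" and "0 < A" "A < a" "a \<le> b" "b < B" "B < N"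
  obtains c d where "uniform_limit (cball 0 b - ball 0 a)
     (\<lambda>n z. (\<Sum>k<n. c k * z ^ k) + (\<Sum>k<n. d k / z ^ (k + 1))) \<phi> sequentially"
proof -
  have cont: "continuous_on (sphere 0 r) \<phi>" if "0 < r" "r < N" for r
    by (rule continuous_on_subset[OF holomorphic_on_imp_continuous_on[OF hol]]) (use that in auto)
  define \<iota> where "\<iota> = 2 * of_real pi * \<i>"
  have "\<iota> \<noteq> 0" by (simp add: \<iota>_def)
  then have inv: "inverse \<iota> * (\<iota> * x) = x" for x by simp
  let ?S = "cball 0 b - ball 0 a :: complex set"
  let ?c = "\<lambda>k. contour_integral (circlepath 0 B) (\<lambda>w. \<phi> w / w ^ (k + 1))"
  let ?d = "\<lambda>k. contour_integral (circlepath 0 A) (\<lambda>w. \<phi> w * w ^ k)"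
  have "uniform_limit ?S (\<lambda>n z. inverse \<iota> * ((\<Sum>k<n. ?c k * z ^ k) + (\<Sum>k<n. ?d k / z ^ (k + 1))))
    (\<lambda>z. inverse \<iota> * (contour_integral (circlepath 0 B) (\<lambda>w. \<phi> w / (w - z))
       + contour_integral (circlepath 0 A) (\<lambda>w. \<phi> w / (z - w)))) sequentially"
    by (intro bounded_linear.uniform_limit[OF bounded_linear_mult_right] uniform_limit_add
         uniform_limit_on_subset[OF cauchy_integral_expansion_inside]
         uniform_limit_on_subset[OF cauchy_integral_expansion_outside] cont)
       (use assms in auto)
  also have "?this \<longleftrightarrow> uniform_limit ?S (\<lambda>n z. (\<Sum>k<n. (?c k / \<iota>) * z ^ k) + (\<Sum>k<n. (?d k / \<iota>) / z ^ (k + 1)))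
     \<phi> sequentially"
  proof (rule uniform_limit_cong')
    fix z :: complex assume "z \<in> ?S"
    then have "\<iota> * \<phi> z = contour_integral (circlepath 0 B) (\<lambda>w. \<phi> w / (w - z)) +
     contour_integral (circlepath 0 A) (\<lambda>w. \<phi> w / (z - w))"
      using assms unfolding \<iota>_def by (intro cauchy_formula_annulus[OF hol]) auto
    from this[symmetric]
    show "inverse \<iota> * (contour_integral (circlepath 0 B) (\<lambda>w. \<phi> w / (w - z))
       + contour_integral (circlepath 0 A) (\<lambda>w. \<phi> w / (z - w))) = \<phi> z"
      by (simp only: inv)
  qed (simp add: distrib_left sum_distrib_left divide_inverse mult_ac)
  finally show thesis by (rule that)
qed

lemma taylor_approximation:
  assumes hol: "\<phi> holomorphic_on ball 0 N" and "0 \<le> b" "b < N"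
  obtains c where "uniform_limit (cball 0 b) (\<lambda>n z. \<Sum>k<n. c k * z ^ k) \<phi> sequentially"
proof -
  obtain B where B: "b < B" "B < N" using dense assms by blast
  have cont: "continuous_on (cball 0 B) \<phi>"
    by (rule continuous_on_subset[OF holomorphic_on_imp_continuous_on[OF hol]]) (use B in auto)
  define \<iota> where "\<iota> = 2 * of_real pi * \<i>"
  have "\<iota> \<noteq> 0" by (simp add: \<iota>_def)
  then have inv: "inverse \<iota> * (\<iota> * x) = x" for x by simp
  let ?c = "\<lambda>k. contour_integral (circlepath 0 B) (\<lambda>w. \<phi> w / w ^ (k + 1))"
  have "uniform_limit (cball 0 b) (\<lambda>n z. inverse \<iota> * (\<Sum>k<n. ?c k * z ^ k))
    (\<lambda>z. inverse \<iota> * contour_integral (circlepath 0 B) (\<lambda>w. \<phi> w / (w - z))) sequentially"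
    by (intro bounded_linear.uniform_limit[OF bounded_linear_mult_right]
         cauchy_integral_expansion_inside continuous_on_subset[OF cont]) (use assms B in auto)
  also have "?this \<longleftrightarrow> uniform_limit (cball 0 b) (\<lambda>n z. \<Sum>k<n. (?c k / \<iota>) * z ^ k) \<phi> sequentially"
  proof (rule uniform_limit_cong')
    fix z :: complex assume "z \<in> cball 0 b"
    then have "((\<lambda>w. \<phi> w / (w - z)) has_contour_integral (\<iota> * \<phi> z)) (circlepath 0 B)"
      unfolding \<iota>_def using B by (intro Cauchy_integral_circlepath cont holomorphic_on_subset[OF hol]) auto
    then show "inverse \<iota> * contour_integral (circlepath 0 B) (\<lambda>w. \<phi> w / (w - z)) = \<phi> z"
      by (simp only: contour_integral_unique inv)
  qed (simp add: sum_distrib_left divide_inverse mult_ac)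
  finally show thesis by (rule that)
qed

text \<open>
  By Cauchy's estimates this class of sequences is stable under differentiation, so it provides
  the coefficients of iterated partial derivatives.
\<close>

definition locally_null :: "complex set \<Rightarrow> (nat \<Rightarrow> complex \<Rightarrow> complex) \<Rightarrow> bool" where
  "locally_null W \<psi> \<longleftrightarrow> (\<forall>n. \<psi> n holomorphic_on W) \<and>
     (\<forall>K. compact K \<and> K \<subseteq> W \<longrightarrow> uniform_limit K \<psi> (\<lambda>_. 0) sequentially)"

text \<open>
  Cauchy's estimate on discs of a fixed radius around the points of a compact set.
\<close>

lemma locally_null_deriv:
  assumes "open W" "locally_null W \<psi>"
  shows "locally_null W (\<lambda>n. deriv (\<psi> n))"
  unfolding locally_null_def
proof (intro conjI allI impI)
  have hol: "\<psi> n holomorphic_on W" for n using assms(2) by (simp add: locally_null_def)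
  then show "deriv (\<psi> n) holomorphic_on W" for n using assms(1) by (simp add: holomorphic_deriv)
  fix K assume K: "compact K \<and> K \<subseteq> W"
  then obtain r where r: "r > 0" "(\<Union>x\<in>K. cball x r) \<subseteq> W"
    using compact_subset_open_imp_cball_epsilon_subset[of K W] assms(1) by blast
  define K' where "K' = {x + y |x y. x \<in> K \<and> y \<in> cball 0 r}"
  have "compact K'" unfolding K'_def using K by (intro compact_sums) auto
  have cb: "cball x r \<subseteq> K'" if "x \<in> K" for x
  proof
    fix y assume "y \<in> cball x r"
    then show "y \<in> K'" unfolding K'_def
      by (intro CollectI exI[of _ x] exI[of _ "y - x"]) (use that in \<open>auto simp: dist_norm norm_minus_commute\<close>)
  qed
  have "K' \<subseteq> W"
  proof
    fix w assume "w \<in> K'"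
    then obtain x y where "w = x + y" "x \<in> K" "norm y \<le> r" by (auto simp: K'_def)
    then have "x \<in> K" "w \<in> cball x r" by (auto simp: dist_norm)
    then show "w \<in> W" using r by blast
  qed
  with \<open>compact K'\<close> have ul: "uniform_limit K' \<psi> (\<lambda>_. 0) sequentially"
    using assms(2) by (simp add: locally_null_def)
  show "uniform_limit K (\<lambda>n. deriv (\<psi> n)) (\<lambda>_. 0) sequentially"
  proof (rule uniform_limitI)
    fix e :: real assume "e > 0"
    then have "\<forall>\<^sub>F n in sequentially. \<forall>x\<in>K'. dist (\<psi> n x) 0 < e * r / 2"
      using r by (intro uniform_limitD[OF ul]) auto
    then show "\<forall>\<^sub>F n in sequentially. \<forall>x\<in>K. dist (deriv (\<psi> n) x) 0 < e"
    proof eventually_elim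
      case (elim n)
      show ?case
      proof
        fix x assume x: "x \<in> K"
        have sub: "cball x r \<subseteq> W" using r x by blast
        have "norm ((deriv ^^ 1) (\<psi> n) x) \<le> fact 1 * (e * r / 2) / r ^ 1"
        proof (rule Cauchy_inequality)
          show "\<psi> n holomorphic_on ball x r" using sub ball_subset_cball by (metis holomorphic_on_subset[OF hol] order_trans)
          show "continuous_on (cball x r) (\<psi> n)"
            using holomorphic_on_imp_continuous_on[OF hol] sub continuous_on_subset by blast
          fix y assume "norm (x - y) = r"
          then have "y \<in> K'" using cb[OF x] by (auto simp: dist_norm)
          then show "norm (\<psi> n y) \<le> e * r / 2" using elim by (auto simp: less_imp_le)
        qed (use r in auto)
        then show "dist (deriv (\<psi> n) x) 0 < e" using r \<open>e > 0\<close> by simp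
      qed
    qed
  qed
qed

section \<open>Calculus in the ring of smooth functions\<close>

lemma smooth_at_point: "smooth_on punctured (at_point f)"
  using at_point[of f] by simp

lemma smooth_eqI: "(\<And>p. p \<in> punctured \<Longrightarrow> at_point f p = at_point g p) \<Longrightarrow> f = g"
proof -
  assume *: "\<And>p. p \<in> punctured \<Longrightarrow> at_point f p = at_point g p"
  have "at_point f p = at_point g p" for p
    using at_point[of f] at_point[of g] * by (cases "p \<in> punctured") (simp_all del: split_paired_All)
  then show "f = g" by (simp add: at_point_inject[symmetric] fun_eq_iff)
qed

text \<open>
  Elements of \<^typ>\<open>smooth\<close> vanish at the origin by convention, so a function that is given by a
  formula has to be truncated first.
\<close>

definition mk_smooth :: "(complex \<times> real \<Rightarrow> complex) \<Rightarrow> smooth" where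
  "mk_smooth f = Abs_smooth (\<lambda>p. if p \<in> punctured then f p else 0)"

lemma at_point_mk_smooth:
  assumes "smooth_on punctured f" "p \<in> punctured"
  shows "at_point (mk_smooth f) p = f p"
proof -
  have "smooth_on punctured (\<lambda>p. if p \<in> punctured then f p else 0)"
    by (rule smooth_on_cong[OF open_punctured assms(1)]) simp
  then show ?thesis using assms(2) by (simp add: mk_smooth_def Abs_smooth_inverse)
qed

lemma at_point_simps [simp]:
  "at_point 0 p = 0" "p \<in> punctured \<Longrightarrow> at_point 1 p = 1"
  "at_point (f + g) p = at_point f p + at_point g p"
  "at_point (f - g) p = at_point f p - at_point g p"
  "at_point (f * g) p = at_point f p * at_point g p"
  "at_point (- f) p = - at_point f p"
  "at_point (smooth_scale c f) p = c * at_point f p"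
  by (transfer; simp)+

lemma at_point_power [simp]: "p \<in> punctured \<Longrightarrow> at_point (f ^ n) p = at_point f p ^ n"
  by (induction n) simp_all

lemma at_point_of_nat [simp]: "p \<in> punctured \<Longrightarrow> at_point (of_nat n) p = of_nat n"
  by (induction n) simp_all

lemma at_point_numeral [simp]: "p \<in> punctured \<Longrightarrow> at_point (numeral k) p = numeral k"
  using at_point_of_nat[of p "numeral k"] by simp

lemma at_point_sum: "at_point (\<Sum>i\<in>I. f i) p = (\<Sum>i\<in>I. at_point (f i) p)"
  by (induction I rule: infinite_finite_induct) simp_all

lemma at_point_dir_deriv [simp]:
  "p \<in> punctured \<Longrightarrow> at_point (dir_deriv v f) p = frechet_derivative (at_point f) (at p) v"
  by transfer simp

lemma at_point_d_t: "p \<in> punctured \<Longrightarrow> at_point (d_t f) p = pd_t (at_point f) p"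
  by (simp add: d_t_def pd_t_def)

lemma at_point_d_zbar: "p \<in> punctured \<Longrightarrow> at_point (d_zbar f) p = pd_zbar (at_point f) p"
  by (simp add: d_zbar_def pd_zbar_def)

lemma at_point_has_derivative:
  "p \<in> punctured \<Longrightarrow> (at_point f has_derivative frechet_derivative (at_point f) (at p)) (at p)"
  using smooth_on_has_derivative[OF smooth_at_point] .

text \<open>
  Derivatives only depend on germs; this is how derivatives of elements of \<^typ>\<open>smooth\<close> are
  computed from formulas that hold on an open set.
\<close>

lemma frechet_derivative_eq_on_open:
  assumes "open O'" "p \<in> O'" "(f has_derivative f') (at p)" "\<And>q. q \<in> O' \<Longrightarrow> f q = g q"
  shows "frechet_derivative g (at p) = f'"
  using has_derivative_transform_within_open[OF assms(3,1,2,4)] frechet_derivative_at by metis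

lemma dir_deriv_add: "dir_deriv v (f + g) = dir_deriv v f + dir_deriv v g"
proof (rule smooth_eqI)
  fix p assume p: "p \<in> punctured"
  have "frechet_derivative (at_point (f + g)) (at p) = (\<lambda>v. frechet_derivative (at_point f) (at p) v +
      frechet_derivative (at_point g) (at p) v)"
    by (rule frechet_derivative_eq_on_open[OF open_punctured p
          has_derivative_add[OF at_point_has_derivative[OF p] at_point_has_derivative[OF p]]]) simp
  then show "at_point (dir_deriv v (f + g)) p = at_point (dir_deriv v f + dir_deriv v g) p"
    using p by simp
qed

lemma dir_deriv_mult: "dir_deriv v (f * g) = dir_deriv v f * g + f * dir_deriv v g"
proof (rule smooth_eqI)
  fix p assume p: "p \<in> punctured"
  have "frechet_derivative (at_point (f * g)) (at p) = (\<lambda>v. at_point f p * frechet_derivative (at_point g) (at p) v +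
      frechet_derivative (at_point f) (at p) v * at_point g p)"
    by (rule frechet_derivative_eq_on_open[OF open_punctured p
          has_derivative_mult[OF at_point_has_derivative[OF p] at_point_has_derivative[OF p]]]) simp
  then show "at_point (dir_deriv v (f * g)) p = at_point (dir_deriv v f * g + f * dir_deriv v g) p"
    using p by simp
qed

lemma dir_deriv_scale: "dir_deriv v (smooth_scale c f) = smooth_scale c (dir_deriv v f)"
proof (rule smooth_eqI)
  fix p assume p: "p \<in> punctured"
  have "frechet_derivative (at_point (smooth_scale c f)) (at p) =
      (\<lambda>v. c * frechet_derivative (at_point f) (at p) v)"
    by (rule frechet_derivative_eq_on_open[OF open_punctured p
          has_derivative_mult_right[OF at_point_has_derivative[OF p]]]) simp
  then show "at_point (dir_deriv v (smooth_scale c f)) p = at_point (smooth_scale c (dir_deriv v f)) p"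
    using p by simp
qed

lemma smooth_scale_simps:
  "smooth_scale c (f + g) = smooth_scale c f + smooth_scale c g"
  "smooth_scale (c + d) f = smooth_scale c f + smooth_scale d f"
  "smooth_scale c (smooth_scale d f) = smooth_scale (c * d) f"
  "smooth_scale 1 f = f"
  "smooth_scale c 0 = 0"
  "smooth_scale c f * g = smooth_scale c (f * g)"
  "f * smooth_scale c g = smooth_scale c (f * g)"
  "smooth_scale c (f - g) = smooth_scale c f - smooth_scale c g"
  "smooth_scale c (- f) = - smooth_scale c f"
  by (rule smooth_eqI, simp add: algebra_simps)+

lemma d_t_add: "d_t (f + g) = d_t f + d_t g"
  and d_t_mult: "d_t (f * g) = d_t f * g + f * d_t g"
  and d_t_scale: "d_t (smooth_scale c f) = smooth_scale c (d_t f)"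
  by (simp_all add: d_t_def dir_deriv_add dir_deriv_mult dir_deriv_scale)

lemma d_zbar_add: "d_zbar (f + g) = d_zbar f + d_zbar g"
  and d_zbar_mult: "d_zbar (f * g) = d_zbar f * g + f * d_zbar g"
  and d_zbar_scale: "d_zbar (smooth_scale c f) = smooth_scale c (d_zbar f)"
  by (simp_all add: d_zbar_def dir_deriv_add dir_deriv_mult dir_deriv_scale smooth_scale_simps
      distrib_left distrib_right mult_ac)

lemma d_0 [simp]: "d_t 0 = 0" "d_zbar 0 = 0"
  using d_t_add[of 0 0] d_zbar_add[of 0 0] by simp_all

lemma d_1 [simp]: "d_t 1 = 0" "d_zbar 1 = 0"
  using d_t_mult[of 1 1] d_zbar_mult[of 1 1] by simp_all

lemma d_t_minus: "d_t (- f) = - d_t f" and d_zbar_minus: "d_zbar (- f) = - d_zbar f"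
  using minus_unique[of "d_t f" "d_t (- f)"] minus_unique[of "d_zbar f" "d_zbar (- f)"]
    d_t_add[of f "- f"] d_zbar_add[of f "- f"] by simp_all

lemma d_t_diff: "d_t (f - g) = d_t f - d_t g" and d_zbar_diff: "d_zbar (f - g) = d_zbar f - d_zbar g"
  using d_t_add[of f "- g"] d_zbar_add[of f "- g"] by (simp_all add: d_t_minus d_zbar_minus)

lemma d_sum: "d_t (\<Sum>i\<in>I. f i) = (\<Sum>i\<in>I. d_t (f i))" "d_zbar (\<Sum>i\<in>I. f i) = (\<Sum>i\<in>I. d_zbar (f i))"
  by (induction I rule: infinite_finite_induct) (simp_all add: d_t_add d_zbar_add)

lemma d_zbar_d_t: "d_zbar (d_t f) = d_t (d_zbar f)"
proof -
  have *: "dir_deriv (w, 0) (dir_deriv (0, 1) f) = dir_deriv (0, 1) (dir_deriv (w, 0) f)" for w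
  proof (rule smooth_eqI)
    fix p assume p: "p \<in> punctured"
    have 1: "frechet_derivative (at_point (dir_deriv u f)) (at p) =
      frechet_derivative (\<lambda>q. frechet_derivative (at_point f) (at q) u) (at p)" for u
      by (rule frechet_derivative_eq_on_open[OF open_punctured p smooth_on_has_derivative[OF
             smooth_on_frechet_derivative[OF smooth_at_point] p]]) simp
    show "at_point (dir_deriv (w, 0) (dir_deriv (0, 1) f)) p = at_point (dir_deriv (0, 1) (dir_deriv (w, 0) f)) p"
      using frechet_derivative_commute_t[OF open_punctured smooth_at_point p, of f w] p by (simp add: 1)
  qed
  show ?thesis by (simp add: d_zbar_def d_t_def dir_deriv_add dir_deriv_scale *)
qed

section \<open>The algebraic and the analytic cdga\<close>

text \<open>
  For an algebra concentrated in degrees 0, 1 and 2, the finite sum over the support is a sum of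
  three terms.
\<close>

lemma graded_decomposition_iff:
  fixes f :: "nat \<Rightarrow> 'a::ab_group_add"
  assumes "\<And>n. n > 2 \<Longrightarrow> H n = {0}"
  shows "finite {n. f n \<noteq> 0} \<and> (\<forall>n. f n \<in> H n) \<and> a = (\<Sum>n | f n \<noteq> 0. f n) \<longleftrightarrow>
     (\<forall>n. f n \<in> H n) \<and> a = f 0 + f 1 + f 2"
proof (cases "\<forall>n. f n \<in> H n")
  case True
  then have "f n = 0" if "n > 2" for n using assms[OF that] by auto
  then have "n \<le> 2" if "f n \<noteq> 0" for n using that not_le by blast
  then have sub: "{n. f n \<noteq> 0} \<subseteq> {0, 1, 2}" by force
  then have "(\<Sum>n | f n \<noteq> 0. f n) = (\<Sum>n\<in>{0, 1, 2}. f n)"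
    by (intro sum.mono_neutral_left) auto
  then have "(\<Sum>n | f n \<noteq> 0. f n) = f 0 + f 1 + f 2" by (simp add: add.assoc)
  moreover have "finite {n. f n \<noteq> 0}" using sub finite_subset by blast
  ultimately show ?thesis by simp
qed blast

lemma graded_decompositionI:
  fixes F :: "nat \<Rightarrow> 'a::ab_group_add"
  assumes H: "\<And>n. n > 2 \<Longrightarrow> H n = {0}"
    and "\<And>n. F n \<in> H n" "a = F 0 + F 1 + F 2"
    and "\<And>f. (\<And>n. f n \<in> H n) \<Longrightarrow> a = f 0 + f 1 + f 2 \<Longrightarrow> f = F"
  shows "\<exists>!f. finite {n. f n \<noteq> 0} \<and> (\<forall>n. f n \<in> H n) \<and> a = (\<Sum>n | f n \<noteq> 0. f n)"
  using assms(2-4) graded_decomposition_iff[of H, OF H] by (intro ex1I[of _ F]) blast+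

lemma alg_sel [simp]:
  "alg0 0 = 0" "alg1 0 = 0" "alg0 1 = 1" "alg1 1 = 0"
  "alg0 (a + b) = alg0 a + alg0 b" "alg1 (a + b) = alg1 a + alg1 b"
  "alg0 (a - b) = alg0 a - alg0 b" "alg1 (a - b) = alg1 a - alg1 b"
  "alg0 (- a) = - alg0 a" "alg1 (- a) = - alg1 a"
  "alg0 (a * b) = alg0 a * alg0 b" "alg1 (a * b) = alg0 a * alg1 b + alg1 a * alg0 b"
  by (simp_all add: zero_alg_def one_alg_def plus_alg_def minus_alg_def uminus_alg_def times_alg_def)

lemma form_sel [simp]:
  "form_1 0 = 0" "form_zbar 0 = 0" "form_t 0 = 0" "form_zbar_t 0 = 0"
  "form_1 1 = 1" "form_zbar 1 = 0" "form_t 1 = 0" "form_zbar_t 1 = 0"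
  "form_1 (a + b) = form_1 a + form_1 b" "form_zbar (a + b) = form_zbar a + form_zbar b"
  "form_t (a + b) = form_t a + form_t b" "form_zbar_t (a + b) = form_zbar_t a + form_zbar_t b"
  "form_1 (a - b) = form_1 a - form_1 b" "form_zbar (a - b) = form_zbar a - form_zbar b"
  "form_t (a - b) = form_t a - form_t b" "form_zbar_t (a - b) = form_zbar_t a - form_zbar_t b"
  "form_1 (- a) = - form_1 a" "form_zbar (- a) = - form_zbar a"
  "form_t (- a) = - form_t a" "form_zbar_t (- a) = - form_zbar_t a"
  "form_1 (a * b) = form_1 a * form_1 b"
  "form_zbar (a * b) = form_1 a * form_zbar b + form_zbar a * form_1 b"
  "form_t (a * b) = form_1 a * form_t b + form_t a * form_1 b"
  "form_zbar_t (a * b) = form_1 a * form_zbar_t b + form_zbar a * form_t b - form_t a * form_zbar b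
     + form_zbar_t a * form_1 b"
  by (simp_all add: zero_form_def one_form_def plus_form_def minus_form_def uminus_form_def times_form_def)

lemma alg_eq_iff: "a = b \<longleftrightarrow> alg0 a = alg0 b \<and> alg1 a = alg1 b"
  by (cases a; cases b) simp

lemma form_eq_iff: "a = b \<longleftrightarrow> form_1 a = form_1 b \<and> form_zbar a = form_zbar b \<and>
    form_t a = form_t b \<and> form_zbar_t a = form_zbar_t b"
  by (cases a; cases b) simp

lemma homog_alg: "a \<in> homog alg_dga n \<longleftrightarrow> (n \<noteq> 0 \<longrightarrow> alg0 a = 0) \<and> (n \<noteq> 1 \<longrightarrow> alg1 a = 0)"
  by (cases a) (auto simp: alg_dga_def alg_eq_iff)

lemma homog_form: "a \<in> homog form_dga n \<longleftrightarrow> (n \<noteq> 0 \<longrightarrow> form_1 a = 0) \<and>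
    (n \<noteq> 1 \<longrightarrow> form_zbar a = 0 \<and> form_t a = 0) \<and> (n \<noteq> 2 \<longrightarrow> form_zbar_t a = 0)"
  by (cases a) (auto simp: form_dga_def form_eq_iff)

lemma scal_alg [simp]: "alg0 (scal alg_dga c a) = qring_const c * alg0 a"
  "alg1 (scal alg_dga c a) = qring_const c * alg1 a"
  by (simp_all add: alg_dga_def)

lemma scal_form [simp]: "form_1 (scal form_dga c a) = smooth_scale c (form_1 a)"
  "form_zbar (scal form_dga c a) = smooth_scale c (form_zbar a)"
  "form_t (scal form_dga c a) = smooth_scale c (form_t a)"
  "form_zbar_t (scal form_dga c a) = smooth_scale c (form_zbar_t a)"
  by (simp_all add: form_dga_def)

lemma differential_alg [simp]: "alg0 (differential alg_dga a) = 0"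
  "alg1 (differential alg_dga a) = qring_deriv (alg0 a)"
  by (simp_all add: alg_dga_def)

lemma differential_form [simp]: "form_1 (differential form_dga a) = 0"
  "form_zbar (differential form_dga a) = d_zbar (form_1 a)"
  "form_t (differential form_dga a) = d_t (form_1 a)"
  "form_zbar_t (differential form_dga a) = d_zbar (form_t a) - d_t (form_zbar a)"
  by (simp_all add: form_dga_def)

lemma qring_deriv_add: "qring_deriv (a + b) = qring_deriv a + qring_deriv b"
  by transfer (simp add: pol_deriv_add quadric_rel_def)

lemma qring_deriv_mult: "qring_deriv (a * b) = qring_deriv a * b + a * qring_deriv b"
  by transfer (simp add: pol_deriv_mult quadric_rel_def)

lemma qring_deriv_const: "qring_deriv (qring_const c) = 0"
  by transfer (simp add: pol_deriv_const quadric_rel_def)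

lemma qring_deriv_0 [simp]: "qring_deriv 0 = 0"
  using qring_deriv_add[of 0 0] by simp

lemma qring_const_add: "qring_const (c + d) = qring_const c + qring_const d"
  by transfer (simp add: pol_const_def quadric_rel_def)

lemma qring_const_mult: "qring_const (c * d) = qring_const c * qring_const d"
  by transfer (simp add: pol_const_def quadric_rel_def)

lemma qring_const_1 [simp]: "qring_const 1 = 1"
  by transfer (simp add: pol_const_def quadric_rel_def one_pCons)

lemma vector_space_alg: "vector_space (scal alg_dga)"
  by unfold_locales (simp_all add: alg_eq_iff qring_const_add qring_const_mult algebra_simps)

lemma vector_space_form: "vector_space (scal form_dga)"
  by unfold_locales (simp_all add: form_eq_iff smooth_scale_simps algebra_simps)

lemma linearI_vector_space:
  assumes "vector_space s" "vector_space s'" "\<And>a b. f (a + b) = f a + f b" "\<And>c a. f (s c a) = s' c (f a)"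
  shows "Vector_Spaces.linear s s' f"
  using assms by (simp add: Vector_Spaces.linear_iff)

interpretation alg: cdga alg_dga
proof (rule cdga.intro)
  interpret vector_space "scal alg_dga" by (rule vector_space_alg)
  fix a b :: alg and m n :: nat and c
  show "module.subspace (scal alg_dga) (homog alg_dga n)"
    by (auto simp: subspace_def homog_alg)
  have H: "homog alg_dga n = {0}" if "n > 2" for n
    using that by (auto simp: homog_alg alg_eq_iff)
  define F where "F = (\<lambda>n::nat. if n = 0 then Alg (alg0 a) 0 else if n = 1 then Alg 0 (alg1 a) else 0)"
  have uniq: "f = F" if f: "\<And>n. f n \<in> homog alg_dga n" "a = f 0 + f 1 + f 2" for f
  proof -
    have *: "(n \<noteq> 0 \<longrightarrow> alg0 (f n) = 0) \<and> (n \<noteq> 1 \<longrightarrow> alg1 (f n) = 0)" for n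
      using f(1)[of n] by (simp add: homog_alg)
    show ?thesis using f(2) * by (auto simp: fun_eq_iff alg_eq_iff F_def)
  qed
  have F: "F n \<in> homog alg_dga n" "a = F 0 + F 1 + F 2" for n
    by (auto simp: homog_alg alg_eq_iff F_def)
  show "\<exists>!f. finite {n. f n \<noteq> 0} \<and> (\<forall>n. f n \<in> homog alg_dga n) \<and> a = (\<Sum>n | f n \<noteq> 0. f n)"
    by (rule graded_decompositionI[OF H F uniq])
  show "1 \<in> homog alg_dga 0" by (simp add: homog_alg)
  show "a * b \<in> homog alg_dga (m + n)" if "a \<in> homog alg_dga m" "b \<in> homog alg_dga n"
    using that by (auto simp: homog_alg)
  show "a * b = (- 1) ^ (m * n) * (b * a)" if "a \<in> homog alg_dga m" "b \<in> homog alg_dga n"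
    using that
    by (cases "m = 1 \<and> n = 1"; cases "even (m * n)")
       (auto simp: homog_alg alg_eq_iff algebra_simps)
  show "Vector_Spaces.linear (scal alg_dga) (scal alg_dga) (differential alg_dga)"
    by (rule linearI_vector_space[OF vector_space_alg vector_space_alg])
       (simp_all add: alg_eq_iff qring_deriv_add qring_deriv_mult qring_deriv_const)
  show "differential alg_dga a \<in> homog alg_dga (Suc n)" if "a \<in> homog alg_dga n"
    using that by (auto simp: homog_alg)
  show "differential alg_dga (a * b) = differential alg_dga a * b + (- 1) ^ m * (a * differential alg_dga b)"
    if "a \<in> homog alg_dga m"
    using that by (cases "m = 0") (auto simp: homog_alg alg_eq_iff qring_deriv_mult)
  show "differential alg_dga (differential alg_dga a) = 0"
    by (simp add: alg_eq_iff)
qed (simp_all add: vector_space_alg alg_eq_iff algebra_simps)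

interpretation form: cdga form_dga
proof (rule cdga.intro)
  interpret vector_space "scal form_dga" by (rule vector_space_form)
  fix a b :: form and m n :: nat and c
  show "module.subspace (scal form_dga) (homog form_dga n)"
    by (auto simp: subspace_def homog_form smooth_scale_simps)
  have H: "homog form_dga n = {0}" if "n > 2" for n
    using that by (auto simp: homog_form form_eq_iff)
  define F where "F = (\<lambda>n::nat. if n = 0 then Form (form_1 a) 0 0 0 else
       if n = 1 then Form 0 (form_zbar a) (form_t a) 0 else if n = 2 then Form 0 0 0 (form_zbar_t a) else 0)"
  have uniq: "f = F" if f: "\<And>n. f n \<in> homog form_dga n" "a = f 0 + f 1 + f 2" for f
  proof -
    have *: "(n \<noteq> 0 \<longrightarrow> form_1 (f n) = 0) \<and>
       (n \<noteq> 1 \<longrightarrow> form_zbar (f n) = 0 \<and> form_t (f n) = 0) \<and> (n \<noteq> 2 \<longrightarrow> form_zbar_t (f n) = 0)" for n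
      using f(1)[of n] by (simp add: homog_form)
    show ?thesis using f(2) * by (auto simp: fun_eq_iff form_eq_iff F_def)
  qed
  have F: "F n \<in> homog form_dga n" "a = F 0 + F 1 + F 2" for n
    by (auto simp: homog_form form_eq_iff F_def)
  show "\<exists>!f. finite {n. f n \<noteq> 0} \<and> (\<forall>n. f n \<in> homog form_dga n) \<and> a = (\<Sum>n | f n \<noteq> 0. f n)"
    by (rule graded_decompositionI[OF H F uniq])
  show "1 \<in> homog form_dga 0" by (simp add: homog_form)
  show "a * b \<in> homog form_dga (m + n)" if "a \<in> homog form_dga m" "b \<in> homog form_dga n"
    using that by (cases "m = 0"; cases "m = 1"; cases "m = 2"; cases "n = 0"; cases "n = 1"; cases "n = 2")
      (auto simp: homog_form)
  show "a * b = (- 1) ^ (m * n) * (b * a)" if "a \<in> homog form_dga m" "b \<in> homog form_dga n"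
    using that
    by (cases "m = 0"; cases "m = 1"; cases "m = 2"; cases "n = 0"; cases "n = 1"; cases "n = 2";
        cases "even (m * n)")
       (auto simp: homog_form form_eq_iff algebra_simps)
  show "Vector_Spaces.linear (scal form_dga) (scal form_dga) (differential form_dga)"
    by (rule linearI_vector_space[OF vector_space_form vector_space_form])
       (simp_all add: form_eq_iff d_t_add d_zbar_add d_t_scale d_zbar_scale smooth_scale_simps)
  show "differential form_dga a \<in> homog form_dga (Suc n)" if "a \<in> homog form_dga n"
    using that by (auto simp: homog_form d_zbar_d_t)
  show "differential form_dga (a * b) = differential form_dga a * b + (- 1) ^ m * (a * differential form_dga b)"
    if "a \<in> homog form_dga m"
    using that by (cases "m = 0"; cases "m = 1"; cases "m = 2")
      (auto simp: homog_form form_eq_iff d_t_mult d_zbar_mult d_t_add d_zbar_add algebra_simps)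
  show "differential form_dga (differential form_dga a) = 0"
    by (simp add: form_eq_iff d_zbar_d_t)
qed (simp_all add: vector_space_form form_eq_iff smooth_scale_simps algebra_simps)

section \<open>Derivatives of the generators\<close>

lemma radius_pos: "p \<in> punctured \<Longrightarrow> (fst p \<bullet> fst p) + (snd p)\<^sup>2 > 0"
proof -
  assume "p \<in> punctured"
  then have "fst p \<noteq> 0 \<or> snd p \<noteq> 0" by (cases p) (auto simp: punctured_def zero_prod_def)
  then show ?thesis
    by (metis add_nonneg_pos add_pos_nonneg inner_ge_zero inner_gt_zero_iff zero_le_power2 zero_less_power2)
qed

lemma radius_eq: "radius z t = sqrt (z \<bullet> z + t\<^sup>2)"
  by (simp add: radius_def inner_complex_def)

lemma radius_gt_0: "p \<in> punctured \<Longrightarrow> radius (fst p) (snd p) > 0"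
  using radius_pos by (simp add: radius_eq)

lemma radius_sq: "(of_real (radius z t))\<^sup>2 = z * cnj z + (of_real t)\<^sup>2"
proof -
  have "(radius z t)\<^sup>2 = z \<bullet> z + t\<^sup>2" by (simp add: radius_eq)
  then have "(complex_of_real (radius z t))\<^sup>2 = of_real (z \<bullet> z + t\<^sup>2)" by (metis of_real_power)
  then show ?thesis by (simp add: complex_eq_iff inner_complex_def power2_eq_square)
qed

lemma smooth_on_radius: "smooth_on punctured (\<lambda>p. radius (fst p) (snd p))"
  unfolding radius_eq using radius_pos open_punctured
  by (intro smooth_on_sqrt smooth_on_add smooth_on_power smooth_on_snd smooth_on_fst smooth_on_ident
      smooth_on_bilinear[OF _ bounded_bilinear_inner]) auto

text \<open>
  The coordinate functions, and \<open>1/r\<close>, as elements of the ring of smooth functions. All other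
  functions and forms in the morphism are polynomials in these four.
\<close>

definition sm_z :: smooth where "sm_z = mk_smooth fst"
definition sm_zbar :: smooth where "sm_zbar = mk_smooth (\<lambda>p. cnj (fst p))"
definition sm_t :: smooth where "sm_t = mk_smooth (\<lambda>p. of_real (snd p))"
definition sm_inv_radius :: smooth where "sm_inv_radius = mk_smooth (\<lambda>p. of_real (inverse (radius (fst p) (snd p))))"

lemma at_point_coordinates [simp]:
  assumes "p \<in> punctured"
  shows "at_point sm_z p = fst p" "at_point sm_zbar p = cnj (fst p)" "at_point sm_t p = of_real (snd p)"
    "at_point sm_inv_radius p = inverse (of_real (radius (fst p) (snd p)))"
proof -
  show "at_point sm_z p = fst p" "at_point sm_zbar p = cnj (fst p)" "at_point sm_t p = of_real (snd p)"
    unfolding sm_z_def sm_zbar_def sm_t_def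
    by (intro at_point_mk_smooth[OF _ assms] smooth_on_cnj smooth_on_of_real smooth_on_fst smooth_on_snd
       smooth_on_ident open_punctured)+
  have "smooth_on punctured (\<lambda>p. complex_of_real (inverse (radius (fst p) (snd p))))"
    using radius_gt_0 by (intro smooth_on_of_real smooth_on_inverse smooth_on_radius open_punctured) force
  from at_point_mk_smooth[OF this assms]
  show "at_point sm_inv_radius p = inverse (of_real (radius (fst p) (snd p)))" by (simp add: sm_inv_radius_def)
qed

lemma pd_of_derivative:
  assumes "p \<in> punctured" "(f has_derivative f') (at p)" "\<And>q. q \<in> punctured \<Longrightarrow> f q = at_point g q"
  shows "at_point (d_t g) p = f' (0, 1)" "at_point (d_zbar g) p = (f' (1, 0) + \<i> * f' (\<i>, 0)) / 2"
  using frechet_derivative_eq_on_open[OF open_punctured assms] assms(1)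
  by (simp_all add: at_point_d_t at_point_d_zbar pd_t_def pd_zbar_def)

lemma d_coordinates:
  "d_t sm_z = 0" "d_zbar sm_z = 0" "d_t sm_zbar = 0" "d_zbar sm_zbar = 1" "d_t sm_t = 1" "d_zbar sm_t = 0"
proof -
  have 1: "(fst has_derivative fst) (at p)" for p :: "complex \<times> real"
    by (rule bounded_linear_imp_has_derivative[OF bounded_linear_fst])
  have 2: "((\<lambda>p. cnj (fst p)) has_derivative (\<lambda>p. cnj (fst p))) (at p)" for p :: "complex \<times> real"
    by (intro bounded_linear_imp_has_derivative bounded_linear_compose[OF bounded_linear_cnj bounded_linear_fst])
  have 3: "((\<lambda>p. of_real (snd p)) has_derivative (\<lambda>p. complex_of_real (snd p))) (at p)" for p :: "complex \<times> real"
    by (intro bounded_linear_imp_has_derivative bounded_linear_compose[OF bounded_linear_of_real bounded_linear_snd])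
  show "d_t sm_z = 0" "d_zbar sm_z = 0"
    by (rule smooth_eqI, subst pd_of_derivative[OF _ 1], simp_all)+
  show "d_t sm_zbar = 0" "d_zbar sm_zbar = 1"
    by (rule smooth_eqI, subst pd_of_derivative[OF _ 2], simp_all)+
  show "d_t sm_t = 1" "d_zbar sm_t = 0"
    by (rule smooth_eqI, subst pd_of_derivative[OF _ 3], simp_all)+
qed

lemma inv_radius_relation: "sm_inv_radius ^ 2 * (sm_z * sm_zbar + sm_t ^ 2) = 1"
proof (rule smooth_eqI)
  fix p assume p: "p \<in> punctured"
  have "(complex_of_real (radius (fst p) (snd p)))\<^sup>2 \<noteq> 0" using radius_gt_0[OF p] by simp
  from left_inverse[OF this] show "at_point (sm_inv_radius ^ 2 * (sm_z * sm_zbar + sm_t ^ 2)) p = at_point 1 p"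
    using p by (simp add: power_inverse radius_sq)
qed

lemma d_power2: "d_t (f ^ 2) = 2 * f * d_t f" "d_zbar (f ^ 2) = 2 * f * d_zbar f"
  by (simp_all add: power2_eq_square d_t_mult d_zbar_mult)

text \<open>
  Differentiating \<open>\<rho>\<^sup>2 (z zbar + t\<^sup>2) = 1\<close> and multiplying by \<open>\<rho>\<close> gives
  \<open>2 d\<rho> = -\<rho>\<^sup>3 d(z zbar + t\<^sup>2)\<close>, so the square root itself never has to be
  differentiated.
\<close>

lemma d_inv_radius: "d_t sm_inv_radius = - (sm_t * sm_inv_radius ^ 3)" "d_zbar sm_inv_radius = smooth_scale (- 1/2) (sm_z * sm_inv_radius ^ 3)"
proof -
  let ?q = "sm_z * sm_zbar + sm_t ^ 2"
  have rq: "sm_inv_radius * sm_inv_radius * ?q = 1" using inv_radius_relation by (simp add: power2_eq_square)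
  have "d_t (sm_inv_radius ^ 2 * ?q) = 0" "d_zbar (sm_inv_radius ^ 2 * ?q) = 0" unfolding inv_radius_relation by simp_all
  then have "2 * sm_inv_radius * d_t sm_inv_radius * ?q + sm_inv_radius ^ 2 * (2 * sm_t) = 0"
    "2 * sm_inv_radius * d_zbar sm_inv_radius * ?q + sm_inv_radius ^ 2 * sm_z = 0"
    by (simp_all add: d_t_mult d_zbar_mult d_power2 d_t_add d_zbar_add d_coordinates)
  then have "sm_inv_radius * (2 * sm_inv_radius * d_t sm_inv_radius * ?q + sm_inv_radius ^ 2 * (2 * sm_t)) = 0"
    "sm_inv_radius * (2 * sm_inv_radius * d_zbar sm_inv_radius * ?q + sm_inv_radius ^ 2 * sm_z) = 0" by simp_all
  moreover have "sm_inv_radius * (2 * sm_inv_radius * d_t sm_inv_radius * ?q + sm_inv_radius ^ 2 * (2 * sm_t)) =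
      2 * d_t sm_inv_radius * (sm_inv_radius * sm_inv_radius * ?q) + 2 * (sm_t * sm_inv_radius ^ 3)"
    "sm_inv_radius * (2 * sm_inv_radius * d_zbar sm_inv_radius * ?q + sm_inv_radius ^ 2 * sm_z) =
      2 * d_zbar sm_inv_radius * (sm_inv_radius * sm_inv_radius * ?q) + sm_z * sm_inv_radius ^ 3"
    by (simp_all add: algebra_simps power2_eq_square power3_eq_cube)
  ultimately have *: "2 * d_t sm_inv_radius + 2 * (sm_t * sm_inv_radius ^ 3) = 0" "2 * d_zbar sm_inv_radius + sm_z * sm_inv_radius ^ 3 = 0"
    unfolding rq by simp_all
  show "d_t sm_inv_radius = - (sm_t * sm_inv_radius ^ 3)"
  proof (rule smooth_eqI)
    fix p assume p: "p \<in> punctured"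
    show "at_point (d_t sm_inv_radius) p = at_point (- (sm_t * sm_inv_radius ^ 3)) p"
      using arg_cong[OF *(1), of "\<lambda>f. at_point f p"] p
      by (simp add: eq_neg_iff_add_eq_0 distrib_left[symmetric] del: distrib_left_numeral at_point_coordinates)
  qed
  show "d_zbar sm_inv_radius = smooth_scale (- 1/2) (sm_z * sm_inv_radius ^ 3)"
  proof (rule smooth_eqI)
    fix p assume p: "p \<in> punctured"
    have "2 * at_point (d_zbar sm_inv_radius) p + at_point (sm_z * sm_inv_radius ^ 3) p = 0"
      using arg_cong[OF *(2), of "\<lambda>f. at_point f p"] p by (simp del: at_point_coordinates)
    then have "at_point (d_zbar sm_inv_radius) p = (- 1/2) * at_point (sm_z * sm_inv_radius ^ 3) p"
      by algebra
    then show "at_point (d_zbar sm_inv_radius) p = at_point (smooth_scale (- 1/2) (sm_z * sm_inv_radius ^ 3)) p"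
      using p by (simp del: at_point_coordinates)
  qed
qed

definition sm_x :: smooth where "sm_x = sm_t * sm_inv_radius"
definition sm_lambda :: smooth where "sm_lambda = sm_zbar * sm_inv_radius ^ 2"
text \<open>
  The two components of \<open>j(\<omega>)\<close>.
\<close>

definition omega_zbar :: smooth where "omega_zbar = sm_t * sm_inv_radius ^ 3"
definition omega_t :: smooth where "omega_t = - 2 * (sm_zbar * sm_inv_radius ^ 3)"

lemma sphere_pointwise:
  assumes "p \<in> punctured"
  shows "at_point sm_inv_radius p * at_point sm_inv_radius p * (fst p * cnj (fst p) + of_real (snd p) * of_real (snd p)) = 1"
  using arg_cong[OF inv_radius_relation, of "\<lambda>f. at_point f p"] assms
  by (simp add: power2_eq_square del: at_point_coordinates(4))

lemma quadric_relation: "sm_z * sm_lambda + sm_x ^ 2 = 1"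
proof (rule smooth_eqI)
  fix p assume p: "p \<in> punctured"
  show "at_point (sm_z * sm_lambda + sm_x ^ 2) p = at_point 1 p"
    using p sphere_pointwise[OF p]
    by (simp add: sm_lambda_def sm_x_def power2_eq_square algebra_simps del: at_point_coordinates(4))
qed

text \<open>
  The differentials of \<open>x\<close> and \<open>\<lambda>\<close> are those prescribed in the algebra, and \<open>j(\<omega>)\<close> is
  closed. After inserting the derivatives of \<open>1/r\<close>, each identity is a consequence of
  \<open>\<rho>\<^sup>2 (z zbar + t\<^sup>2) = 1\<close>.
\<close>

lemma d_generators:
  "d_zbar sm_x = smooth_scale (- 1/2) (sm_z * omega_zbar)" "d_t sm_x = smooth_scale (- 1/2) (sm_z * omega_t)"
  "d_zbar sm_lambda = sm_x * omega_zbar" "d_t sm_lambda = sm_x * omega_t"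
  "d_zbar omega_t = d_t omega_zbar"
proof -
  note ds = d_t_mult d_zbar_mult d_t_minus d_zbar_minus d_coordinates d_inv_radius power2_eq_square power3_eq_cube
    sm_x_def sm_lambda_def omega_zbar_def omega_t_def d_t_add d_zbar_add d_t_scale d_zbar_scale 
  have two: "d_t (2 :: smooth) = 0" "d_zbar (2 :: smooth) = 0"
    using d_t_add[of 1 1] d_zbar_add[of 1 1] by simp_all
  show "d_zbar sm_x = smooth_scale (- 1/2) (sm_z * omega_zbar)"
    by (rule smooth_eqI) (simp add: ds del: at_point_coordinates(4))
  show "d_t sm_x = smooth_scale (- 1/2) (sm_z * omega_t)"
  proof (rule smooth_eqI)
    fix p assume p: "p \<in> punctured"
    show "at_point (d_t sm_x) p = at_point (smooth_scale (- 1/2) (sm_z * omega_t)) p"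
      using p sphere_pointwise[OF p] by (simp add: ds del: at_point_coordinates(4)) algebra
  qed
  show "d_zbar sm_lambda = sm_x * omega_zbar"
  proof (rule smooth_eqI)
    fix p assume p: "p \<in> punctured"
    show "at_point (d_zbar sm_lambda) p = at_point (sm_x * omega_zbar) p"
      using p sphere_pointwise[OF p] by (simp add: ds del: at_point_coordinates(4)) algebra
  qed
  show "d_t sm_lambda = sm_x * omega_t"
  proof (rule smooth_eqI)
    fix p assume p: "p \<in> punctured"
    show "at_point (d_t sm_lambda) p = at_point (sm_x * omega_t) p"
      using p by (simp add: ds del: at_point_coordinates(4)) 
  qed
  show "d_zbar omega_t = d_t omega_zbar"
  proof (rule smooth_eqI)
    fix p assume p: "p \<in> punctured"
    show "at_point (d_zbar omega_t) p = at_point (d_t omega_zbar) p"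
      using p sphere_pointwise[OF p] by (simp add: ds two del: at_point_coordinates(4)) algebra
  qed
qed

section \<open>The morphism\<close>

text \<open>
  Elements are generated by constants and the three variables, so a statement that is stable under
  sums and products, such as one about derivations, need only be checked on these.
\<close>

lemma pol_induct [case_names const z lambda x add mult]:
  assumes const: "\<And>c. P (pol_const c)" and gens: "P pol_z" "P pol_lambda" "P pol_x"
    and add: "\<And>p q. P p \<Longrightarrow> P q \<Longrightarrow> P (p + q)" and mult: "\<And>p q. P p \<Longrightarrow> P q \<Longrightarrow> P (p * q)"
  shows "P p"
proof -
  have 0: "P 0" using const[of 0] by (simp add: pol_const_def)
  have 1: "P [:[:a:]:]" for a
  proof (induction a)
    case (pCons b a)
    have "[:[:pCons b a:]:] = pol_const b + pol_z * [:[:a:]:]" by (simp add: pol_const_def pol_z_def)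
    with pCons show ?case by (metis add mult const gens)
  qed (simp add: 0)
  have 2: "P [:a:]" for a
  proof (induction a)
    case (pCons b a)
    have "[:pCons b a:] = [:[:b:]:] + pol_lambda * [:a:]" by (simp add: pol_lambda_def)
    with pCons show ?case by (metis add mult 1 gens)
  qed (simp add: 0)
  show ?thesis
  proof (induction p)
    case (pCons b a)
    have "pCons b a = [:b:] + pol_x * a" by (simp add: pol_x_def)
    with pCons show ?case by (metis add mult 2 gens)
  qed (rule 0)
qed

lemma qring_induct [case_names const z lambda x add mult]:
  assumes "\<And>c. P (qring_const c)" "P qring_z" "P qring_lambda" "P qring_x"
    and "\<And>p q. P p \<Longrightarrow> P q \<Longrightarrow> P (p + q)" "\<And>p q. P p \<Longrightarrow> P q \<Longrightarrow> P (p * q)"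
  shows "P q"
proof -
  have "P (abs_qring p)" for p
  proof (induction p rule: pol_induct)
    case (add p q) then show ?case using assms(5)[of "abs_qring p" "abs_qring q"] by (simp add: plus_qring.abs_eq)
  next
    case (mult p q) then show ?case using assms(6)[of "abs_qring p" "abs_qring q"] by (simp add: times_qring.abs_eq)
  qed (use assms(1-4) in \<open>simp_all add: qring_const_def qring_z_def qring_lambda_def qring_x_def\<close>)
  then show ?thesis by (metis Quotient_qring Quotient_abs_rep)
qed

definition pol_eval :: "pol \<Rightarrow> complex \<Rightarrow> complex \<Rightarrow> complex \<Rightarrow> complex" where
  "pol_eval p z l x = poly (poly (poly p [:[:x:]:]) [:l:]) z"

lemma pol_eval_simps [simp]:
  "pol_eval (p + q) z l x = pol_eval p z l x + pol_eval q z l x"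
  "pol_eval (p - q) z l x = pol_eval p z l x - pol_eval q z l x"
  "pol_eval (p * q) z l x = pol_eval p z l x * pol_eval q z l x"
  "pol_eval (pol_const c) z l x = c" "pol_eval pol_z z l x = z" "pol_eval pol_lambda z l x = l"
  "pol_eval pol_x z l x = x" "pol_eval 0 z l x = 0" "pol_eval 1 z l x = 1"
  by (simp_all add: pol_eval_def pol_const_def pol_z_def pol_lambda_def pol_x_def)

definition pol_fun :: "pol \<Rightarrow> complex \<times> real \<Rightarrow> complex" where
  "pol_fun p q = pol_eval p (fst q) (at_point sm_lambda q) (at_point sm_x q)"

lemma smooth_on_pol_fun: "smooth_on punctured (pol_fun p)"
proof (induction p rule: pol_induct)
  case (const c)
  show ?case by (simp add: pol_fun_def[abs_def] smooth_on_const open_punctured)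
next
  case z
  show ?case by (simp add: pol_fun_def[abs_def] smooth_on_fst smooth_on_ident open_punctured)
qed (simp_all add: pol_fun_def[abs_def] smooth_at_point smooth_on_add smooth_on_mult open_punctured)

lemma pol_fun_quadric: "p \<in> punctured \<Longrightarrow> pol_fun quadric p = 0"
  using arg_cong[OF quadric_relation, of "\<lambda>f. at_point f p"]
  by (simp add: pol_fun_def quadric_def power2_eq_square)

text \<open>
  The degree 0 part of the morphism.
\<close>

lift_definition qfun :: "qring \<Rightarrow> smooth" is "\<lambda>p. mk_smooth (pol_fun p)"
proof -
  fix p q assume "quadric_rel p q"
  then obtain r where r: "p - q = quadric * r" by (auto simp: quadric_rel_def)
  show "mk_smooth (pol_fun p) = mk_smooth (pol_fun q)"
  proof (rule smooth_eqI)
    fix x assume x: "x \<in> punctured"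
    have "pol_fun p x - pol_fun q x = pol_fun (quadric * r) x" unfolding r[symmetric] by (simp add: pol_fun_def)
    also have "\<dots> = 0" using pol_fun_quadric[OF x] by (simp add: pol_fun_def)
    finally show "at_point (mk_smooth (pol_fun p)) x = at_point (mk_smooth (pol_fun q)) x"
      by (simp add: at_point_mk_smooth[OF smooth_on_pol_fun x])
  qed
qed

lemma at_point_qfun_abs: "p \<in> punctured \<Longrightarrow> at_point (qfun (abs_qring P)) p = pol_fun P p"
  by (simp add: qfun.abs_eq at_point_mk_smooth smooth_on_pol_fun)

lemma qfun_simps [simp]:
  "qfun (a + b) = qfun a + qfun b" "qfun (a * b) = qfun a * qfun b" "qfun 1 = 1" "qfun 0 = 0"
  "qfun (qring_const c) = smooth_scale c 1"
  "qfun qring_z = sm_z" "qfun qring_lambda = sm_lambda" "qfun qring_x = sm_x"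
  by (transfer, rule smooth_eqI, simp add: at_point_mk_smooth smooth_on_pol_fun, simp add: pol_fun_def)+

lemma qring_deriv_generators:
  "qring_deriv qring_z = 0" "qring_deriv qring_lambda = qring_x"
  "qring_deriv qring_x = qring_const (- 1/2) * qring_z"
proof -
  show "qring_deriv qring_z = 0" by transfer (simp add: pol_deriv_z quadric_rel_def)
  show "qring_deriv qring_lambda = qring_x" by transfer (simp add: pol_deriv_lambda quadric_rel_def)
  show "qring_deriv qring_x = qring_const (- 1/2) * qring_z"
    by transfer (simp add: pol_deriv_x quadric_rel_def pol_const_def flip: smult_minus_left)
qed

lemma d_smooth_scale_1 [simp]: "d_t (smooth_scale c 1) = 0" "d_zbar (smooth_scale c 1) = 0"
  by (simp_all add: d_t_scale d_zbar_scale smooth_scale_simps)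

text \<open>
  Both sides are derivations along \<open>qfun\<close>, so it suffices to compare them on generators.
\<close>

lemma d_qfun: "d_zbar (qfun q) = qfun (qring_deriv q) * omega_zbar \<and> d_t (qfun q) = qfun (qring_deriv q) * omega_t"
  by (induction q rule: qring_induct)
     (simp_all add: qring_deriv_const qring_deriv_generators qring_deriv_add qring_deriv_mult
       d_coordinates d_generators d_t_add d_zbar_add d_t_mult d_zbar_mult smooth_scale_simps algebra_simps)

definition alg_to_form :: "alg \<Rightarrow> form" where
  "alg_to_form a = Form (qfun (alg0 a)) (qfun (alg1 a) * omega_zbar) (qfun (alg1 a) * omega_t) 0"

lemma alg_to_form_sel [simp]:
  "form_1 (alg_to_form a) = qfun (alg0 a)" "form_zbar (alg_to_form a) = qfun (alg1 a) * omega_zbar"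
  "form_t (alg_to_form a) = qfun (alg1 a) * omega_t" "form_zbar_t (alg_to_form a) = 0"
  by (simp_all add: alg_to_form_def)

interpretation alg_form: cdga_hom alg_dga form_dga alg_to_form
proof (intro cdga_hom.intro cdga_hom_axioms.intro)
  show "cdga alg_dga" "cdga form_dga" by unfold_locales
  show "Vector_Spaces.linear (scal alg_dga) (scal form_dga) alg_to_form"
    by (rule linearI_vector_space[OF vector_space_alg vector_space_form])
       (simp_all add: form_eq_iff algebra_simps smooth_scale_simps)
  fix a b n
  show "alg_to_form 1 = 1" by (simp add: form_eq_iff)
  show "alg_to_form (a * b) = alg_to_form a * alg_to_form b" by (simp add: form_eq_iff algebra_simps)
  show "a \<in> homog alg_dga n \<Longrightarrow> alg_to_form a \<in> homog form_dga n" by (auto simp: homog_alg homog_form)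
  show "alg_to_form (differential alg_dga a) = differential form_dga (alg_to_form a)"
    using d_qfun[of "alg0 a"] d_qfun[of "alg1 a"]
    by (simp add: form_eq_iff d_t_mult d_zbar_mult d_generators algebra_simps)
qed

section \<open>Smooth functions and the axis\<close>

lemma nonzero_in_punctured: "z \<noteq> 0 \<Longrightarrow> (z, t) \<in> punctured" "t \<noteq> 0 \<Longrightarrow> (z, t) \<in> punctured"
  by (auto simp: punctured_def zero_prod_def)

lemma at_point_axis_limit:
  assumes "t \<noteq> 0"
  shows "(\<lambda>n. at_point f (of_real (inverse (real (Suc n))), t)) \<longlonglongrightarrow> at_point f (0, t)"
proof -
  have "isCont (at_point f) (0, t)"
    using smooth_on_continuous[OF smooth_at_point] open_punctured nonzero_in_punctured(2)[OF assms]
    by (simp add: continuous_on_eq_continuous_at)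
  moreover have "(\<lambda>n. (complex_of_real (inverse (real (Suc n))), t)) \<longlonglongrightarrow> (of_real 0, t)"
    by (intro tendsto_intros LIMSEQ_inverse_real_of_nat)
  ultimately show ?thesis using isCont_tendsto_compose by fastforce
qed

text \<open>
  The points off the axis \<open>z = 0\<close> are dense.
\<close>

lemma smooth_eqI_off_axis:
  assumes "\<And>z t. z \<noteq> 0 \<Longrightarrow> at_point f (z, t) = at_point g (z, t)"
  shows "f = g"
proof (rule smooth_eqI)
  fix p assume p: "p \<in> punctured"
  obtain z t where zt: "p = (z, t)" by (cases p)
  show "at_point f p = at_point g p"
  proof (cases "z = 0")
    case True
    then have "t \<noteq> 0" using p zt by (auto simp: punctured_def zero_prod_def)
    have "(\<lambda>n. at_point f (of_real (inverse (real (Suc n))), t)) = (\<lambda>n. at_point g (of_real (inverse (real (Suc n))), t))"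
      by (rule ext, rule assms) (simp del: of_nat_Suc)
    then show ?thesis
      using at_point_axis_limit[OF \<open>t \<noteq> 0\<close>, of f] at_point_axis_limit[OF \<open>t \<noteq> 0\<close>, of g] True zt
      by (metis LIMSEQ_unique)
  qed (use assms zt in auto)
qed

text \<open>
  Off the axis the whole line over \<open>z\<close> lies in the domain. On the axis the two half-lines are
  separated by the origin, and one passes from one to the other through neighbouring lines.
\<close>

lemma d_t_0_imp_constant:
  assumes "d_t f = 0" "(z, s) \<in> punctured" "(z, t) \<in> punctured"
  shows "at_point f (z, s) = at_point f (z, t)"
proof -
  have off: "at_point f (w, s) = at_point f (w, t)" if "w \<noteq> 0" for w
  proof -
    have "((\<lambda>t. at_point f (w, t)) has_derivative (\<lambda>h. 0)) (at t within UNIV)" for t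
      using pd_t_vector_derivative[OF smooth_at_point nonzero_in_punctured(1)[OF that], of f t UNIV]
        arg_cong[OF assms(1), of "\<lambda>g. at_point g (w, t)"] nonzero_in_punctured(1)[OF that, of t]
      by (simp add: at_point_d_t has_vector_derivative_def)
    from has_derivative_zero_unique[OF convex_UNIV this] show ?thesis by simp
  qed
  show ?thesis
  proof (cases "z = 0")
    case True
    then have st: "s \<noteq> 0" "t \<noteq> 0" using assms by (auto simp: punctured_def zero_prod_def)
    have "(\<lambda>n. at_point f (of_real (inverse (real (Suc n))), s)) = (\<lambda>n. at_point f (of_real (inverse (real (Suc n))), t))"
      by (rule ext, rule off) (simp del: of_nat_Suc)
    then show ?thesis
      using at_point_axis_limit[OF st(1), of f] at_point_axis_limit[OF st(2), of f] True
      by (metis LIMSEQ_unique)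
  qed (use off in auto)
qed


lemma holomorphic_if_d_0:
  assumes "d_t f = 0" "d_zbar f = 0"
  shows "(\<lambda>z. at_point f (z, 1)) holomorphic_on UNIV"
proof (rule holomorphic_on_if_pd_cbar_0)
  have in1: "(z, 1) \<in> punctured" for z by (simp add: nonzero_in_punctured)
  show "smooth_on UNIV (\<lambda>z. at_point f (z, 1))"
    by (rule smooth_on_compose[OF _ smooth_at_point])
       (auto intro!: smooth_on_Pair smooth_on_ident smooth_on_const in1 simp: open_punctured)
  fix z :: complex
  have d: "((\<lambda>z. (z, 1)) has_derivative (\<lambda>v. (v, 0::real))) (at z)"
    by (auto intro!: derivative_eq_intros)
  have "pd_cbar (\<lambda>z. at_point f (z, 1)) z = pd_zbar (at_point f) (z, 1)"
    using frechet_derivative_compose[OF d smooth_at_point in1, of f] by (simp add: pd_cbar_def pd_zbar_def)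
  also have "\<dots> = at_point (d_zbar f) (z, 1)" using at_point_d_zbar[OF in1] by simp
  finally show "pd_cbar (\<lambda>z. at_point f (z, 1)) z = 0" using assms by simp
qed simp

section \<open>Independence of the classes of \<open>\<lambda>\<^sup>k \<omega>\<close>\<close>

definition smooth_poly :: "complex poly \<Rightarrow> smooth \<Rightarrow> smooth" where
  "smooth_poly Q g = poly (map_poly (\<lambda>c. smooth_scale c 1) Q) g"

lemma smooth_scale_0 [simp]: "smooth_scale 0 f = 0"
  by (rule smooth_eqI) simp

lemma smooth_poly_pCons: "smooth_poly (pCons a Q) g = smooth_scale a 1 + g * smooth_poly Q g"
  by (simp add: smooth_poly_def map_poly_pCons)

lemma at_point_smooth_poly [simp]: "p \<in> punctured \<Longrightarrow> at_point (smooth_poly Q g) p = poly Q (at_point g p)"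
  by (induction Q) (simp_all add: smooth_poly_pCons, simp add: smooth_poly_def)

lemma d_smooth_poly: "d_t (smooth_poly Q g) = smooth_poly (pderiv Q) g * d_t g" "d_zbar (smooth_poly Q g) = smooth_poly (pderiv Q) g * d_zbar g"
proof -
  have 0: "smooth_poly 0 g = 0" by (simp add: smooth_poly_def)
  have add: "smooth_poly (P + Q) g = smooth_poly P g + smooth_poly Q g" for P Q
    by (rule smooth_eqI) simp
  have "d_t (smooth_poly Q g) = smooth_poly (pderiv Q) g * d_t g \<and> d_zbar (smooth_poly Q g) = smooth_poly (pderiv Q) g * d_zbar g"
    by (induction Q)
       (simp_all add: 0 smooth_poly_pCons pderiv_pCons add d_t_add d_zbar_add d_t_mult d_zbar_mult
         algebra_simps smooth_scale_simps(5))
  then show "d_t (smooth_poly Q g) = smooth_poly (pderiv Q) g * d_t g" "d_zbar (smooth_poly Q g) = smooth_poly (pderiv Q) g * d_zbar g"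
    by auto
qed

lemma poly_antiderivative:
  fixes p :: "'a::field_char_0 poly"
  obtains P where "pderiv P = p"
proof
  have "pderiv (\<Sum>i\<le>degree p. monom (coeff p i / of_nat (Suc i)) (Suc i)) = (\<Sum>i\<le>degree p. monom (coeff p i) i)"
    unfolding pderiv_sum' by (rule sum.cong) (simp_all add: pderiv_monom del: of_nat_Suc)
  then show "pderiv (\<Sum>i\<le>degree p. monom (coeff p i / of_nat (Suc i)) (Suc i)) = p"
    by (simp add: poly_as_sum_of_monoms)
qed

text \<open>
  The difference of the values at 1 and -1 is the integral of the positive function
  \<open>(1 - s\<^sup>2)\<^sup>k\<close> over \<open>(-1, 1)\<close>. It is evaluated for the real antiderivative, by the mean
  value theorem.
\<close>

lemma one_minus_sq_antiderivative:
  obtains Q :: "complex poly" where "pderiv Q = [:1, 0, - 1:] ^ k" "poly Q 1 \<noteq> poly Q (- 1)"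
proof -
  obtain R :: "real poly" where R: "pderiv R = [:1, 0, - 1:] ^ k" by (rule poly_antiderivative)
  let ?Q = "map_poly complex_of_real R"
  have "pderiv ?Q = map_poly complex_of_real (pderiv R)"
    by (rule poly_eqI) (simp add: coeff_pderiv coeff_map_poly)
  also have "\<dots> = [:1, 0, - 1:] ^ k"
    unfolding R
  proof (induction k)
    case (Suc k)
    have "map_poly complex_of_real (A * B) = map_poly complex_of_real A * map_poly complex_of_real B" for A B
      by (rule poly_eqI) (simp add: coeff_map_poly coeff_mult)
    moreover have "map_poly complex_of_real [:1, 0, - 1:] = [:1, 0, - 1:]" by (simp add: map_poly_pCons)
    ultimately show ?case by (simp only: power_Suc Suc)
  qed simp
  finally have 1: "pderiv ?Q = [:1, 0, - 1:] ^ k" .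
  have "\<exists>\<xi>. - 1 < \<xi> \<and> \<xi> < 1 \<and> poly R 1 - poly R (- 1) = (1 - (- 1)) * poly (pderiv R) \<xi>"
    by (rule MVT2) auto
  then obtain \<xi> where \<xi>: "- 1 < \<xi>" "\<xi> < 1" "poly R 1 - poly R (- 1) = 2 * (1 - \<xi>\<^sup>2) ^ k"
    by (auto simp: R poly_power power2_eq_square)
  have "\<xi>\<^sup>2 < 1" using \<xi> by (simp add: abs_square_less_1 abs_less_iff)
  then have "poly R 1 \<noteq> poly R (- 1)" using \<xi>(3) by auto
  moreover have of_real: "poly ?Q (of_real x) = of_real (poly R x)" for x
    by (induction R) (simp_all add: map_poly_pCons)
  ultimately have "poly ?Q 1 \<noteq> poly ?Q (- 1)"
    using of_real[of 1] of_real[of "- 1"] by (metis of_real_1 of_real_eq_iff of_real_minus)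
  with 1 that show thesis by blast
qed

lemma one_minus_x_sq: "smooth_poly ([:1, 0, - 1:] ^ k) sm_x = (sm_z * sm_lambda) ^ k"
proof (rule smooth_eqI)
  fix p assume p: "p \<in> punctured"
  have "1 - (at_point sm_x p)\<^sup>2 = fst p * at_point sm_lambda p"
    using arg_cong[OF quadric_relation, of "\<lambda>f. at_point f p"] p by (simp add: algebra_simps)
  then show "at_point (smooth_poly ([:1, 0, - 1:] ^ k) sm_x) p = at_point ((sm_z * sm_lambda) ^ k) p"
    using p by (simp add: poly_power power2_eq_square)
qed

text \<open>
  As \<open>d'x = -z \<omega>/2\<close> and \<open>1 - x\<^sup>2 = z \<lambda>\<close>, this says that
  \<open>-2 z\<^sup>-\<^sup>k\<^sup>-\<^sup>1 Q(x)\<close> is a primitive of \<open>\<lambda>\<^sup>k \<omega>\<close> where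
  \<open>z \<noteq> 0\<close>.
\<close>

lemma d_antiderivative_x:
  assumes "pderiv Q = [:1, 0, - 1:] ^ k"
  shows "d_t (smooth_poly Q sm_x) = smooth_scale (- 1/2) (sm_z ^ (k + 1) * (sm_lambda ^ k * omega_t))"
    and "d_zbar (smooth_poly Q sm_x) = smooth_scale (- 1/2) (sm_z ^ (k + 1) * (sm_lambda ^ k * omega_zbar))"
  by (simp_all add: d_smooth_poly assms one_minus_x_sq d_generators smooth_scale_simps power_mult_distrib mult_ac)

lemma sm_x_axis: "t \<noteq> 0 \<Longrightarrow> at_point sm_x (0, t) = of_real (sgn t)"
  by (simp add: sm_x_def nonzero_in_punctured radius_eq sgn_div_norm divide_inverse)

lemma d_sm_z_power [simp]: "d_t (sm_z ^ n) = 0" "d_zbar (sm_z ^ n) = 0"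
  by (induction n) (simp_all add: d_t_mult d_zbar_mult d_coordinates)

text \<open>
  Subtract from \<open>f\<close> the primitive of \<open>\<Sum> c\<^sub>k \<lambda>\<^sup>k \<omega>\<close> that exists off the
  axis. The result does not depend on \<open>t\<close>. The primitive has the pole
  \<open>-2 c\<^sub>k z\<^sup>-\<^sup>k\<^sup>-\<^sup>1 Q\<^sub>k(x)\<close>, and \<open>Q\<^sub>k\<close> takes different
  values at the two half-axes \<open>x = 1\<close> and \<open>x = -1\<close>; so the coefficient of the highest pole vanishes.
  Multiplying by the power of \<open>z\<close> that clears the denominators turns this into an argument with
  smooth functions.
\<close>

lemma lambda_omega_not_exact:
  assumes "d_t f = (\<Sum>k<n. smooth_scale (c k) (sm_lambda ^ k)) * omega_t" "k < n"
  shows "c k = 0"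
  using assms
proof (induction n)
  case (Suc n)
  have "\<exists>Q. pderiv Q = [:1, 0, - 1:] ^ k \<and> poly Q 1 \<noteq> poly Q (- 1 :: complex)" for k
    using one_minus_sq_antiderivative by metis
  then obtain Q where Q: "\<And>k. pderiv (Q k) = [:1, 0, - 1:] ^ k" "\<And>k. poly (Q k) 1 \<noteq> poly (Q k) (- 1 :: complex)"
    by metis
  \<comment> \<open>\<open>z\<^sup>n\<^sup>+\<^sup>1\<close> times the difference of \<open>f\<close> and the primitive off the axis.\<close>
  define h where "h = sm_z ^ Suc n * f + (\<Sum>k<Suc n. smooth_scale (2 * c k) (sm_z ^ (n - k) * smooth_poly (Q k) sm_x))"
  have summand: "smooth_scale (2 * c k) (sm_z ^ (n - k) * d_t (smooth_poly (Q k) sm_x)) =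
     - (sm_z ^ Suc n * (smooth_scale (c k) (sm_lambda ^ k) * omega_t))" if "k < Suc n" for k
  proof -
    have "sm_z ^ (n - k) * (sm_z ^ (k + 1) * (sm_lambda ^ k * omega_t)) = sm_z ^ (n - k + (k + 1)) * (sm_lambda ^ k * omega_t)"
      by (simp only: power_add mult.assoc)
    also have "n - k + (k + 1) = Suc n" using that by simp
    finally have e: "sm_z ^ (n - k) * (sm_z ^ (k + 1) * (sm_lambda ^ k * omega_t)) = sm_z ^ Suc n * (sm_lambda ^ k * omega_t)" .
    show ?thesis unfolding d_antiderivative_x[OF Q(1)] smooth_scale_simps(3,6,7) e
      by (rule smooth_eqI) simp
  qed
  have "d_t h = sm_z ^ Suc n * d_t f + (\<Sum>k<Suc n. - (sm_z ^ Suc n * (smooth_scale (c k) (sm_lambda ^ k) * omega_t)))"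
    unfolding h_def d_t_add d_t_mult d_sum d_t_scale d_sm_z_power
    by (rule arg_cong2[of _ _ _ _ "(+)"], simp, rule sum.cong) (use summand in auto)
  also have "\<dots> = 0"
    unfolding Suc.prems(1) by (simp only: sum_negf sum_distrib_right sum_distrib_left) simp
  finally have "d_t h = 0" .
  from d_t_0_imp_constant[OF this, of 0 1 "- 1"]
  have h: "at_point h (0, 1) = at_point h (0, - 1)" by (simp add: nonzero_in_punctured)
  have "at_point h (0, t) = 2 * c n * poly (Q n) (of_real (sgn t))" if "t \<noteq> 0" for t
  proof -
    have p: "(0, t) \<in> punctured" using that by (simp add: nonzero_in_punctured)
    have "at_point h (0, t) = (\<Sum>k<Suc n. 2 * c k * (0 ^ (n - k) * poly (Q k) (of_real (sgn t))))"
      using p that by (simp add: h_def at_point_sum sm_x_axis del: sum.lessThan_Suc)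
    also have "\<dots> = (\<Sum>k<n. 2 * c k * (0 ^ (n - k) * poly (Q k) (of_real (sgn t)))) +
        2 * c n * poly (Q n) (of_real (sgn t))" by simp
    also have "(\<Sum>k<n. 2 * c k * (0 ^ (n - k) * poly (Q k) (of_real (sgn t)))) = 0"
      by (rule sum.neutral) (auto simp: power_0_left)
    finally show ?thesis by simp
  qed
  from this[of 1] this[of "- 1"] h have "c n * poly (Q n) 1 = c n * poly (Q n) (- 1)" by auto
  then have cn: "c n = 0" using Q(2)[of n] by simp
  then have "d_t f = (\<Sum>k<n. smooth_scale (c k) (sm_lambda ^ k)) * omega_t"
    using Suc.prems(1) by (simp add: smooth_eqI)
  from Suc.IH[OF this] cn Suc.prems(2) show ?case by (cases "k = n") auto
qed simp

section \<open>Injectivity of the morphism\<close>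

text \<open>
  The quadric is a monic polynomial of degree 2 in \<open>x\<close> over \<open>\<complex>[z,\<lambda>]\<close>.
\<close>

lemma reduce_mod_quadric: "\<exists>A B. quadric dvd P - [:A, B:]"
proof (induction P)
  case 0
  have "quadric dvd 0 - [:0, 0:]" by simp
  then show ?case by blast
next
  case (pCons a P)
  then obtain A B R where R: "P - [:A, B:] = quadric * R" unfolding dvd_def by blast
  let ?c = "[:- 1, [:0, 1:]:] :: complex poly poly"
  have "pCons a P - [:a - B * ?c, A:] = pol_x * (P - [:A, B:]) + (pCons a [:A, B:] - [:a - B * ?c, A:])"
    by (simp add: pol_x_def)
  also have "pCons a [:A, B:] - [:a - B * ?c, A:] = quadric * [:B:]"
    by (simp add: quadric_eq mult.commute)
  finally have "pCons a P - [:a - B * ?c, A:] = quadric * (pol_x * R + [:B:])"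
    unfolding R by (simp add: algebra_simps)
  then show ?case unfolding dvd_def by blast
qed

text \<open>
  For each \<open>z \<noteq> 0\<close> the polynomial in the second variable has infinitely many roots, hence
  each of its coefficients, a polynomial in \<open>z\<close>, vanishes at all \<open>z \<noteq> 0\<close>.
\<close>

lemma poly2_eq_0:
  fixes A :: "complex poly poly"
  assumes "\<And>z. z \<noteq> 0 \<Longrightarrow> infinite {l. poly (poly A [:l:]) z = 0}"
  shows "A = 0"
proof (rule poly_eqI)
  fix i
  have ev: "poly (poly A [:l:]) z = poly (map_poly (\<lambda>c. poly c z) A) l" for l z
    by (induction A) (simp_all add: map_poly_pCons)
  have "map_poly (\<lambda>c. poly c z) A = 0" if "z \<noteq> 0" for z
    using assms[OF that] unfolding ev using poly_roots_finite by blast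
  then have "poly (coeff A i) z = 0" if "z \<noteq> 0" for z
    using that by (metis coeff_0 coeff_map_poly poly_0)
  then have "UNIV - {0} \<subseteq> {z. poly (coeff A i) z = 0}" by auto
  moreover have "infinite (UNIV - {0 :: complex})" by (simp add: infinite_UNIV_char_0)
  ultimately show "coeff A i = coeff 0 i"
    using poly_roots_finite finite_subset by (metis coeff_0)
qed

text \<open>
  For \<open>A + B x\<close> the substitution \<open>t \<mapsto> -t\<close> changes the sign of \<open>x\<close> only, so \<open>A\<close> and \<open>B\<close> vanish
  separately as functions. For fixed \<open>z \<noteq> 0\<close> the values \<open>zbar/(|z|\<^sup>2 + t\<^sup>2)\<close> of
  \<open>\<lambda>\<close> are infinite in number, so they vanish as polynomials.
\<close>

lemma qfun_eq_0_iff: "qfun q = 0 \<longleftrightarrow> q = 0"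
proof
  assume q0: "qfun q = 0"
  obtain P where P: "q = abs_qring P" by (metis Quotient_qring Quotient_abs_rep)
  obtain A B where AB: "quadric dvd P - [:A, B:]" using reduce_mod_quadric by blast
  then have q: "q = abs_qring [:A, B:]" unfolding P by (simp add: qring.abs_eq_iff quadric_rel_def)
  let ?l = "\<lambda>z t. cnj z / (z * cnj z + (of_real t)\<^sup>2)"
  have l: "at_point sm_lambda (z, t) = ?l z t" if "z \<noteq> 0" for z t
    using nonzero_in_punctured(1)[OF that, of t]
    by (simp add: sm_lambda_def power_inverse radius_sq divide_inverse)
  have ev: "poly (poly A [:?l z t:]) z + at_point sm_x (z, t) * poly (poly B [:?l z t:]) z = 0" if "z \<noteq> 0" for z t
  proof -
    have "at_point (qfun q) (z, t) = 0" using q0 by simp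
    then show ?thesis
      unfolding q at_point_qfun_abs[OF nonzero_in_punctured(1)[OF that]] pol_fun_def pol_eval_def
      by (simp add: l[OF that] algebra_simps)
  qed
  have x: "at_point sm_x (z, - t) = - at_point sm_x (z, t)" "t \<noteq> 0 \<Longrightarrow> at_point sm_x (z, t) \<noteq> 0" if "z \<noteq> 0" for z t
    using that nonzero_in_punctured(1)[OF that] radius_gt_0[OF nonzero_in_punctured(1)[OF that, of t]]
    by (simp_all add: sm_x_def radius_eq)
  have zero: "poly (poly A [:?l z t:]) z = 0" "poly (poly B [:?l z t:]) z = 0" if "z \<noteq> 0" "t > 0" for z t
  proof -
    have "poly (poly A [:?l z t:]) z - at_point sm_x (z, t) * poly (poly B [:?l z t:]) z = 0"
      using ev[OF that(1), of "- t"] x(1)[OF that(1), of t] by simp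
    with ev[OF that(1), of t] have "poly (poly A [:?l z t:]) z = 0 \<and> at_point sm_x (z, t) * poly (poly B [:?l z t:]) z = 0"
      by (auto simp: add_eq_0_iff)
    then show "poly (poly A [:?l z t:]) z = 0" "poly (poly B [:?l z t:]) z = 0"
      using x(2)[OF that(1), of t] that by auto
  qed
  have inf: "infinite ((?l z) ` {0<..})" if "z \<noteq> 0" for z
  proof -
    have "inj_on (?l z) {0<..}"
    proof (rule inj_onI)
      fix s t :: real assume st: "s \<in> {0<..}" "t \<in> {0<..}" "?l z s = ?l z t"
      have e: "z * cnj z + (of_real t)\<^sup>2 = of_real ((cmod z)\<^sup>2 + t\<^sup>2)" for t :: real
        by (simp add: complex_norm_square[symmetric] flip: of_real_power)
      have "cnj z \<noteq> 0" using that by simp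
      then have "z * cnj z + (of_real s)\<^sup>2 = z * cnj z + (of_real t)\<^sup>2"
        using st(3) by (simp add: divide_inverse)
      then have "s\<^sup>2 = t\<^sup>2" unfolding e of_real_eq_iff by simp
      then show "s = t" using st by (simp add: power2_eq_iff)
    qed
    moreover have "infinite {0::real<..}" by (simp add: infinite_Ioi)
    ultimately show ?thesis using finite_imageD by blast
  qed
  have "A = 0"
    by (rule poly2_eq_0, rule infinite_super[OF _ inf]) (use zero in auto)
  moreover have "B = 0"
    by (rule poly2_eq_0, rule infinite_super[OF _ inf]) (use zero in auto)
  ultimately show "q = 0" unfolding q by (simp add: zero_qring_def)
qed simp

lemma qfun_minus [simp]: "qfun (- a) = - qfun a" "qfun (a - b) = qfun a - qfun b"
proof -
  show 1: "qfun (- a) = - qfun a" for a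
    using minus_unique[of "qfun a" "qfun (- a)"] by (simp flip: qfun_simps(1))
  show "qfun (a - b) = qfun a - qfun b" using 1[of b] qfun_simps(1)[of a "- b"] by simp
qed

lemma inj_alg_to_form: "inj alg_to_form"
proof (rule injI)
  fix a b assume eq: "alg_to_form a = alg_to_form b"
  have "qfun (alg0 a - alg0 b) = 0" using arg_cong[OF eq, of form_1] by simp
  then have 0: "alg0 a = alg0 b" by (simp only: qfun_eq_0_iff right_minus_eq)
  have *: "qfun (alg1 a - alg1 b) * omega_zbar = 0" "qfun (alg1 a - alg1 b) * omega_t = 0"
    using arg_cong[OF eq, of form_zbar] arg_cong[OF eq, of form_t] by (simp_all add: left_diff_distrib)
  have "qfun (alg1 a - alg1 b) = 0"
  proof (rule smooth_eqI_off_axis)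
    fix z t assume z: "(z::complex) \<noteq> 0"
    have p: "(z, t) \<in> punctured" using z by (rule nonzero_in_punctured)
    have "at_point (qfun (alg1 a - alg1 b)) (z, t) * at_point omega_t (z, t) = 0"
      using arg_cong[OF *(2), of "\<lambda>f. at_point f (z, t)"] by (simp del: qfun_minus)
    moreover have "at_point omega_t (z, t) \<noteq> 0"
      using z p radius_gt_0[OF p] by (simp add: omega_t_def)
    ultimately show "at_point (qfun (alg1 a - alg1 b)) (z, t) = at_point 0 (z, t)" by simp
  qed
  then have "alg1 a = alg1 b" by (simp only: qfun_eq_0_iff right_minus_eq)
  with 0 show "a = b" by (simp add: alg_eq_iff)
qed

section \<open>Algebraic cohomology in degree one\<close>

text \<open>
  These monomials span the whole ring, because products containing both \<open>z\<close> and \<open>\<lambda>\<close> are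
  removed with \<open>z \<lambda> = 1 - x\<^sup>2\<close>.
\<close>

inductive mono_span :: "qring \<Rightarrow> bool" where
  zx: "mono_span (qring_const c * qring_z ^ a * qring_x ^ m)"
| lx: "mono_span (qring_const c * qring_lambda ^ b * qring_x ^ m)"
| add: "mono_span p \<Longrightarrow> mono_span q \<Longrightarrow> mono_span (p + q)"

lemma z_lambda: "qring_z * qring_lambda = 1 - qring_x ^ 2"
  by transfer (simp add: quadric_rel_def quadric_def algebra_simps)

lemma qring_const_0 [simp]: "qring_const 0 = 0"
  using qring_const_add[of 0 0] by simp

lemma qring_const_minus: "qring_const (- c) = - qring_const c"
  using minus_unique[of "qring_const c" "qring_const (- c)"] by (simp flip: qring_const_add)

lemma mono_span_mult_const: "mono_span q \<Longrightarrow> mono_span (qring_const c * q)"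
  by (induction rule: mono_span.induct)
     (auto simp: distrib_left mult.assoc[symmetric] qring_const_mult[symmetric] intro: mono_span.intros)

lemma mono_span_mult_x: "mono_span q \<Longrightarrow> mono_span (qring_x * q)"
proof (induction rule: mono_span.induct)
  case (zx c a m)
  show ?case using mono_span.zx[of c a "Suc m"] by (simp add: mult_ac)
next
  case (lx c b m)
  show ?case using mono_span.lx[of c b "Suc m"] by (simp add: mult_ac)
qed (simp add: distrib_left mono_span.add)

lemma mono_span_mixed: "mono_span (qring_const c * (qring_z * qring_lambda) * q)" if "mono_span q"
proof -
  have "qring_const c * (qring_z * qring_lambda) * q = qring_const c * q + qring_const (- c) * (qring_x * (qring_x * q))"
    unfolding z_lambda by (simp add: power2_eq_square qring_const_minus algebra_simps)
  then show ?thesis using that by (simp add: mono_span.add mono_span_mult_const mono_span_mult_x)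
qed

lemma mono_span_mult_z: "mono_span q \<Longrightarrow> mono_span (qring_z * q)"
proof (induction rule: mono_span.induct)
  case (zx c a m)
  show ?case using mono_span.zx[of c "Suc a" m] by (simp add: mult_ac)
next
  case (lx c b m)
  show ?case
  proof (cases b)
    case 0
    then show ?thesis using mono_span.zx[of c 1 m] by (simp add: mult_ac)
  next
    case (Suc b')
    then show ?thesis using mono_span_mixed[OF mono_span.lx[of 1 b' m], of c] by (simp add: mult_ac)
  qed
qed (simp add: distrib_left mono_span.add)

lemma mono_span_mult_lambda: "mono_span q \<Longrightarrow> mono_span (qring_lambda * q)"
proof (induction rule: mono_span.induct)
  case (lx c b m)
  show ?case using mono_span.lx[of c "Suc b" m] by (simp add: mult_ac)
next
  case (zx c a m)
  show ?case
  proof (cases a)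
    case 0
    then show ?thesis using mono_span.lx[of c 1 m] by (simp add: mult_ac)
  next
    case (Suc a')
    then show ?thesis using mono_span_mixed[OF mono_span.zx[of 1 a' m], of c] by (simp add: mult_ac)
  qed
qed (simp add: distrib_left mono_span.add)

lemma monomials_span_qring: "mono_span q"
proof -
  have "\<forall>p. mono_span p \<longrightarrow> mono_span (q * p)"
    by (induction q rule: qring_induct)
       (simp_all add: mono_span_mult_const mono_span_mult_x mono_span_mult_z mono_span_mult_lambda
         distrib_right mono_span.add mult.assoc)
  then show ?thesis using mono_span.zx[of 1 0 0] by fastforce
qed

lemma qring_deriv_power: "qring_deriv (a ^ Suc n) = qring_const (of_nat (Suc n)) * (a ^ n * qring_deriv a)"
proof (induction n)
  case (Suc n)
  have "qring_deriv (a ^ Suc (Suc n)) = qring_deriv a * a ^ Suc n + a * qring_deriv (a ^ Suc n)"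
    by (simp add: qring_deriv_mult)
  moreover have "qring_const (of_nat (Suc (Suc n))) = 1 + qring_const (of_nat (Suc n))"
    by (subst of_nat_Suc) (simp only: qring_const_add qring_const_1)
  ultimately show ?case unfolding Suc by (simp add: algebra_simps del: of_nat_Suc)
qed simp

definition reducible :: "qring \<Rightarrow> bool" where
  "reducible q \<longleftrightarrow> (\<exists>s c n. q = qring_deriv s + (\<Sum>k<n. qring_const (c k) * qring_lambda ^ k))"

lemma reducible_add:
  assumes "reducible p" "reducible q" shows "reducible (p + q)"
proof -
  obtain s c m where p: "p = qring_deriv s + (\<Sum>k<m. qring_const (c k) * qring_lambda ^ k)"
    using assms by (auto simp: reducible_def)
  obtain t d n where q: "q = qring_deriv t + (\<Sum>k<n. qring_const (d k) * qring_lambda ^ k)"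
    using assms by (auto simp: reducible_def)
  have ext: "(\<Sum>k<m. qring_const (c k) * qring_lambda ^ k) =
      (\<Sum>k<N. qring_const (if k < m then c k else 0) * qring_lambda ^ k)" if "m \<le> N" for m N and c :: "nat \<Rightarrow> complex"
    by (rule sum.mono_neutral_cong_left) (use that in auto)
  define N where "N = max m n"
  let ?e = "\<lambda>k. (if k < m then c k else 0) + (if k < n then d k else 0)"
  have "p + q = qring_deriv (s + t) + ((\<Sum>k<N. qring_const (if k < m then c k else 0) * qring_lambda ^ k) +
      (\<Sum>k<N. qring_const (if k < n then d k else 0) * qring_lambda ^ k))"
    unfolding p q qring_deriv_add using ext[of m N c] ext[of n N d] by (simp add: N_def)
  also have "\<dots> = qring_deriv (s + t) + (\<Sum>k<N. qring_const (?e k) * qring_lambda ^ k)"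
    by (simp only: qring_const_add distrib_right sum.distrib)
  finally show ?thesis unfolding reducible_def by (intro exI[of _ "s + t"] exI[of _ ?e] exI[of _ N])
qed

lemma reducible_const:
  assumes "reducible q" shows "reducible (qring_const a * q)"
proof -
  obtain s c n where q: "q = qring_deriv s + (\<Sum>k<n. qring_const (c k) * qring_lambda ^ k)"
    using assms by (auto simp: reducible_def)
  have "qring_const a * q = qring_deriv (qring_const a * s) + (\<Sum>k<n. qring_const (a * c k) * qring_lambda ^ k)"
    unfolding q by (simp add: qring_deriv_mult qring_deriv_const qring_const_mult distrib_left sum_distrib_left mult.assoc)
  then show ?thesis unfolding reducible_def
    by (intro exI[of _ "qring_const a * s"] exI[of _ "\<lambda>k. a * c k"] exI[of _ n])
qed

lemma reducible_const_cancel: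
  assumes "reducible (qring_const a * q)" "a \<noteq> 0" shows "reducible q"
  using reducible_const[OF assms(1), of "inverse a"] assms(2)
  by (simp add: mult.assoc[symmetric] qring_const_mult[symmetric])

lemma reducible_deriv: "reducible (qring_deriv s)"
  unfolding reducible_def by (intro exI[of _ s] exI[of _ "\<lambda>_. 0"] exI[of _ 0]) simp

lemma reducible_lambda_power: "reducible (qring_lambda ^ b)"
  unfolding reducible_def
  by (intro exI[of _ 0] exI[of _ "\<lambda>k. if k = b then 1 else 0"] exI[of _ "Suc b"]) (simp add: sum.neutral)

text \<open>
  The derivative of \<open>z\<^sup>a x\<^sup>m\<^sup>+\<^sup>1\<close> is a nonzero multiple of
  \<open>z\<^sup>a\<^sup>+\<^sup>1 x\<^sup>m\<close>.
\<close>

lemma reducible_z_x: "reducible (qring_z ^ Suc a * qring_x ^ m)"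
proof (rule reducible_const_cancel)
  have "qring_deriv (qring_z ^ a * qring_x ^ Suc m) = qring_deriv (qring_z ^ a) * qring_x ^ Suc m +
     qring_z ^ a * (qring_const (of_nat (Suc m)) * (qring_x ^ m * (qring_const (- 1/2) * qring_z)))"
    unfolding qring_deriv_mult qring_deriv_power qring_deriv_generators ..
  also have "qring_deriv (qring_z ^ a) = 0"
    by (induction a) (simp_all add: qring_deriv_mult qring_deriv_generators qring_deriv_const flip: qring_const_1)
  also have "0 * qring_x ^ Suc m + qring_z ^ a * (qring_const (of_nat (Suc m)) * (qring_x ^ m * (qring_const (- 1/2) * qring_z)))
     = qring_const (of_nat (Suc m) * (- 1/2)) * (qring_z ^ Suc a * qring_x ^ m)"
    unfolding qring_const_mult by (simp add: mult_ac del: of_nat_Suc)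
  finally show "reducible (qring_const (of_nat (Suc m) * (- 1/2)) * (qring_z ^ Suc a * qring_x ^ m))"
    using reducible_deriv by metis
qed (simp del: of_nat_Suc)

text \<open>
  Using \<open>z \<lambda> = 1 - x\<^sup>2\<close>, the derivative of
  \<open>\<lambda>\<^sup>b\<^sup>+\<^sup>1 x\<^sup>n\<^sup>+\<^sup>1\<close> is
  \<open>(b + 1 + (n + 1)/2) \<lambda>\<^sup>b x\<^sup>n\<^sup>+\<^sup>2 - ((n + 1)/2) \<lambda>\<^sup>b x\<^sup>n\<close>,
  which lowers the exponent of \<open>x\<close> by 2; the derivative of \<open>\<lambda>\<^sup>b\<^sup>+\<^sup>1\<close>
  disposes of \<open>\<lambda>\<^sup>b x\<close>.
\<close>

lemma reducible_lambda_x: "reducible (qring_lambda ^ b * qring_x ^ m)"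
proof (induction m rule: less_induct)
  case (less m)
  consider "m = 0" | "m = 1" | n where "m = Suc (Suc n)" by (metis One_nat_def not0_implies_Suc)
  then show ?case
  proof cases
    case 1
    then show ?thesis using reducible_lambda_power by simp
  next
    case 2
    have "reducible (qring_const (of_nat (Suc b)) * (qring_lambda ^ b * qring_x ^ m))"
      using reducible_deriv[of "qring_lambda ^ Suc b"] 2
      unfolding qring_deriv_power qring_deriv_generators by simp
    then show ?thesis by (rule reducible_const_cancel) (simp del: of_nat_Suc)
  next
    case 3
    let ?B = "qring_const (of_nat (Suc b))" and ?N = "qring_const (of_nat (Suc n) * (- 1/2))"
    have "qring_deriv (qring_lambda ^ Suc b * qring_x ^ Suc n) =
        ?B * (qring_lambda ^ b * qring_x ^ m) + ?N * (qring_lambda ^ b * qring_x ^ n * (qring_z * qring_lambda))"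
      unfolding qring_deriv_mult qring_deriv_power qring_deriv_generators qring_const_mult 3
      by (simp add: mult_ac del: of_nat_Suc)
    also have "\<dots> = ?B * (qring_lambda ^ b * qring_x ^ m) + ?N * (qring_lambda ^ b * qring_x ^ n)
         + qring_const (of_nat (Suc n) * (1/2)) * (qring_lambda ^ b * qring_x ^ m)"
    proof -
      have "qring_const (of_nat (Suc n) * (1/2)) = - ?N"
        by (simp add: qring_const_minus del: of_nat_Suc)
      then show ?thesis
        unfolding z_lambda 3 by (simp add: algebra_simps power2_eq_square del: of_nat_Suc)
    qed
    also have "\<dots> = qring_const (of_nat (Suc b) + of_nat (Suc n) * (1/2)) * (qring_lambda ^ b * qring_x ^ m)
          + ?N * (qring_lambda ^ b * qring_x ^ n)"
      unfolding qring_const_add by (simp add: algebra_simps del: of_nat_Suc)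
    finally have "qring_const (of_nat (Suc b) + of_nat (Suc n) * (1/2)) * (qring_lambda ^ b * qring_x ^ m) =
       qring_deriv (qring_lambda ^ Suc b * qring_x ^ Suc n) + qring_const (- 1) * (?N * (qring_lambda ^ b * qring_x ^ n))"
      by (simp only: qring_const_minus[of 1] qring_const_1) simp
    also have "reducible \<dots>"
      using less[of n] 3 by (intro reducible_add reducible_deriv reducible_const) auto
    finally have "reducible (qring_const (of_nat (Suc b) + of_nat (Suc n) * (1/2)) * (qring_lambda ^ b * qring_x ^ m))" .
    then show ?thesis
    proof (rule reducible_const_cancel)
      have "of_nat (Suc b) + of_nat (Suc n) * (1/2) = complex_of_real (real (Suc b) + real (Suc n) * (1/2))"
        by simp
      also have "\<dots> \<noteq> 0" by (subst of_real_eq_0_iff) (simp add: add_eq_0_iff)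
      finally show "of_nat (Suc b) + of_nat (Suc n) * (1/2) \<noteq> (0::complex)" .
    qed
  qed
qed

text \<open>
  The classes of \<open>\<lambda>\<^sup>k \<omega>\<close> span the algebraic cohomology in degree 1.
\<close>

lemma qring_eq_deriv_plus_lambda_polynomial: "reducible q"
  using monomials_span_qring[of q]
proof (induction rule: mono_span.induct)
  case (zx c a m)
  then show ?case
    using reducible_const[OF reducible_z_x, of c _ m] reducible_const[OF reducible_lambda_x[of 0], of c m]
    by (cases a) (simp_all add: mult.assoc)
next
  case (lx c b m)
  then show ?case using reducible_const[OF reducible_lambda_x, of c b m] by (simp add: mult.assoc)
qed (rule reducible_add)

section \<open>Convergence in the Frechet topology\<close>

lemma fold_dir_deriv_add: "fold dir_deriv vs (f + g) = fold dir_deriv vs f + fold dir_deriv vs g"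
  by (induction vs arbitrary: f g) (simp_all add: dir_deriv_add)

text \<open>
  Convergence in the Frechet topology is this for all compact \<open>K\<close>; for density arguments the
  sequence may depend on \<open>K\<close>.
\<close>

definition conv_on :: "(complex \<times> real) set \<Rightarrow> (nat \<Rightarrow> smooth) \<Rightarrow> smooth \<Rightarrow> bool" where
  "conv_on K s f \<longleftrightarrow> (\<forall>vs. set vs \<subseteq> Basis \<longrightarrow>
     uniform_limit K (\<lambda>n. at_point (fold dir_deriv vs (s n - f))) (\<lambda>_. 0) sequentially)"

lemma conv_on_subset: "conv_on K s f \<Longrightarrow> L \<subseteq> K \<Longrightarrow> conv_on L s f"
  by (auto simp: conv_on_def intro: uniform_limit_on_subset)

lemma conv_on_Un: "conv_on K s f \<Longrightarrow> conv_on L s f \<Longrightarrow> conv_on (K \<union> L) s f"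
  by (auto simp: conv_on_def intro: uniform_limit_on_Un)

text \<open>
  An element of a subbasic open set satisfies the strict inequality that defines it with a
  positive margin, since a continuous function attains its supremum on \<open>K\<close>. A finite intersection
  involves only finitely many compact sets, whose union is used.
\<close>

lemma smooth_topology_neighbourhood:
  assumes "openin smooth_topology V" "f \<in> V"
  obtains K where "compact K" "K \<subseteq> punctured" "\<And>s. conv_on K s f \<Longrightarrow> \<forall>\<^sub>F n in sequentially. s n \<in> V"
proof -
  have "\<exists>K. compact K \<and> K \<subseteq> punctured \<and> (\<forall>s. conv_on K s f \<longrightarrow> (\<forall>\<^sub>F n in sequentially. s n \<in> V))"
    using assms unfolding smooth_topology_def openin_topology_generated_by_iff
  proof (induction rule: generate_topology_on.induct)
    case (Int a b)
    then obtain K L where "compact K" "K \<subseteq> punctured" "\<forall>s. conv_on K s f \<longrightarrow> (\<forall>\<^sub>F n in sequentially. s n \<in> a)"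
      "compact L" "L \<subseteq> punctured" "\<forall>s. conv_on L s f \<longrightarrow> (\<forall>\<^sub>F n in sequentially. s n \<in> b)" by auto
    moreover have "conv_on K s f" "conv_on L s f" if "conv_on (K \<union> L) s f" for s
      using conv_on_subset[OF that] by auto
    ultimately show ?case
      by (intro exI[of _ "K \<union> L"]) (simp add: eventually_conj compact_Un)
  next
    case (UN K)
    then obtain k where k: "k \<in> K" "f \<in> k" by auto
    with UN.IH[OF this] obtain L where L: "compact L" "L \<subseteq> punctured"
      "\<forall>s. conv_on L s f \<longrightarrow> (\<forall>\<^sub>F n in sequentially. s n \<in> k)" by auto
    then show ?case
      using k by (intro exI[of _ L]) (auto elim!: eventually_mono)
  next
    case (Basis b)
    then obtain f0 vs K \<epsilon> where b: "b = {g. \<forall>p\<in>K. cmod (at_point (fold dir_deriv vs (g - f0)) p) < \<epsilon>}"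
      and K: "set vs \<subseteq> Basis" "compact K" "K \<subseteq> punctured" "0 < \<epsilon>" by blast
    let ?h = "\<lambda>p. cmod (at_point (fold dir_deriv vs (f - f0)) p)"
    have lt: "?h p < \<epsilon>" if "p \<in> K" for p using Basis.prems that b by simp
    have cont: "continuous_on K ?h"
      using continuous_on_subset[OF smooth_on_continuous[OF smooth_at_point] K(3)] by (intro continuous_on_norm)
    have "\<exists>\<delta>>0. \<forall>p\<in>K. ?h p \<le> \<epsilon> - \<delta>"
    proof (cases "K = {}")
      case False
      then obtain p0 where "p0 \<in> K" "\<forall>p\<in>K. ?h p \<le> ?h p0"
        using continuous_attains_sup[OF K(2) _ cont] by blast
      then show ?thesis using lt[of p0] by (intro exI[of _ "\<epsilon> - ?h p0"]) auto
    qed (auto intro: exI[of _ 1])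
    then obtain \<delta> where \<delta>: "\<delta> > 0" "\<And>p. p \<in> K \<Longrightarrow> ?h p \<le> \<epsilon> - \<delta>" by auto
    have "\<forall>\<^sub>F n in sequentially. s n \<in> b" if s: "conv_on K s f" for s
    proof -
      have "\<forall>\<^sub>F n in sequentially. \<forall>p\<in>K. dist (at_point (fold dir_deriv vs (s n - f)) p) 0 < \<delta>"
        by (rule uniform_limitD) (use s K(1) \<delta>(1) in \<open>simp_all add: conv_on_def\<close>)
      then show ?thesis
      proof eventually_elim
        case (elim n)
        have "cmod (at_point (fold dir_deriv vs (s n - f0)) p) < \<epsilon>" if "p \<in> K" for p
        proof -
          have "s n - f0 = (s n - f) + (f - f0)" by simp
          then have "fold dir_deriv vs (s n - f0) = fold dir_deriv vs (s n - f) + fold dir_deriv vs (f - f0)"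
            by (metis fold_dir_deriv_add)
          then have "cmod (at_point (fold dir_deriv vs (s n - f0)) p) \<le>
              cmod (at_point (fold dir_deriv vs (s n - f)) p) + ?h p"
            by (simp add: norm_triangle_ineq)
          also have "\<dots> < \<delta> + (\<epsilon> - \<delta>)" using elim that \<delta>(2)[OF that] by (intro add_less_le_mono) auto
          finally show ?thesis by simp
        qed
        then show ?case by (simp add: b)
      qed
    qed
    with K show ?case by blast
  qed auto
  then show thesis using that by blast
qed

lemma topspace_smooth_topology: "topspace smooth_topology = UNIV"
proof -
  have "openin smooth_topology UNIV"
    unfolding smooth_topology_def openin_topology_generated_by_iff
    by (rule generate_topology_on.Basis) (auto intro!: exI[of _ 0] exI[of _ "[]"] exI[of _ "{}"] exI[of _ 1])
  then show ?thesis using openin_subset by blast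
qed

definition form_conv_on :: "(complex \<times> real) set \<Rightarrow> (nat \<Rightarrow> form) \<Rightarrow> form \<Rightarrow> bool" where
  "form_conv_on K s a \<longleftrightarrow> conv_on K (\<lambda>n. form_1 (s n)) (form_1 a) \<and> conv_on K (\<lambda>n. form_zbar (s n)) (form_zbar a) \<and>
     conv_on K (\<lambda>n. form_t (s n)) (form_t a) \<and> conv_on K (\<lambda>n. form_zbar_t (s n)) (form_zbar_t a)"

lemma topspace_form_topology: "topspace form_topology = UNIV"
  by (simp add: form_topology_def topspace_pullback_topology topspace_smooth_topology)

lemma openin_prod_topology_box:
  assumes "openin (prod_topology X Y) S" "(x, y) \<in> S"
  obtains U V where "openin X U" "x \<in> U" "y \<in> V" "openin Y V" "U \<times> V \<subseteq> S"
  using assms unfolding openin_prod_topology_alt by blast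

lemma form_topology_neighbourhood:
  assumes "openin form_topology V" "a \<in> V"
  obtains K where "compact K" "K \<subseteq> punctured" "\<And>s. form_conv_on K s a \<Longrightarrow> \<forall>\<^sub>F n in sequentially. s n \<in> V"
proof -
  let ?c = "\<lambda>a. (form_1 a, form_zbar a, form_t a, form_zbar_t a)"
  obtain W where W: "openin (prod_topology smooth_topology (prod_topology smooth_topology
       (prod_topology smooth_topology smooth_topology))) W" "V = ?c -` W"
    using assms(1) unfolding form_topology_def openin_pullback_topology by auto
  from assms(2) W(2) have "?c a \<in> W" by simp
  then obtain U1 W1 where 1: "openin smooth_topology U1" "form_1 a \<in> U1" "(form_zbar a, form_t a, form_zbar_t a) \<in> W1"
    "openin (prod_topology smooth_topology (prod_topology smooth_topology smooth_topology)) W1" "U1 \<times> W1 \<subseteq> W"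
    by (rule openin_prod_topology_box[OF W(1)])
  obtain U2 W2 where 2: "openin smooth_topology U2" "form_zbar a \<in> U2" "(form_t a, form_zbar_t a) \<in> W2"
    "openin (prod_topology smooth_topology smooth_topology) W2" "U2 \<times> W2 \<subseteq> W1"
    by (rule openin_prod_topology_box[OF 1(4,3)])
  obtain U3 U4 where 3: "openin smooth_topology U3" "form_t a \<in> U3" "form_zbar_t a \<in> U4"
    "openin smooth_topology U4" "U3 \<times> U4 \<subseteq> W2"
    by (rule openin_prod_topology_box[OF 2(4,3)])
  obtain K1 where K1: "compact K1" "K1 \<subseteq> punctured" "\<And>s. conv_on K1 s (form_1 a) \<Longrightarrow> \<forall>\<^sub>F n in sequentially. s n \<in> U1"
    using smooth_topology_neighbourhood[OF 1(1,2)] by blast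
  obtain K2 where K2: "compact K2" "K2 \<subseteq> punctured" "\<And>s. conv_on K2 s (form_zbar a) \<Longrightarrow> \<forall>\<^sub>F n in sequentially. s n \<in> U2"
    using smooth_topology_neighbourhood[OF 2(1,2)] by blast
  obtain K3 where K3: "compact K3" "K3 \<subseteq> punctured" "\<And>s. conv_on K3 s (form_t a) \<Longrightarrow> \<forall>\<^sub>F n in sequentially. s n \<in> U3"
    using smooth_topology_neighbourhood[OF 3(1,2)] by blast
  obtain K4 where K4: "compact K4" "K4 \<subseteq> punctured" "\<And>s. conv_on K4 s (form_zbar_t a) \<Longrightarrow> \<forall>\<^sub>F n in sequentially. s n \<in> U4"
    using smooth_topology_neighbourhood[OF 3(4,3)] by blast
  let ?K = "K1 \<union> K2 \<union> K3 \<union> K4"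
  show thesis
  proof (rule that[of ?K])
    fix s assume "form_conv_on ?K s a"
    then have "conv_on K1 (\<lambda>n. form_1 (s n)) (form_1 a)" "conv_on K2 (\<lambda>n. form_zbar (s n)) (form_zbar a)"
     "conv_on K3 (\<lambda>n. form_t (s n)) (form_t a)" "conv_on K4 (\<lambda>n. form_zbar_t (s n)) (form_zbar_t a)"
      unfolding form_conv_on_def by (auto elim!: conv_on_subset)
    from K1(3)[OF this(1)] K2(3)[OF this(2)] K3(3)[OF this(3)] K4(3)[OF this(4)]
    show "\<forall>\<^sub>F n in sequentially. s n \<in> V"
    proof eventually_elim
      case (elim n)
      then have "?c (s n) \<in> W" using 1(5) 2(5) 3(5) by blast
      then show ?case using W(2) by simp
    qed
  qed (use K1 K2 K3 K4 in auto)
qed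

section \<open>Maps induced in cohomology\<close>

context cdga_hom
begin

lemma hom_diff_elem: "j (a - b) = j a - j b"
  and hom_0: "j 0 = 0"
proof -
  interpret L: Vector_Spaces.linear "scal A" "scal B" j by (rule hom_linear)
  show "j (a - b) = j a - j b" "j 0 = 0" by (simp_all add: L.diff L.zero)
qed

lemma hom_cocycle: "a \<in> cocycles A n \<Longrightarrow> j a \<in> cocycles B n"
  using hom_comp hom_diff[of a] hom_0 by (auto simp: cocycles_def)

lemma hom_coboundary: "a \<in> coboundaries A n \<Longrightarrow> j a \<in> coboundaries B n"
  using hom_comp hom_diff hom_0 by (cases n) (auto simp: coboundaries_def)

lemma hom_cohomologous: "(a, b) \<in> cohomologous A n \<Longrightarrow> (j a, j b) \<in> cohomologous B n"
  using hom_cocycle hom_coboundary[of "a - b" n] by (auto simp: cohomologous_def hom_diff_elem)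

lemma cohomology_map_class:
  assumes "b \<in> cocycles A n"
  shows "cohomology_map B n j (cohomologous A n `` {b}) = cohomologous B n `` {j b}"
proof -
  have "(\<Union>a\<in>cohomologous A n `` {b}. cohomologous B n `` {j a}) =
      (\<Union>a\<in>cohomologous A n `` {b}. cohomologous B n `` {j b})"
  proof (rule SUP_cong[OF refl])
    fix a assume "a \<in> cohomologous A n `` {b}"
    then have "(b, a) \<in> cohomologous A n" by simp
    from equiv_class_eq[OF target.equiv_cohomologous hom_cohomologous[OF this]]
    show "cohomologous B n `` {j a} = cohomologous B n `` {j b}" by (rule sym)
  qed
  also have "cohomologous A n `` {b} \<noteq> {}"
    using equiv_class_self[OF source.equiv_cohomologous assms] by blast
  then have "(\<Union>a\<in>cohomologous A n `` {b}. cohomologous B n `` {j b}) = cohomologous B n `` {j b}"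
    by (simp only: UN_constant if_False)
  finally show ?thesis unfolding cohomology_map_def .
qed

lemma inj_on_cohomology_map:
  assumes "\<And>a. a \<in> cocycles A n \<Longrightarrow> j a \<in> coboundaries B n \<Longrightarrow> a \<in> coboundaries A n"
  shows "inj_on (cohomology_map B n j) (cohomology A n)"
proof (rule inj_onI)
  fix X Y assume XY: "X \<in> cohomology A n" "Y \<in> cohomology A n" "cohomology_map B n j X = cohomology_map B n j Y"
  then obtain a b where ab: "a \<in> cocycles A n" "X = cohomologous A n `` {a}" "b \<in> cocycles A n" "Y = cohomologous A n `` {b}"
    by (auto simp: cohomology_def elim!: quotientE)
  interpret V: vector_space "scal A" by (rule source.scalars)
  interpret D: Vector_Spaces.linear "scal A" "scal A" "differential A" by (rule source.diff_linear)
  have "cohomologous B n `` {j a} = cohomologous B n `` {j b}"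
    using XY(3) ab cohomology_map_class by simp
  then have "(j a, j b) \<in> cohomologous B n"
    using eq_equiv_class[OF _ target.equiv_cohomologous] hom_cocycle[OF ab(3)] by blast
  then have "j (a - b) \<in> coboundaries B n" by (simp add: cohomologous_def hom_diff_elem)
  moreover have "a - b \<in> cocycles A n"
    using ab V.subspace_diff[OF source.comp_subspace] by (auto simp: cocycles_def D.diff)
  ultimately have "a - b \<in> coboundaries A n" by (rule assms[rotated])
  then have "(a, b) \<in> cohomologous A n" using ab by (simp add: cohomologous_def)
  then show "X = Y" using equiv_class_eq[OF source.equiv_cohomologous] ab by simp
qed

text \<open>
  A set of classes is open when the union of these classes is open among cocycles. Hence if sums
  of images of cocycles and coboundaries are dense among the cocycles, an open set of classes
  contains the class of the image of some cocycle.
\<close>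

lemma dense_cohomology_map:
  assumes top: "topspace T = UNIV"
    and dense: "\<And>a V. a \<in> cocycles B n \<Longrightarrow> openin T V \<Longrightarrow> a \<in> V \<Longrightarrow>
      \<exists>b\<in>cocycles A n. \<exists>c\<in>coboundaries B n. j b + c \<in> V"
  shows "cohomology_topology B T n closure_of (cohomology_map B n j ` cohomology A n) = cohomology B n"
proof -
  have union: "\<Union>(cohomology B n) = cocycles B n"
    unfolding cohomology_def using Union_quotient[OF target.equiv_cohomologous] .
  have "openin (cohomology_topology B T n) (cohomology B n)"
    unfolding target.openin_cohomology_topology union
    using openin_subtopology_refl[of T] top by auto
  then have ts: "topspace (cohomology_topology B T n) = cohomology B n"
    using openin_subset target.openin_cohomology_topology openin_topspace by (metis subset_antisym)
  have "X \<in> cohomology_topology B T n closure_of (cohomology_map B n j ` cohomology A n)"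
    if X: "X \<in> cohomology B n" for X
    unfolding in_closure_of ts
  proof (intro conjI allI impI X)
    fix U assume U: "X \<in> U \<and> openin (cohomology_topology B T n) U"
    then have U': "U \<subseteq> cohomology B n" "openin (subtopology T (cocycles B n)) (\<Union>U)"
      by (auto simp: target.openin_cohomology_topology)
    obtain a where a: "a \<in> cocycles B n" "X = cohomologous B n `` {a}"
      using X by (auto simp: cohomology_def elim!: quotientE)
    have "a \<in> X" using equiv_class_self[OF target.equiv_cohomologous a(1)] a(2) by simp
    obtain V where V: "openin T V" "\<Union>U = V \<inter> cocycles B n"
      using U'(2) by (auto simp: openin_subtopology)
    have "a \<in> V" using V U \<open>a \<in> X\<close> by blast
    from dense[OF a(1) V(1) this] obtain b c where bc: "b \<in> cocycles A n" "c \<in> coboundaries B n" "j b + c \<in> V" by blast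
    interpret W: vector_space "scal B" by (rule target.scalars)
    interpret D: Vector_Spaces.linear "scal B" "scal B" "differential B" by (rule target.diff_linear)
    have "c \<in> cocycles B n"
    proof (cases n)
      case 0
      then show ?thesis using bc(2) W.subspace_0[OF target.comp_subspace] by (simp add: coboundaries_def cocycles_def D.zero)
    next
      case (Suc m)
      then show ?thesis using bc(2) target.diff_comp target.diff_diff by (auto simp: coboundaries_def cocycles_def)
    qed
    then have jbc: "j b + c \<in> cocycles B n"
      using hom_cocycle[OF bc(1)] W.subspace_add[OF target.comp_subspace] by (auto simp: cocycles_def D.add)
    then have "j b + c \<in> \<Union>U" using V bc(3) by blast
    then obtain Y where Y: "Y \<in> U" "j b + c \<in> Y" by blast
    have "(j b + c, j b) \<in> cohomologous B n"
      using jbc hom_cocycle[OF bc(1)] bc(2) by (simp add: cohomologous_def)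
    moreover obtain y where "Y = cohomologous B n `` {y}"
      using Y U' by (auto simp: cohomology_def elim!: quotientE)
    ultimately have "Y = cohomologous B n `` {j b}"
      using Y(2) equiv_class_eq[OF target.equiv_cohomologous] by (metis Image_singleton_iff)
    also have "\<dots> = cohomology_map B n j (cohomologous A n `` {b})"
      using cohomology_map_class[OF bc(1)] by simp
    finally have "Y \<in> cohomology_map B n j ` cohomology A n"
      using bc(1) by (auto simp: cohomology_def intro: quotientI)
    with Y show "\<exists>y. y \<in> cohomology_map B n j ` cohomology A n \<and> y \<in> U" by blast
  qed
  moreover have "cohomology_topology B T n closure_of (cohomology_map B n j ` cohomology A n) \<subseteq> cohomology B n"
    using closure_of_subset_topspace[of "cohomology_topology B T n"] ts by simp
  ultimately show ?thesis by blast
qed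

end

section \<open>Limits of smooth functions with holomorphic coefficients\<close>

text \<open>
  Finite sums of products \<open>\<psi>\<^sub>n(z) \<eta>(z,t)\<close> of a sequence of holomorphic functions and
  a fixed smooth function. By the product rule partial derivatives of such a sum are again of this
  form, which is recorded by \<open>deriv_terms\<close>.
\<close>

definition sum_terms :: "((nat \<Rightarrow> complex \<Rightarrow> complex) \<times> smooth) list \<Rightarrow> nat \<Rightarrow> complex \<times> real \<Rightarrow> complex" where
  "sum_terms L n p = (\<Sum>(\<psi>, \<eta>)\<leftarrow>L. \<psi> n (fst p) * at_point \<eta> p)"

definition deriv_terms :: "complex \<times> real \<Rightarrow> ((nat \<Rightarrow> complex \<Rightarrow> complex) \<times> smooth) list \<Rightarrow>
    ((nat \<Rightarrow> complex \<Rightarrow> complex) \<times> smooth) list" where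
  "deriv_terms v L = concat (map (\<lambda>(\<psi>, \<eta>). [(\<lambda>n. deriv (\<psi> n), smooth_scale (fst v) \<eta>), (\<psi>, dir_deriv v \<eta>)]) L)"

lemma sum_terms_has_derivative:
  assumes "open W" "p \<in> punctured" "fst p \<in> W" "\<And>\<psi> \<eta>. (\<psi>, \<eta>) \<in> set L \<Longrightarrow> locally_null W \<psi>"
  shows "(sum_terms L n has_derivative (\<lambda>v. sum_terms (deriv_terms v L) n p)) (at p)"
  using assms(4)
proof (induction L)
  case Nil
  then show ?case by (simp add: sum_terms_def[abs_def] deriv_terms_def)
next
  case (Cons x L)
  obtain \<psi> \<eta> where x: "x = (\<psi>, \<eta>)" by (cases x)
  have "\<psi> n holomorphic_on W" using Cons.prems[of \<psi> \<eta>] x by (simp add: locally_null_def)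
  then have "(\<psi> n has_derivative (*) (deriv (\<psi> n) (fst p))) (at (fst p))"
    using holomorphic_derivI[OF _ assms(1,3)] by (simp add: has_field_derivative_def)
  from has_derivative_compose[OF has_derivative_fst[OF has_derivative_ident] this]
  have d: "((\<lambda>p. \<psi> n (fst p)) has_derivative (\<lambda>v. deriv (\<psi> n) (fst p) * fst v)) (at p)" by simp
  have "((\<lambda>p. \<psi> n (fst p) * at_point \<eta> p + sum_terms L n p) has_derivative
    (\<lambda>v. (\<psi> n (fst p) * frechet_derivative (at_point \<eta>) (at p) v + deriv (\<psi> n) (fst p) * fst v * at_point \<eta> p)
      + sum_terms (deriv_terms v L) n p)) (at p)"
    using Cons by (intro has_derivative_add has_derivative_mult d at_point_has_derivative assms(2)) auto
  then show ?case
    using assms(2) by (simp add: x sum_terms_def[abs_def] deriv_terms_def algebra_simps)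
qed

lemma deriv_terms_locally_null:
  assumes "open W" "\<And>\<psi> \<eta>. (\<psi>, \<eta>) \<in> set L \<Longrightarrow> locally_null W \<psi>" "(\<psi>, \<eta>) \<in> set (deriv_terms v L)"
  shows "locally_null W \<psi>"
  using assms(2,3) locally_null_deriv[OF assms(1)] by (auto simp: deriv_terms_def)

lemma sum_terms_uniform_limit:
  assumes "compact K" "K \<subseteq> punctured" "fst ` K \<subseteq> W" "\<And>\<psi> \<eta>. (\<psi>, \<eta>) \<in> set L \<Longrightarrow> locally_null W \<psi>"
  shows "uniform_limit K (sum_terms L) (\<lambda>_. 0) sequentially"
  using assms(4)
proof (induction L)
  case Nil
  have "uniform_limit K (\<lambda>(n::nat) p. 0) (\<lambda>_. 0 :: complex) sequentially" by (rule uniform_limit_const)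
  then show ?case by (simp add: sum_terms_def[abs_def])
next
  case (Cons x L)
  obtain \<psi> \<eta> where x: "x = (\<psi>, \<eta>)" by (cases x)
  have cK: "compact (fst ` K)" using assms(1) by (intro compact_continuous_image continuous_intros)
  have ul: "uniform_limit (fst ` K) \<psi> (\<lambda>_. 0) sequentially"
    using Cons.prems[of \<psi> \<eta>] x cK assms(3) by (simp add: locally_null_def)
  have 1: "uniform_limit K (\<lambda>n p. \<psi> n (fst p)) (\<lambda>_. 0) sequentially"
  proof (rule uniform_limitI)
    fix e :: real assume "e > 0"
    from uniform_limitD[OF ul this]
    show "\<forall>\<^sub>F n in sequentially. \<forall>p\<in>K. dist (\<psi> n (fst p)) 0 < e"
      by eventually_elim auto
  qed
  have "bounded (at_point \<eta> ` K)"
    using assms(1,2) smooth_on_continuous[OF smooth_at_point]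
    by (intro compact_imp_bounded compact_continuous_image) (auto intro: continuous_on_subset)
  moreover have "bounded ((\<lambda>_. 0 :: complex) ` K)" by (intro boundedI[of _ 0]) auto
  ultimately have "uniform_limit K (\<lambda>n p. \<psi> n (fst p) * at_point \<eta> p) (\<lambda>p. 0 * at_point \<eta> p) sequentially"
    using uniform_lim_mult[OF 1 uniform_limit_const, of "at_point \<eta>"] by blast
  moreover have "uniform_limit K (sum_terms L) (\<lambda>_. 0) sequentially"
    by (rule Cons.IH) (use Cons.prems in auto)
  ultimately have "uniform_limit K (\<lambda>n p. \<psi> n (fst p) * at_point \<eta> p + sum_terms L n p)
      (\<lambda>p. 0 * at_point \<eta> p + 0) sequentially" by (rule uniform_limit_add)
  then show ?case using Cons.prems by (simp add: x sum_terms_def[abs_def])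
qed

text \<open>
  The representation is only required on an open set \<open>O'\<close> around \<open>K\<close>, because the holomorphic factors
  need not extend to all values of \<open>z\<close>.
\<close>

lemma uniform_limit_fold_dir_deriv:
  assumes "open O'" "O' \<subseteq> punctured" "open W" "fst ` O' \<subseteq> W" "compact K" "K \<subseteq> O'"
    and "\<And>\<psi> \<eta>. (\<psi>, \<eta>) \<in> set L \<Longrightarrow> locally_null W \<psi>"
    and "\<And>n p. p \<in> O' \<Longrightarrow> at_point (s n) p = sum_terms L n p"
  shows "uniform_limit K (\<lambda>n. at_point (fold dir_deriv vs (s n))) (\<lambda>_. 0) sequentially"
  using assms(7,8)
proof (induction vs arbitrary: L s)
  case Nil
  have "uniform_limit K (sum_terms L) (\<lambda>_. 0) sequentially"
    using assms Nil.prems(1) by (intro sum_terms_uniform_limit[of _ W]) auto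
  then show ?case
    by (rule uniform_limit_cong'[THEN iffD1, rotated -1]) (use assms Nil.prems(2) in auto)
next
  case (Cons v vs)
  have "uniform_limit K (\<lambda>n. at_point (fold dir_deriv vs (dir_deriv v (s n)))) (\<lambda>_. 0) sequentially"
  proof (rule Cons.IH)
    show "locally_null W \<psi>" if "(\<psi>, \<eta>) \<in> set (deriv_terms v L)" for \<psi> \<eta>
      by (rule deriv_terms_locally_null[OF assms(3) Cons.prems(1) that])
    fix n p assume p: "p \<in> O'"
    then have p': "p \<in> punctured" "fst p \<in> W" using assms by auto
    have "frechet_derivative (at_point (s n)) (at p) = (\<lambda>v. sum_terms (deriv_terms v L) n p)"
      by (rule frechet_derivative_eq_on_open[OF assms(1) p
            sum_terms_has_derivative[OF assms(3) p' Cons.prems(1)]]) (use Cons.prems(2) in auto)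
    then show "at_point (dir_deriv v (s n)) p = sum_terms (deriv_terms v L) n p" using p' by simp
  qed
  then show ?case by simp
qed

lemma conv_on_holomorphic_factor:
  assumes "open O'" "O' \<subseteq> punctured" "open W" "fst ` O' \<subseteq> W" "compact K" "K \<subseteq> O'" "locally_null W \<psi>"
    and "\<And>n p. p \<in> O' \<Longrightarrow> at_point (s n) p - at_point f p = \<psi> n (fst p) * at_point \<eta> p"
  shows "conv_on K s f"
  unfolding conv_on_def
  by (intro allI impI uniform_limit_fold_dir_deriv[OF assms(1-6), of "[(\<psi>, \<eta>)]"])
     (use assms(7,8) in \<open>auto simp: sum_terms_def\<close>)

lemma conv_on_locally_equal:
  assumes "open O'" "O' \<subseteq> punctured" "compact K" "K \<subseteq> O'"
    and "\<And>n p. p \<in> O' \<Longrightarrow> at_point (s n) p = at_point f p"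
  shows "conv_on K s f"
  unfolding conv_on_def
  by (intro allI impI uniform_limit_fold_dir_deriv[OF assms(1,2) open_UNIV _ assms(3,4), of "[]"])
     (use assms(5) in \<open>auto simp: sum_terms_def\<close>)

section \<open>Primitives off a half-axis\<close>

text \<open>
  The complement of a closed half of the axis: the one with \<open>t \<le> 0\<close> for \<open>\<tau> > 0\<close>, and the one
  with \<open>t \<ge> 0\<close> for \<open>\<tau> < 0\<close>.
\<close>

definition slit :: "real \<Rightarrow> (complex \<times> real) set" where
  "slit \<tau> = {p. fst p \<noteq> 0 \<or> \<tau> * snd p > 0}"

lemma open_slit: "open (slit \<tau>)"
proof -
  have "slit \<tau> = (fst -` (- {0})) \<union> ((\<lambda>p. \<tau> * snd p) -` {0<..})" by (auto simp: slit_def)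
  also have "open \<dots>" by (intro open_Un open_vimage continuous_intros)
  finally show ?thesis .
qed

lemma slit_subset: "slit \<tau> \<subseteq> punctured"
  by (auto simp: slit_def punctured_def zero_prod_def)

text \<open>
  On the axis \<open>t\<close> has the sign of \<open>\<tau>\<close>, hence so have their convex combinations.
\<close>

lemma slit_segment:
  assumes "\<tau> \<noteq> 0" "(z, t) \<in> slit \<tau>" "0 \<le> s" "s \<le> 1"
  shows "(z, \<tau> + s * (t - \<tau>)) \<in> punctured"
proof (cases "z = 0")
  case True
  then have t: "\<tau> * t > 0" using assms by (simp add: slit_def)
  have "\<tau> * (\<tau> + s * (t - \<tau>)) = (1 - s) * \<tau>\<^sup>2 + s * (\<tau> * t)" by (simp add: algebra_simps power2_eq_square)
  moreover have "(1 - s) * \<tau>\<^sup>2 + s * (\<tau> * t) > 0"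
  proof (cases "s = 0")
    case False
    then show ?thesis using t assms by (intro add_nonneg_pos mult_nonneg_nonneg mult_pos_pos[OF _ t]) auto
  qed (use assms in simp)
  ultimately have "\<tau> + s * (t - \<tau>) \<noteq> 0" by auto
  then show ?thesis by (rule nonzero_in_punctured)
qed (simp add: nonzero_in_punctured)

lemma pd_add:
  assumes "f differentiable (at p)" "g differentiable (at p)"
  shows "pd_t (\<lambda>p. f p + g p) p = pd_t f p + pd_t g p" "pd_zbar (\<lambda>p. f p + g p) p = pd_zbar f p + pd_zbar g p"
proof -
  have "frechet_derivative (\<lambda>p. f p + g p) (at p) = (\<lambda>v. frechet_derivative f (at p) v + frechet_derivative g (at p) v)"
    using frechet_derivative_at[OF has_derivative_add] assms unfolding frechet_derivative_works by metis
  then show "pd_t (\<lambda>p. f p + g p) p = pd_t f p + pd_t g p" "pd_zbar (\<lambda>p. f p + g p) p = pd_zbar f p + pd_zbar g p"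
    by (simp_all add: pd_t_def pd_zbar_def algebra_simps add_divide_distrib)
qed

lemma pd_fst:
  assumes "smooth_on UNIV u"
  shows "pd_t (\<lambda>p. u (fst p)) p = 0" "pd_zbar (\<lambda>p. u (fst p)) p = pd_cbar u (fst p)"
proof -
  have "frechet_derivative (\<lambda>p. u (fst p)) (at p) v = frechet_derivative u (at (fst p)) (fst v)" for v
    by (rule frechet_derivative_compose[OF has_derivative_fst[OF has_derivative_ident] assms]) simp
  moreover have "frechet_derivative u (at (fst p)) 0 = 0"
    by (rule linear_0[OF has_derivative_linear[OF smooth_on_has_derivative[OF assms]]]) simp
  ultimately show "pd_t (\<lambda>p. u (fst p)) p = 0" "pd_zbar (\<lambda>p. u (fst p)) p = pd_cbar u (fst p)"
    by (simp_all add: pd_t_def pd_zbar_def pd_cbar_def)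
qed

text \<open>
  The vertical primitive of \<open>h\<close> from height \<open>\<tau>\<close> has the right \<open>t\<close>-derivative, and by closedness its
  \<open>zbar\<close>-derivative is \<open>g(z,t) - g(z,\<tau>)\<close>. The defect \<open>g(z,\<tau>)\<close> is a smooth function on
  \<open>\<complex>\<close>, so it is a \<open>zbar\<close>-derivative on the disc of radius \<open>N\<close>.
\<close>

lemma primitive_on_slit:
  assumes closed: "d_zbar h = d_t g" and "\<tau> \<noteq> 0" "N > 0"
  obtains F where "smooth_on (slit \<tau>) F"
    "\<And>p. p \<in> slit \<tau> \<Longrightarrow> norm (fst p) < N \<Longrightarrow> pd_t F p = at_point h p"
    "\<And>p. p \<in> slit \<tau> \<Longrightarrow> norm (fst p) < N \<Longrightarrow> pd_zbar F p = at_point g p"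
proof -
  note seg = slit_segment[OF assms(2)]
  have "smooth_on UNIV (\<lambda>z. at_point g (z, \<tau>))"
    by (rule smooth_on_compose[OF _ smooth_at_point])
       (use assms(2) in \<open>auto intro!: smooth_on_Pair smooth_on_ident smooth_on_const simp: open_punctured nonzero_in_punctured\<close>)
  from dbar_solution_on_ball[OF this assms(3)]
  obtain u where u: "smooth_on UNIV u" "\<And>z. z \<in> ball 0 N \<Longrightarrow> pd_cbar u z = at_point g (z, \<tau>)" by blast
  let ?f = "vertical_primitive \<tau> (at_point h)"
  define F where "F = (\<lambda>p. ?f p + u (fst p))"
  have sf: "smooth_on (slit \<tau>) ?f"
    by (rule smooth_on_vertical_primitive[OF open_punctured open_slit seg smooth_at_point])
  have su: "smooth_on A (\<lambda>p. u (fst p))" if "open A" for A :: "(complex \<times> real) set"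
    by (rule smooth_on_compose[OF that u(1)]) (auto intro: smooth_on_linear[OF that] bounded_linear_fst)
  have pd: "pd_t F p = pd_t ?f p" "pd_zbar F p = pd_zbar ?f p + pd_cbar u (fst p)" if "p \<in> slit \<tau>" for p
    using pd_add[OF smooth_on_differentiable[OF sf that] smooth_on_differentiable[OF su[OF open_UNIV] UNIV_I]]
      pd_fst[OF u(1)] by (simp_all add: F_def)
  show thesis
  proof (rule that)
    show "smooth_on (slit \<tau>) F" unfolding F_def by (intro smooth_on_add sf su open_slit)
    fix p assume p: "p \<in> slit \<tau>" "norm (fst p) < N"
    show "pd_t F p = at_point h p"
      unfolding pd(1)[OF p(1)] by (rule pd_t_vertical_primitive[OF open_punctured open_slit seg smooth_at_point p(1)])
    have "pd_zbar ?f p = vertical_primitive \<tau> (pd_zbar (at_point h)) p"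
      by (rule pd_zbar_vertical_primitive[OF open_punctured open_slit seg smooth_at_point p(1)])
    also have "\<dots> = vertical_primitive \<tau> (pd_t (at_point g)) p"
    proof -
      have "pd_zbar (at_point h) q = pd_t (at_point g) q" if "q \<in> punctured" for q
        using arg_cong[OF closed, of "\<lambda>f. at_point f q"] that by (simp add: at_point_d_t at_point_d_zbar)
      then have "integral {0..1} (\<lambda>s. pd_zbar (at_point h) (fst p, \<tau> + s * (snd p - \<tau>))) =
         integral {0..1} (\<lambda>s. pd_t (at_point g) (fst p, \<tau> + s * (snd p - \<tau>)))"
        using seg[of "fst p" "snd p"] p(1) by (intro Henstock_Kurzweil_Integration.integral_cong) auto
      then show ?thesis by (simp add: vertical_primitive_def)
    qed
    also have "\<dots> = at_point g p - at_point g (fst p, \<tau>)"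
      by (rule vertical_primitive_of_pd_t[OF open_punctured open_slit seg smooth_at_point p(1)])
    finally show "pd_zbar F p = at_point g p"
      unfolding pd(2)[OF p(1)] using u(2)[of "fst p"] p(2) by simp
  qed
qed

section \<open>A cutoff between the two half-axes\<close>

text \<open>
  The real-valued function \<open>x = t/r\<close>; it is 1 and -1 on the two half-axes, and stays away from both
  values on compact sets that avoid the axis.
\<close>

definition height :: "complex \<times> real \<Rightarrow> real" where
  "height p = snd p / radius (fst p) (snd p)"

lemma at_point_sm_x: "p \<in> punctured \<Longrightarrow> at_point sm_x p = of_real (height p)"
  by (simp add: sm_x_def height_def divide_inverse)

lemma smooth_on_height: "smooth_on punctured height"
  unfolding height_def using radius_gt_0
  by (intro smooth_on_divide smooth_on_snd smooth_on_ident smooth_on_radius open_punctured) force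

lemma open_height: "open A \<Longrightarrow> open {p \<in> punctured. height p \<in> A}"
  using continuous_open_preimage[OF smooth_on_continuous[OF smooth_on_height] open_punctured, of A]
  by (simp add: vimage_def Int_def)

lemma height_axis: "t \<noteq> 0 \<Longrightarrow> height (0, t) = sgn t"
  by (simp add: height_def radius_eq sgn_div_norm divide_inverse)

definition height_step :: "real \<Rightarrow> real" where
  "height_step = (SOME s. smooth_on UNIV s \<and> (\<forall>x\<le>-1/2. s x = 1) \<and> (\<forall>x\<ge>1/2. s x = 0))"

lemma height_step: "smooth_on UNIV height_step" "x \<le> - 1/2 \<Longrightarrow> height_step x = 1" "x \<ge> 1/2 \<Longrightarrow> height_step x = 0"
proof -
  obtain s :: "real \<Rightarrow> real" where "smooth_on UNIV s" "\<And>x. x \<le> - 1/2 \<Longrightarrow> s x = 1" "\<And>x. x \<ge> 1/2 \<Longrightarrow> s x = 0"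
    using smooth_step_exists[of "- 1/2" "1/2"] by auto
  then have "\<exists>s :: real \<Rightarrow> real. smooth_on UNIV s \<and> (\<forall>x\<le>-1/2. s x = 1) \<and> (\<forall>x\<ge>1/2. s x = 0)" by blast
  from someI_ex[OF this]
  show "smooth_on UNIV height_step" "x \<le> - 1/2 \<Longrightarrow> height_step x = 1" "x \<ge> 1/2 \<Longrightarrow> height_step x = 0"
    by (simp_all add: height_step_def)
qed

definition cutoff :: smooth where "cutoff = mk_smooth (\<lambda>p. of_real (height_step (height p)))"

lemma at_point_cutoff [simp]: "p \<in> punctured \<Longrightarrow> at_point cutoff p = of_real (height_step (height p))"
  unfolding cutoff_def
  by (rule at_point_mk_smooth) (auto intro!: smooth_on_of_real smooth_on_compose[OF _ height_step(1)]
     smooth_on_height simp: open_punctured)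

lemma dir_deriv_cutoff_0:
  assumes "p \<in> punctured" "\<bar>height p\<bar> > 1/2"
  shows "at_point (dir_deriv v cutoff) p = 0"
proof -
  have *: "at_point (dir_deriv v cutoff) p = 0" if O': "open O'" "p \<in> O'" "\<And>q. q \<in> O' \<Longrightarrow> at_point cutoff q = c" for O' c
  proof -
    have "frechet_derivative (at_point cutoff) (at p) = (\<lambda>v. 0)"
      by (rule frechet_derivative_eq_on_open[OF O'(1,2) has_derivative_const[of c]]) (use O'(3) in auto)
    then show ?thesis using assms by simp
  qed
  from assms(2) consider "height p > 1/2" | "height p < - 1/2" by linarith
  then show ?thesis
  proof cases
    case 1
    have "open {p \<in> punctured. height p \<in> {1/2<..}}" by (rule open_height) simp
    from *[OF this, of 0] show ?thesis using 1 assms by (simp add: height_step)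
  next
    case 2
    have "open {p \<in> punctured. height p \<in> {..<-1/2}}" by (rule open_height) simp
    from *[OF this, of 1] show ?thesis using 2 assms by (simp add: height_step)
  qed
qed

lemma d_cutoff_0:
  assumes "p \<in> punctured" "\<bar>height p\<bar> > 1/2"
  shows "at_point (d_t cutoff) p = 0" "at_point (d_zbar cutoff) p = 0"
  using dir_deriv_cutoff_0[OF assms] by (simp_all add: d_t_def d_zbar_def del: at_point_dir_deriv)

text \<open>
  In characteristic 0 the order of a root drops by exactly one under differentiation.
\<close>

lemma root_power_dvd_antiderivative:
  fixes E :: "complex poly"
  assumes "poly E a = 0" "[:- a, 1:] ^ k dvd pderiv E"
  shows "[:- a, 1:] ^ Suc k dvd E"
proof (cases "pderiv E = 0")
  case True
  then obtain c where "E = [:c:]" using pderiv_iszero by blast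
  then show ?thesis using assms(1) by simp
next
  case False
  then have "E \<noteq> 0" by auto
  from order_pderiv[OF this assms(1)] show ?thesis
    using assms(2) False \<open>E \<noteq> 0\<close> by (simp add: order_divides del: power_Suc)
qed

text \<open>
  Let \<open>E\<close> be the multiple of an antiderivative of \<open>(1 - x\<^sup>2)\<^sup>k\<close> with values 0 at 1 and 1
  at -1, the values of the cutoff at the two half-axes. Then
  \<open>w = z\<^sup>-\<^sup>k\<^sup>-\<^sup>1 (\<chi> - E(x))\<close> extends smoothly over the axis: near \<open>x = 1\<close>
  it equals \<open>-z\<^sup>-\<^sup>k\<^sup>-\<^sup>1 E(x)\<close>, where \<open>E\<close> is divisible by
  \<open>(x - 1)\<^sup>k\<^sup>+\<^sup>1\<close> and \<open>1 - x = z \<lambda>/(1 + x)\<close>, and likewise near \<open>x = -1\<close>. So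
  \<open>z\<^sup>-\<^sup>k\<^sup>-\<^sup>1 d'\<chi>\<close> differs from \<open>d'w\<close> by
  \<open>z\<^sup>-\<^sup>k\<^sup>-\<^sup>1 d'(E(x))\<close>, a multiple of \<open>\<lambda>\<^sup>k \<omega>\<close>.
\<close>

lemma cutoff_class_multiple_of_lambda_omega:
  obtains w C where "sm_z ^ Suc k * (d_t w + smooth_scale C (sm_lambda ^ k * omega_t)) = d_t cutoff"
    "sm_z ^ Suc k * (d_zbar w + smooth_scale C (sm_lambda ^ k * omega_zbar)) = d_zbar cutoff"
proof -
  obtain Q :: "complex poly" where Q: "pderiv Q = [:1, 0, - 1:] ^ k" "poly Q 1 \<noteq> poly Q (- 1)"
    by (rule one_minus_sq_antiderivative)
  define e where "e = 1 / (poly Q (- 1) - poly Q 1)"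
  define E where "E = smult e (Q - [:poly Q 1:])"
  have E: "poly E 1 = 0" "poly E (- 1) = 1" "pderiv E = smult e ([:1, 0, - 1:] ^ k)"
    using Q by (simp_all add: E_def e_def pderiv_smult pderiv_diff pderiv_pCons)
  have "[:- 1, 1:] ^ k dvd ([:1, 0, - 1:] :: complex poly) ^ k" "[:1, 1:] ^ k dvd ([:1, 0, - 1:] :: complex poly) ^ k"
  proof -
    have "[:1, 0, - 1:] = [:- 1, 1:] * [:- 1, - 1 :: complex:]" "[:1, 0, - 1:] = [:1, 1:] * [:1, - 1 :: complex:]" by simp_all
    then have "[:- 1, 1:] dvd [:1, 0, - 1 :: complex:]" "[:1, 1:] dvd [:1, 0, - 1 :: complex:]"
      unfolding dvd_def by blast+
    then show "[:- 1, 1:] ^ k dvd ([:1, 0, - 1:] :: complex poly) ^ k" "[:1, 1:] ^ k dvd ([:1, 0, - 1:] :: complex poly) ^ k"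
      by (simp_all add: dvd_power_same)
  qed
  then have "[:- 1, 1:] ^ k dvd pderiv E" "[:- (- 1), 1:] ^ k dvd pderiv (E - 1)"
    unfolding E(3) pderiv_diff pderiv_1 by (simp_all add: dvd_smult E(3))
  from root_power_dvd_antiderivative[OF E(1) this(1)] root_power_dvd_antiderivative[OF _ this(2)]
  obtain R S where "E = [:- 1, 1:] ^ Suc k * R" "E - 1 = [:1, 1:] ^ Suc k * S"
    using E(2) unfolding dvd_def by auto
  from arg_cong[OF this(1), of "\<lambda>p. poly p x" for x] arg_cong[OF this(2), of "\<lambda>p. poly p x" for x]
  have RS: "poly E x = (x - 1) ^ Suc k * poly R x" "poly E x - 1 = (x + 1) ^ Suc k * poly S x" for x
    by (simp_all add: poly_power add.commute del: power_Suc)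
  let ?x = "at_point sm_x" and ?l = "at_point sm_lambda"
  have zl: "fst p * ?l p = (1 - ?x p) * (1 + ?x p)" if "p \<in> punctured" for p
    using arg_cong[OF quadric_relation, of "\<lambda>f. at_point f p"] that by (simp add: algebra_simps power2_eq_square)
  have l0: "?l p = 0" if "p \<in> punctured" "fst p = 0" for p using that by (simp add: sm_lambda_def)
  \<comment> \<open>On the axis the quotient is 0 since the denominator is; this agrees with the smooth
    expressions used on \<open>?P\<close> and \<open>?M\<close>, which contain \<open>\<lambda> = 0\<close> as a factor there.\<close>
  define W where "W = (\<lambda>p. (at_point cutoff p - poly E (?x p)) / fst p ^ Suc k)"
  let ?O = "fst -` (- {0}) :: (complex \<times> real) set"
  let ?P = "{p \<in> punctured. height p \<in> {1/2<..}}" and ?M = "{p \<in> punctured. height p \<in> {..<-1/2}}"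
  have o: "open ?O" "open ?P" "open ?M"
    by (intro open_vimage continuous_intros, (rule open_height, simp)+)
  have sub: "?O \<subseteq> punctured" by (auto simp: punctured_def zero_prod_def)
  have spe: "smooth_on A (\<lambda>p. poly G (?x p))" if "open A" "A \<subseteq> punctured" for G A
    by (rule smooth_on_cong[OF that(1) smooth_on_subset[OF smooth_at_point[of "smooth_poly G sm_x"] that(2)]])
       (use that(2) in auto)
  have sat: "smooth_on A (at_point g)" if "A \<subseteq> punctured" for A g
    using smooth_on_subset[OF smooth_at_point that] .
  have 1: "smooth_on ?O W" unfolding W_def
    by (intro smooth_on_divide smooth_on_diff spe sat smooth_on_power smooth_on_fst smooth_on_ident o sub) auto
  have 2: "smooth_on ?P W"
  proof (rule smooth_on_cong[OF o(2)])
    have nz: "1 + ?x p \<noteq> 0" if "p \<in> ?P" for p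
    proof -
      have "1 + ?x p = of_real (1 + height p)" using that by (simp add: at_point_sm_x)
      then show ?thesis using that by (simp only: of_real_eq_0_iff) auto
    qed
    show "smooth_on ?P (\<lambda>p. - ((- (?l p / (1 + ?x p))) ^ Suc k * poly R (?x p)))"
      using nz by (intro smooth_on_minus smooth_on_mult smooth_on_power smooth_on_divide smooth_on_add smooth_on_const
        spe sat o) auto
    fix p assume p: "p \<in> ?P"
    show "- ((- (?l p / (1 + ?x p))) ^ Suc k * poly R (?x p)) = W p"
    proof (cases "fst p = 0")
      case True
      then show ?thesis using p l0 by (simp add: W_def)
    next
      case False
      have "?x p - 1 = fst p * (- (?l p / (1 + ?x p)))"
        using zl[of p] p nz[OF p] by (simp add: field_simps)
      then have "poly E (?x p) = fst p ^ Suc k * ((- (?l p / (1 + ?x p))) ^ Suc k * poly R (?x p))"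
        unfolding RS(1) by (simp only: power_mult_distrib mult.assoc)
      moreover have "at_point cutoff p = 0" using p by (simp add: height_step)
      ultimately show ?thesis using False by (simp add: W_def del: power_Suc)
    qed
  qed
  have 3: "smooth_on ?M W"
  proof (rule smooth_on_cong[OF o(3)])
    have nz: "1 - ?x p \<noteq> 0" if "p \<in> ?M" for p
    proof -
      have "1 - ?x p = of_real (1 - height p)" using that by (simp add: at_point_sm_x)
      then show ?thesis using that by (simp only: of_real_eq_0_iff) auto
    qed
    show "smooth_on ?M (\<lambda>p. - ((?l p / (1 - ?x p)) ^ Suc k * poly S (?x p)))"
      using nz by (intro smooth_on_minus smooth_on_mult smooth_on_power smooth_on_divide smooth_on_diff smooth_on_const
        spe sat o) auto
    fix p assume p: "p \<in> ?M"
    show "- ((?l p / (1 - ?x p)) ^ Suc k * poly S (?x p)) = W p"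
    proof (cases "fst p = 0")
      case True
      then show ?thesis using p l0 by (simp add: W_def)
    next
      case False
      have "?x p + 1 = fst p * (?l p / (1 - ?x p))"
        using zl[of p] p nz[OF p] by (simp add: field_simps)
      then have "poly E (?x p) - 1 = fst p ^ Suc k * ((?l p / (1 - ?x p)) ^ Suc k * poly S (?x p))"
        unfolding RS(2) by (simp only: power_mult_distrib mult.assoc)
      moreover have "at_point cutoff p = 1" using p by (simp add: height_step)
      moreover have "1 - poly E (?x p) = - (poly E (?x p) - 1)" by simp
      ultimately show ?thesis using False by (simp add: W_def del: power_Suc minus_diff_eq)
    qed
  qed
  have cover: "p \<in> ?O \<union> ?P \<union> ?M" if p: "p \<in> punctured" for p
  proof (cases "fst p = 0")
    case True
    then obtain t where t: "p = (0, t)" "t \<noteq> 0" using p by (cases p) (auto simp: punctured_def zero_prod_def)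
    then show ?thesis using p height_axis[OF t(2)] by (cases "t > 0") auto
  qed auto
  have "smooth_on (?O \<union> ?P \<union> ?M) W"
    by (intro smooth_on_Un open_Un o 1 2 3)
  then have sW: "smooth_on punctured W" by (rule smooth_on_subset) (use cover in blast)
  define w where "w = mk_smooth W"
  have "sm_z ^ Suc k * w = cutoff - smooth_poly E sm_x"
  proof (rule smooth_eqI_off_axis)
    fix z t assume z: "(z::complex) \<noteq> 0"
    have p: "(z, t) \<in> punctured" using z by (rule nonzero_in_punctured)
    have "at_point w (z, t) = W (z, t)" unfolding w_def by (rule at_point_mk_smooth[OF sW p])
    then show "at_point (sm_z ^ Suc k * w) (z, t) = at_point (cutoff - smooth_poly E sm_x) (z, t)"
      using z p by (simp add: W_def del: power_Suc)
  qed
  then have d: "d_t (sm_z ^ Suc k * w) = d_t (cutoff - smooth_poly E sm_x)" "d_zbar (sm_z ^ Suc k * w) = d_zbar (cutoff - smooth_poly E sm_x)"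
    by simp_all
  have spE: "smooth_poly (pderiv E) sm_x = smooth_scale e ((sm_z * sm_lambda) ^ k)"
    unfolding E(3) one_minus_x_sq[symmetric] by (rule smooth_eqI) simp
  have s: "d_t (smooth_poly E sm_x) = smooth_scale (- e / 2) (sm_z ^ Suc k * (sm_lambda ^ k * omega_t))"
    "d_zbar (smooth_poly E sm_x) = smooth_scale (- e / 2) (sm_z ^ Suc k * (sm_lambda ^ k * omega_zbar))"
    by (simp_all add: d_smooth_poly spE d_generators smooth_scale_simps power_mult_distrib mult_ac)
  show thesis
  proof (rule that)
    show "sm_z ^ Suc k * (d_t w + smooth_scale (- e / 2) (sm_lambda ^ k * omega_t)) = d_t cutoff"
      "sm_z ^ Suc k * (d_zbar w + smooth_scale (- e / 2) (sm_lambda ^ k * omega_zbar)) = d_zbar cutoff"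
      using d unfolding d_t_diff d_zbar_diff s d_t_mult d_zbar_mult d_sm_z_power
      by (simp_all add: distrib_left smooth_scale_simps del: power_Suc)
  qed
qed

section \<open>Approximation of closed one-forms\<close>

lemma vanishes_on_axis:
  assumes "open O'" "O' \<subseteq> punctured" "\<And>q. q \<in> O' \<Longrightarrow> fst q \<noteq> 0 \<Longrightarrow> at_point e q = 0" "p \<in> O'"
  shows "at_point e p = 0"
proof (cases "fst p = 0")
  case True
  then obtain t where t: "p = (0, t)" by (cases p) auto
  then have t0: "t \<noteq> 0" using assms by (auto simp: punctured_def zero_prod_def)
  have "(\<lambda>n. (complex_of_real (inverse (real (Suc n))), t)) \<longlonglongrightarrow> (of_real 0, t)"
    by (intro tendsto_intros LIMSEQ_inverse_real_of_nat)
  then have "\<forall>\<^sub>F n in sequentially. (complex_of_real (inverse (real (Suc n))), t) \<in> O'"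
    using assms(1,4) t by (intro topological_tendstoD) auto
  then have "\<forall>\<^sub>F n in sequentially. at_point e (complex_of_real (inverse (real (Suc n))), t) = 0"
    by eventually_elim (rule assms(3), simp_all del: of_nat_Suc)
  from tendsto_eventually[OF this] at_point_axis_limit[OF t0, of e] show ?thesis
    unfolding t using LIMSEQ_unique by blast
qed (use assms in auto)

text \<open>
  On the part of \<open>K\<close> where \<open>|x| \<le> 3/4\<close>, which contains a neighbourhood in \<open>K\<close> of the support of the
  derivatives of the cutoff, \<open>|z|\<close> is bounded below, because \<open>|x| = 1\<close> on the axis.
\<close>

lemma annulus_bounds:
  assumes "compact K" "K \<subseteq> punctured"
  obtains a b where "0 < a" "a \<le> b" "\<And>p. p \<in> K \<Longrightarrow> norm (fst p) < b"
    "\<And>p. p \<in> K \<Longrightarrow> \<bar>height p\<bar> \<le> 3/4 \<Longrightarrow> a < norm (fst p)"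
proof -
  have "compact (fst ` K)" using assms(1) by (intro compact_continuous_image continuous_intros)
  then obtain b where b: "\<And>z. z \<in> fst ` K \<Longrightarrow> norm z \<le> b" using compact_imp_bounded bounded_iff by metis
  have ch: "continuous_on K height" using continuous_on_subset[OF smooth_on_continuous[OF smooth_on_height] assms(2)] .
  have c: "compact (K \<inter> height -` {-3/4..3/4})"
  proof -
    have "closed (K \<inter> height -` {-3/4..3/4})"
      using assms(1) by (intro continuous_closed_preimage ch compact_imp_closed) auto
    from compact_Int_closed[OF assms(1) this] show ?thesis by (simp add: Int_assoc[symmetric])
  qed
  have "\<exists>a>0. \<forall>p\<in>K \<inter> height -` {-3/4..3/4}. a < norm (fst p)"
  proof (cases "K \<inter> height -` {-3/4..3/4} = {}")
    case False
    have "continuous_on (K \<inter> height -` {-3/4..3/4}) (\<lambda>p. norm (fst p))" by (intro continuous_intros)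
    from continuous_attains_inf[OF c False this]
    obtain q where q': "q \<in> K \<inter> height -` {-3/4..3/4}" "\<forall>p\<in>K \<inter> height -` {-3/4..3/4}. norm (fst q) \<le> norm (fst p)"
      by blast
    then have q: "q \<in> K" "height q \<in> {-3/4..3/4}" "\<And>p. p \<in> K \<inter> height -` {-3/4..3/4} \<Longrightarrow> norm (fst q) \<le> norm (fst p)"
      by blast+
    have "fst q \<noteq> 0"
    proof
      assume "fst q = 0"
      then obtain t where "q = (0, t)" "t \<noteq> 0" using q(1) assms(2) by (cases q) (auto simp: punctured_def zero_prod_def)
      then show False using q(2) height_axis[of t] by (auto simp: sgn_if split: if_splits)
    qed
    then have "norm (fst q) / 2 < norm (fst q)" "norm (fst q) / 2 > 0" by simp_all
    with q(3) show ?thesis by (meson less_le_trans)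
  qed (auto intro: exI[of _ 1])
  then obtain a where a0: "a > 0" "\<forall>p\<in>K \<inter> height -` {-3/4..3/4}. a < norm (fst p)" by blast
  have a: "a < norm (fst p)" if "p \<in> K" "\<bar>height p\<bar> \<le> 3/4" for p
  proof (rule bspec[OF a0(2)])
    have "- 3/4 \<le> height p" "height p \<le> 3/4" using that(2) by linarith+
    then show "p \<in> K \<inter> height -` {-3/4..3/4}" using that(1) by simp
  qed
  show thesis
  proof (rule that[of a "max a (b + 1)"])
    fix p assume "p \<in> K"
    then have "norm (fst p) \<le> b" using b by simp
    then show "norm (fst p) < max a (b + 1)" by simp
  qed (use a a0(1) in simp_all)
qed

text \<open>
  One component of the approximation of \<open>e\<^sub>0 + \<phi> \<eta>\<close>, where \<open>\<eta>\<close> is a component of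
  \<open>d'\<chi>\<close>, by \<open>e\<^sub>0 + q\<^sub>n \<eta>\<close> with the Laurent polynomials \<open>q\<^sub>n\<close>. The products
  \<open>z\<^sup>-\<^sup>k\<^sup>-\<^sup>1 \<eta>\<close> enter as smooth functions \<open>y\<^sub>k\<close> that are determined
  by \<open>z\<^sup>k\<^sup>+\<^sup>1 y\<^sub>k = \<eta>\<close>.
\<close>

lemma laurent_component_conv_on:
  assumes K: "compact K" "K \<subseteq> punctured" and ab: "0 < a" "b < N"
    and Kb: "\<And>p. p \<in> K \<Longrightarrow> norm (fst p) < b"
    and Ka: "\<And>p. p \<in> K \<Longrightarrow> \<bar>height p\<bar> \<le> 3/4 \<Longrightarrow> a < norm (fst p)"
    and hol: "\<phi> holomorphic_on (ball 0 N - {0})"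
    and lim: "uniform_limit (cball 0 b - ball 0 a)
     (\<lambda>n z. (\<Sum>k<n. c k * z ^ k) + (\<Sum>k<n. d k / z ^ (k + 1))) \<phi> sequentially"
    and \<eta>0: "\<And>p. p \<in> punctured \<Longrightarrow> \<bar>height p\<bar> > 1/2 \<Longrightarrow> at_point \<eta> p = 0"
    and y: "\<And>k. sm_z ^ Suc k * y k = \<eta>"
    and e: "\<And>p. fst p \<noteq> 0 \<Longrightarrow> norm (fst p) < N \<Longrightarrow> at_point e p - at_point e0 p = \<phi> (fst p) * at_point \<eta> p"
  shows "conv_on K (\<lambda>n. e0 + (\<Sum>k<n. smooth_scale (c k) (sm_z ^ k * \<eta>)) + (\<Sum>k<n. smooth_scale (d k) (y k))) e"
    (is "conv_on K ?s e")
proof -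
  let ?q = "\<lambda>n z. (\<Sum>k<n. c k * z ^ k) + (\<Sum>k<n. d k / z ^ (k + 1))"
  have diff: "at_point (?s n) p - at_point e p = (?q n (fst p) - \<phi> (fst p)) * at_point \<eta> p"
    if p: "fst p \<noteq> 0" "norm (fst p) < N" for n p
  proof -
    have pp: "p \<in> punctured" using p(1) nonzero_in_punctured(1)[of "fst p" "snd p"] by simp
    have "at_point (y k) p = at_point \<eta> p / fst p ^ (k + 1)" for k
      using arg_cong[OF y[of k], of "\<lambda>f. at_point f p"] p(1) pp by (simp add: field_simps)
    then have "at_point (?s n) p = at_point e0 p + ?q n (fst p) * at_point \<eta> p"
      using pp by (simp add: at_point_sum distrib_left sum_distrib_left mult_ac)
    then show ?thesis using e[OF p] by (simp add: algebra_simps)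
  qed
  \<comment> \<open>Where \<open>|x| \<le> 3/4\<close> the approximation is a product with the holomorphic error
    \<open>q\<^sub>n - \<phi>\<close>; where \<open>|x| \<ge> 3/4\<close> it is exact, because \<open>\<eta>\<close> vanishes for \<open>|x| > 1/2\<close>.\<close>
  define W where "W = ball 0 b - cball (0::complex) a"
  have oW: "open W" by (simp add: W_def open_Diff)
  have null: "locally_null W (\<lambda>n z. ?q n z - \<phi> z)"
    unfolding locally_null_def
  proof (intro conjI allI impI)
    show "(\<lambda>z. ?q n z - \<phi> z) holomorphic_on W" for n
      using ab by (intro holomorphic_intros holomorphic_on_subset[OF hol]) (auto simp: W_def)
    fix L assume "compact L \<and> L \<subseteq> W"
    then have "L \<subseteq> cball 0 b - ball 0 a" by (auto simp: W_def)
    from uniform_limit_minus[OF uniform_limit_on_subset[OF lim this] uniform_limit_const[of \<phi>]]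
    show "uniform_limit L (\<lambda>n z. ?q n z - \<phi> z) (\<lambda>_. 0) sequentially" by simp
  qed
  have ch: "continuous_on K height" using continuous_on_subset[OF smooth_on_continuous[OF smooth_on_height] K(2)] .
  have comp: "compact (K \<inter> height -` A)" if "closed A" for A
  proof -
    have "closed (K \<inter> height -` A)"
      by (rule continuous_closed_preimage[OF ch compact_imp_closed[OF K(1)] that])
    from compact_Int_closed[OF K(1) this] show ?thesis by (simp add: Int_assoc[symmetric])
  qed
  have onorm: "open {p :: complex \<times> real. norm (fst p) < b}" "open {p :: complex \<times> real. a < norm (fst p)}"
    by (intro open_Collect_less continuous_intros)+
  have 1: "conv_on (K \<inter> height -` {-3/4..3/4}) ?s e"
  proof (rule conv_on_holomorphic_factor[OF _ _ oW _ comp _ null])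
    let ?O = "{p :: complex \<times> real. norm (fst p) < b} \<inter> {p. a < norm (fst p)}"
    show "open ?O" using onorm by (rule open_Int)
    show "?O \<subseteq> punctured" using ab by (auto simp: punctured_def zero_prod_def)
    show "fst ` ?O \<subseteq> W" by (auto simp: W_def)
    show "K \<inter> height -` {-3/4..3/4} \<subseteq> ?O" using Ka Kb by (auto simp: abs_le_iff)
    show "at_point (?s n) p - at_point e p = (?q n (fst p) - \<phi> (fst p)) * at_point \<eta> p" if "p \<in> ?O" for n p
      by (rule diff) (use that ab in auto)
  qed simp
  have 2: "conv_on (K \<inter> height -` ({..-3/4} \<union> {3/4..})) ?s e"
  proof (rule conv_on_locally_equal[OF _ _ comp])
    let ?O = "{p \<in> punctured. height p \<in> {..<-1/2} \<union> {1/2<..}} \<inter> {p. norm (fst p) < b}"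
    have "open {p \<in> punctured. height p \<in> {..<-1/2} \<union> {1/2<..}}"
      by (rule open_height) (intro open_Un open_lessThan open_greaterThan)
    then show oO: "open ?O" using onorm(1) by (rule open_Int)
    show sub: "?O \<subseteq> punctured" by auto
    show "K \<inter> height -` ({..-3/4} \<union> {3/4..}) \<subseteq> ?O" using K Kb by auto
    fix n p assume p: "p \<in> ?O"
    have "at_point (?s n - e) p = 0"
    proof (rule vanishes_on_axis[OF oO sub _ p])
      fix q assume q: "q \<in> ?O" "fst q \<noteq> 0"
      then have "at_point \<eta> q = 0" by (intro \<eta>0) auto
      then show "at_point (?s n - e) q = 0" using diff[of q n] q ab by (simp del: at_point_simps(3))
    qed
    then show "at_point (?s n) p = at_point e p" by simp
  qed (intro closed_Un closed_atMost closed_atLeast)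
  have "K = (K \<inter> height -` {-3/4..3/4}) \<union> (K \<inter> height -` ({..-3/4} \<union> {3/4..}))" by auto
  then show ?thesis using conv_on_Un[OF 1 2] by simp
qed

text \<open>
  With primitives \<open>F\<close> and \<open>G\<close> off the two half-axes, put \<open>f = (1 - \<chi>) F + \<chi> G\<close>, where each
  summand vanishes near the half-axis on which its primitive is undefined. Then
  \<open>d'f = \<alpha> - (F - G) d'\<chi>\<close>. The difference \<open>F - G\<close> is closed off the axis, hence a
  holomorphic function of \<open>z\<close>.
\<close>

lemma closed_one_form_decomposition:
  assumes closed: "d_zbar h = d_t g" and N: "N > 0"
  obtains f \<phi> where "\<phi> holomorphic_on (ball 0 N - {0})"
    "\<And>p. fst p \<noteq> 0 \<Longrightarrow> norm (fst p) < N \<Longrightarrow> at_point h p - at_point (d_t f) p = \<phi> (fst p) * at_point (d_t cutoff) p"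
    "\<And>p. fst p \<noteq> 0 \<Longrightarrow> norm (fst p) < N \<Longrightarrow> at_point g p - at_point (d_zbar f) p = \<phi> (fst p) * at_point (d_zbar cutoff) p"
proof -
  obtain F where F: "smooth_on (slit 1) F"
    "\<And>p. p \<in> slit 1 \<Longrightarrow> norm (fst p) < N \<Longrightarrow> pd_t F p = at_point h p"
    "\<And>p. p \<in> slit 1 \<Longrightarrow> norm (fst p) < N \<Longrightarrow> pd_zbar F p = at_point g p"
    using primitive_on_slit[OF closed _ N, of 1] by auto
  obtain G where G: "smooth_on (slit (- 1)) G"
    "\<And>p. p \<in> slit (- 1) \<Longrightarrow> norm (fst p) < N \<Longrightarrow> pd_t G p = at_point h p"
    "\<And>p. p \<in> slit (- 1) \<Longrightarrow> norm (fst p) < N \<Longrightarrow> pd_zbar G p = at_point g p"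
    using primitive_on_slit[OF closed _ N, of "- 1"] by auto
  let ?O = "fst -` (- {0}) :: (complex \<times> real) set"
  have oO: "open ?O" by (intro open_vimage continuous_intros)
  have inO: "p \<in> slit \<tau>" "p \<in> punctured" if "fst p \<noteq> 0" for p \<tau>
    using that nonzero_in_punctured(1)[of "fst p" "snd p"] by (auto simp: slit_def)
  define \<phi> where "\<phi> = (\<lambda>z. F (z, 0) - G (z, 0))"
  have const: "F p - G p = \<phi> (fst p)" if p: "fst p \<noteq> 0" "norm (fst p) < N" for p
  proof -
    have "((\<lambda>t. F (fst p, t) - G (fst p, t)) has_derivative (\<lambda>h. 0)) (at t within UNIV)" for t
    proof -
      have "(fst p, t) \<in> slit 1" "(fst p, t) \<in> slit (- 1)" using p by (auto simp: slit_def)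
      from has_vector_derivative_diff[OF pd_t_vector_derivative[OF F(1) this(1), of UNIV] pd_t_vector_derivative[OF G(1) this(2), of UNIV]]
      show ?thesis using F(2)[OF \<open>(fst p, t) \<in> slit 1\<close>] G(2)[OF \<open>(fst p, t) \<in> slit (- 1)\<close>] p
        by (simp add: has_vector_derivative_def)
    qed
    from has_derivative_zero_unique[OF convex_UNIV this, of "snd p" 0] show ?thesis by (simp add: \<phi>_def)
  qed
  have hol: "\<phi> holomorphic_on (ball 0 N - {0})"
  proof (rule holomorphic_on_if_pd_cbar_0)
    have sm: "smooth_on (- {0}) (\<lambda>z. H (z, 0))" if "smooth_on (slit \<tau>) H" for H \<tau>
      by (rule smooth_on_compose[OF _ that _ _ open_slit])
         (auto intro!: smooth_on_Pair smooth_on_ident smooth_on_const simp: slit_def)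
    have s\<phi>: "smooth_on (- {0}) \<phi>" unfolding \<phi>_def by (intro smooth_on_diff sm[OF F(1)] sm[OF G(1)]) auto
    then show "smooth_on (ball 0 N - {0}) \<phi>" by (rule smooth_on_subset) auto
    fix z :: complex assume z: "z \<in> ball 0 N - {0}"
    have d: "((\<lambda>z. (z, 0)) has_derivative (\<lambda>v. (v, 0::real))) (at z)"
      by (auto intro!: derivative_eq_intros)
    have in1: "(z, 0) \<in> slit 1" "(z, 0) \<in> slit (- 1)" using z by (auto simp: slit_def)
    have "(\<phi> has_derivative (\<lambda>v. frechet_derivative F (at (z, 0)) (v, 0) - frechet_derivative G (at (z, 0)) (v, 0))) (at z)"
      unfolding \<phi>_def
      by (intro has_derivative_diff has_derivative_compose[OF d] smooth_on_has_derivative[OF F(1)]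
          smooth_on_has_derivative[OF G(1)] in1)
    from frechet_derivative_at[OF this, symmetric]
    have "pd_cbar \<phi> z = pd_zbar F (z, 0) - pd_zbar G (z, 0)"
      by (simp add: pd_cbar_def pd_zbar_def algebra_simps diff_divide_distrib add_divide_distrib)
    then show "pd_cbar \<phi> z = 0" using F(3)[OF in1(1)] G(3)[OF in1(2)] z by simp
  qed (simp add: open_Diff)
  let ?P = "{p \<in> punctured. height p \<in> {1/2<..}}" and ?M = "{p \<in> punctured. height p \<in> {..<-1/2}}"
  have o: "open ?P" "open ?M" by ((rule open_height, simp)+)
  define f0 where "f0 = (\<lambda>p. (1 - at_point cutoff p) * F p + at_point cutoff p * G p)"
  have s1: "smooth_on (slit 1 \<union> ?M) (\<lambda>p. (1 - at_point cutoff p) * F p)"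
  proof (rule smooth_on_Un[OF open_slit o(2)])
    show "smooth_on (slit 1) (\<lambda>p. (1 - at_point cutoff p) * F p)"
      by (intro smooth_on_mult smooth_on_diff smooth_on_const F(1) open_slit
          smooth_on_subset[OF smooth_at_point slit_subset])
    show "smooth_on ?M (\<lambda>p. (1 - at_point cutoff p) * F p)"
      by (rule smooth_on_cong[OF o(2) smooth_on_const[OF o(2), of 0]]) (auto simp: height_step)
  qed
  have s2: "smooth_on (slit (- 1) \<union> ?P) (\<lambda>p. at_point cutoff p * G p)"
  proof (rule smooth_on_Un[OF open_slit o(1)])
    show "smooth_on (slit (- 1)) (\<lambda>p. at_point cutoff p * G p)"
      by (intro smooth_on_mult G(1) open_slit smooth_on_subset[OF smooth_at_point slit_subset])
    show "smooth_on ?P (\<lambda>p. at_point cutoff p * G p)"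
      by (rule smooth_on_cong[OF o(1) smooth_on_const[OF o(1), of 0]]) (auto simp: height_step)
  qed
  have cover: "p \<in> slit 1 \<union> ?M" "p \<in> slit (- 1) \<union> ?P" if p: "p \<in> punctured" for p
  proof -
    have "p \<in> slit 1 \<union> ?M \<and> p \<in> slit (- 1) \<union> ?P"
    proof (cases "fst p = 0")
      case True
      then obtain t where t: "p = (0, t)" "t \<noteq> 0" using p by (cases p) (auto simp: punctured_def zero_prod_def)
      then show ?thesis using p height_axis[OF t(2)] by (cases "t > 0") (auto simp: slit_def)
    qed (auto simp: slit_def)
    then show "p \<in> slit 1 \<union> ?M" "p \<in> slit (- 1) \<union> ?P" by auto
  qed
  have s0: "smooth_on punctured f0" unfolding f0_def
    by (intro smooth_on_add open_punctured smooth_on_subset[OF s1] smooth_on_subset[OF s2] subsetI cover)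
  define f where "f = mk_smooth f0"
  have D: "at_point (dir_deriv v f) p = (1 - at_point cutoff p) * frechet_derivative F (at p) v +
      at_point cutoff p * frechet_derivative G (at p) v - \<phi> (fst p) * at_point (dir_deriv v cutoff) p"
    if p: "fst p \<noteq> 0" "norm (fst p) < N" for p v
  proof -
    have dF: "(F has_derivative frechet_derivative F (at p)) (at p)" "(G has_derivative frechet_derivative G (at p)) (at p)"
      using smooth_on_has_derivative[OF F(1)] smooth_on_has_derivative[OF G(1)] inO[OF p(1)] by auto
    note dc = at_point_has_derivative[OF inO(2)[OF p(1)], of cutoff]
    have "frechet_derivative (at_point f) (at p) = (\<lambda>v. ((1 - at_point cutoff p) * frechet_derivative F (at p) v +
       (0 - frechet_derivative (at_point cutoff) (at p) v) * F p) +
       (at_point cutoff p * frechet_derivative G (at p) v + frechet_derivative (at_point cutoff) (at p) v * G p))"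
    proof (rule frechet_derivative_eq_on_open[OF oO])
      show "p \<in> ?O" using p by simp
      show "(f0 has_derivative (\<lambda>v. ((1 - at_point cutoff p) * frechet_derivative F (at p) v +
       (0 - frechet_derivative (at_point cutoff) (at p) v) * F p) +
       (at_point cutoff p * frechet_derivative G (at p) v + frechet_derivative (at_point cutoff) (at p) v * G p))) (at p)"
        unfolding f0_def by (intro has_derivative_add has_derivative_mult has_derivative_diff has_derivative_const dF dc)
      show "f0 q = at_point f q" if "q \<in> ?O" for q
        using at_point_mk_smooth[OF s0] inO(2)[of q] that by (simp add: f_def)
    qed
    then show ?thesis
      using inO(2)[OF p(1)] by (simp add: const[OF p, symmetric] algebra_simps)
  qed
  show thesis
  proof (rule that[OF hol])
    fix p :: "complex \<times> real" assume p: "fst p \<noteq> 0" "norm (fst p) < N"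
    show "at_point h p - at_point (d_t f) p = \<phi> (fst p) * at_point (d_t cutoff) p"
      using F(2)[OF inO(1)[OF p(1)] p(2)] G(2)[OF inO(1)[OF p(1)] p(2)]
      unfolding d_t_def D[OF p] pd_t_def by (simp add: algebra_simps del: at_point_dir_deriv)
    have "at_point (d_zbar f) p = (1 - at_point cutoff p) * pd_zbar F p + at_point cutoff p * pd_zbar G p - \<phi> (fst p) * at_point (d_zbar cutoff) p"
      unfolding d_zbar_def at_point_simps D[OF p] pd_zbar_def by (simp add: field_simps del: at_point_dir_deriv)
    then show "at_point g p - at_point (d_zbar f) p = \<phi> (fst p) * at_point (d_zbar cutoff) p"
      using F(3)[OF inO(1)[OF p(1)] p(2)] G(3)[OF inO(1)[OF p(1)] p(2)] by (simp add: algebra_simps)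
  qed
qed

text \<open>
  The primitives \<open>f\<^sub>n\<close> collect the one of \<open>\<alpha> - \<phi> d'\<chi>\<close>, those of
  \<open>z\<^sup>k d'\<chi>\<close> for the nonnegative powers, and the corrections \<open>w\<^sub>k\<close> that turn
  \<open>z\<^sup>-\<^sup>k\<^sup>-\<^sup>1 d'\<chi>\<close> into multiples of \<open>\<lambda>\<^sup>k \<omega>\<close>.
\<close>

lemma closed_one_form_approximation:
  assumes closed: "d_zbar h = d_t g" and K: "compact K" "K \<subseteq> punctured"
  obtains f c where "conv_on K (\<lambda>n. d_t (f n) + (\<Sum>k<n. smooth_scale (c k) (sm_lambda ^ k)) * omega_t) h"
    "conv_on K (\<lambda>n. d_zbar (f n) + (\<Sum>k<n. smooth_scale (c k) (sm_lambda ^ k)) * omega_zbar) g"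
proof -
  obtain a b where ab: "0 < a" "a \<le> b" "\<And>p. p \<in> K \<Longrightarrow> norm (fst p) < b"
    "\<And>p. p \<in> K \<Longrightarrow> \<bar>height p\<bar> \<le> 3/4 \<Longrightarrow> a < norm (fst p)"
    using annulus_bounds[OF K] by blast
  define N where "N = b + 2"
  have N: "N > 0" "b < N" using ab by (auto simp: N_def)
  show thesis
  proof (rule closed_one_form_decomposition[OF closed N(1)])
    fix f \<phi>
    assume f: "\<phi> holomorphic_on (ball 0 N - {0})"
      "\<And>p. fst p \<noteq> 0 \<Longrightarrow> norm (fst p) < N \<Longrightarrow> at_point h p - at_point (d_t f) p = \<phi> (fst p) * at_point (d_t cutoff) p"
      "\<And>p. fst p \<noteq> 0 \<Longrightarrow> norm (fst p) < N \<Longrightarrow> at_point g p - at_point (d_zbar f) p = \<phi> (fst p) * at_point (d_zbar cutoff) p"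
    obtain c d where lim: "uniform_limit (cball 0 b - ball 0 a)
       (\<lambda>n z. (\<Sum>k<n. c k * z ^ k) + (\<Sum>k<n. d k / z ^ (k + 1))) \<phi> sequentially"
      using laurent_approximation[OF f(1), of "a/2" a b "b + 1"] ab N_def by auto
    have "\<exists>w C. sm_z ^ Suc k * (d_t w + smooth_scale C (sm_lambda ^ k * omega_t)) = d_t cutoff \<and>
      sm_z ^ Suc k * (d_zbar w + smooth_scale C (sm_lambda ^ k * omega_zbar)) = d_zbar cutoff" for k
      using cutoff_class_multiple_of_lambda_omega by metis
    then obtain w C where w: "\<And>k. sm_z ^ Suc k * (d_t (w k) + smooth_scale (C k) (sm_lambda ^ k * omega_t)) = d_t cutoff"
      "\<And>k. sm_z ^ Suc k * (d_zbar (w k) + smooth_scale (C k) (sm_lambda ^ k * omega_zbar)) = d_zbar cutoff"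
      by metis
    define F where "F = (\<lambda>n. f + (\<Sum>k<n. smooth_scale (c k) (sm_z ^ k * cutoff)) + (\<Sum>k<n. smooth_scale (d k) (w k)))"
    show thesis
    proof (rule that)
      have "d_t (F n) + (\<Sum>k<n. smooth_scale (d k * C k) (sm_lambda ^ k)) * omega_t =
        d_t f + (\<Sum>k<n. smooth_scale (c k) (sm_z ^ k * d_t cutoff)) +
          (\<Sum>k<n. smooth_scale (d k) (d_t (w k) + smooth_scale (C k) (sm_lambda ^ k * omega_t)))" for n
        by (simp add: F_def d_t_add d_sum d_t_scale d_t_mult smooth_scale_simps sum.distrib sum_distrib_right)
      then show "conv_on K (\<lambda>n. d_t (F n) + (\<Sum>k<n. smooth_scale (d k * C k) (sm_lambda ^ k)) * omega_t) h"
        using laurent_component_conv_on[OF K ab(1) N(2) ab(3,4) f(1) lim d_cutoff_0(1) w(1) f(2)] by simp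
      have "d_zbar (F n) + (\<Sum>k<n. smooth_scale (d k * C k) (sm_lambda ^ k)) * omega_zbar =
        d_zbar f + (\<Sum>k<n. smooth_scale (c k) (sm_z ^ k * d_zbar cutoff)) +
          (\<Sum>k<n. smooth_scale (d k) (d_zbar (w k) + smooth_scale (C k) (sm_lambda ^ k * omega_zbar)))" for n
        by (simp add: F_def d_zbar_add d_sum d_zbar_scale d_zbar_mult smooth_scale_simps sum.distrib sum_distrib_right)
      then show "conv_on K (\<lambda>n. d_zbar (F n) + (\<Sum>k<n. smooth_scale (d k * C k) (sm_lambda ^ k)) * omega_zbar) g"
        using laurent_component_conv_on[OF K ab(1) N(2) ab(3,4) f(1) lim d_cutoff_0(2) w(2) f(3)] by simp
    qed
  qed
qed

section \<open>Approximation in degrees zero and two\<close>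

lemma closed_function_approximation:
  assumes "d_t f = 0" "d_zbar f = 0" and K: "compact K" "K \<subseteq> punctured"
  obtains c where "conv_on K (\<lambda>n. \<Sum>k<n. smooth_scale (c k) (sm_z ^ k)) f"
proof -
  have "compact (fst ` K)" using K(1) by (intro compact_continuous_image continuous_intros)
  then obtain b0 where b0: "\<And>z. z \<in> fst ` K \<Longrightarrow> norm z \<le> b0" using compact_imp_bounded bounded_iff by metis
  define b where "b = max 0 b0 + 1"
  have b: "0 \<le> b" "norm (fst p) < b" if "p \<in> K" for p
    using b0[of "fst p"] that by (auto simp: b_def)
  have b': "0 \<le> b" by (simp add: b_def)
  let ?F = "\<lambda>z. at_point f (z, 1)"
  have hol: "?F holomorphic_on UNIV" using holomorphic_if_d_0[OF assms(1,2)] .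
  obtain c where lim: "uniform_limit (cball 0 b) (\<lambda>n z. \<Sum>k<n. c k * z ^ k) ?F sequentially"
    using taylor_approximation[of ?F "b + 1" b] holomorphic_on_subset[OF hol] b' by auto
  have null: "locally_null (ball 0 b) (\<lambda>n z. (\<Sum>k<n. c k * z ^ k) - ?F z)"
    unfolding locally_null_def
  proof (intro conjI allI impI)
    show "(\<lambda>z. (\<Sum>k<n. c k * z ^ k) - ?F z) holomorphic_on ball 0 b" for n
      by (intro holomorphic_intros holomorphic_on_subset[OF hol]) auto
    fix L :: "complex set" assume "compact L \<and> L \<subseteq> ball 0 b"
    then have "L \<subseteq> cball 0 b" by auto
    from uniform_limit_minus[OF uniform_limit_on_subset[OF lim this] uniform_limit_const[of ?F]]
    show "uniform_limit L (\<lambda>n z. (\<Sum>k<n. c k * z ^ k) - ?F z) (\<lambda>_. 0) sequentially" by simp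
  qed
  have "conv_on K (\<lambda>n. \<Sum>k<n. smooth_scale (c k) (sm_z ^ k)) f"
  proof (rule conv_on_holomorphic_factor[OF _ _ open_ball _ K(1) _ null])
    let ?O = "punctured \<inter> {p. norm (fst p) < b}"
    show "open ?O" by (intro open_Int open_punctured open_Collect_less continuous_intros)
    show "?O \<subseteq> punctured" "fst ` ?O \<subseteq> ball 0 b" by auto
    show "K \<subseteq> ?O" using K b by auto
    fix n p assume p: "p \<in> ?O"
    then have "at_point f p = ?F (fst p)"
      using d_t_0_imp_constant[OF assms(1), of "fst p" "snd p" 1] by (simp add: nonzero_in_punctured)
    then show "at_point (\<Sum>k<n. smooth_scale (c k) (sm_z ^ k)) p - at_point f p =
        ((\<Sum>k<n. c k * fst p ^ k) - ?F (fst p)) * at_point 1 p"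
      using p by (simp add: at_point_sum)
  qed
  then show thesis by (rule that)
qed

text \<open>
  Cut \<open>k\<close> off near the origin, away from \<open>K\<close>. The result is smooth on \<open>\<complex> \<times> \<real>\<close>,
  where vertical primitives from height 0 exist.
\<close>

lemma top_form_approximation:
  assumes K: "compact K" "K \<subseteq> punctured"
  obtains g where "conv_on K (\<lambda>n::nat. d_t g) k"
proof -
  obtain \<delta> where \<delta>: "\<delta> > 0" "\<And>p. p \<in> K \<Longrightarrow> \<delta> \<le> norm p"
  proof -
    have "closed K" "0 \<notin> K" using K compact_imp_closed by (auto simp: punctured_def)
    from separate_point_closed[OF this] that show thesis by auto
  qed
  obtain \<kappa> :: "complex \<times> real \<Rightarrow> real" where \<kappa>: "smooth_on UNIV \<kappa>" "\<And>x. norm x \<le> \<delta> / 3 \<Longrightarrow> \<kappa> x = 1"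
    "\<And>x. norm x \<ge> \<delta> / 2 \<Longrightarrow> \<kappa> x = 0"
  proof -
    have "0 \<le> \<delta> / 3" "\<delta> / 3 < \<delta> / 2" using \<delta>(1) by simp_all
    from smooth_cutoff_exists[OF this, where 'a = "complex \<times> real"] that show thesis by blast
  qed
  \<comment> \<open>The function \<open>k\<close> vanishes at the origin by convention, but need not be smooth there.\<close>
  define k' where "k' = (\<lambda>p. of_real (1 - \<kappa> p) * at_point k p)"
  have "smooth_on (punctured \<union> ball 0 (\<delta> / 3)) k'"
  proof (rule smooth_on_Un[OF open_punctured open_ball])
    show "smooth_on punctured k'" unfolding k'_def
      by (intro smooth_on_mult smooth_on_of_real smooth_on_diff smooth_on_const smooth_on_subset[OF \<kappa>(1)]
          smooth_at_point open_punctured) auto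
    show "smooth_on (ball 0 (\<delta> / 3)) k'"
      by (rule smooth_on_cong[OF open_ball smooth_on_const[OF open_ball, of 0]]) (use \<kappa>(2) in \<open>auto simp: k'_def\<close>)
  qed
  moreover have "punctured \<union> ball 0 (\<delta> / 3) = UNIV" using \<delta>(1) by (auto simp: punctured_def)
  ultimately have sk: "smooth_on UNIV k'" by simp
  have sv: "smooth_on UNIV (vertical_primitive 0 k')" by (rule smooth_on_vertical_primitive[OF open_UNIV open_UNIV _ sk]) simp
  define g where "g = mk_smooth (vertical_primitive 0 k')"
  have g: "at_point (d_t g) p = k' p" if p: "p \<in> punctured" for p
  proof -
    have "frechet_derivative (at_point g) (at p) = frechet_derivative (vertical_primitive 0 k') (at p)"
      by (rule frechet_derivative_eq_on_open[OF open_punctured p smooth_on_has_derivative[OF sv UNIV_I]])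
         (simp add: g_def at_point_mk_smooth[OF smooth_on_subset[OF sv]])
    then have "at_point (d_t g) p = pd_t (vertical_primitive 0 k') p" using p by (simp add: at_point_d_t pd_t_def)
    also have "\<dots> = k' p" by (rule pd_t_vertical_primitive[OF open_UNIV open_UNIV _ sk]) auto
    finally show ?thesis .
  qed
  have "conv_on K (\<lambda>n::nat. d_t g) k"
  proof (rule conv_on_locally_equal[OF _ _ K(1)])
    let ?O = "punctured \<inter> {p. \<delta> / 2 < norm p}"
    show "open ?O" by (intro open_Int open_punctured open_Collect_less continuous_intros)
    show "?O \<subseteq> punctured" by auto
    show "K \<subseteq> ?O" using K \<delta> by force
    show "at_point (d_t g) p = at_point k p" if "p \<in> ?O" for p
      using that g[of p] \<kappa>(3)[of p] by (simp add: k'_def)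
  qed
  then show thesis by (rule that)
qed

section \<open>Dense embedding in cohomology\<close>

lemma qfun_power [simp]: "qfun (a ^ n) = qfun a ^ n"
  by (induction n) simp_all

lemma qfun_sum: "qfun (\<Sum>i\<in>I. a i) = (\<Sum>i\<in>I. qfun (a i))"
  by (induction I rule: infinite_finite_induct) simp_all

lemma conv_on_const: "conv_on K (\<lambda>n. f) f"
  unfolding conv_on_def
proof (intro allI impI)
  fix vs
  have "fold dir_deriv vs 0 = 0" using fold_dir_deriv_add[of vs 0 0] by simp
  then show "uniform_limit K (\<lambda>n::nat. at_point (fold dir_deriv vs (f - f))) (\<lambda>_. 0) sequentially"
    by (simp add: zero_smooth.rep_eq) (rule uniform_limit_const)
qed

text \<open>
  In degree 1, a form whose image is exact is reduced to a combination of the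
  \<open>\<lambda>\<^sup>k \<omega>\<close> by subtracting an algebraic coboundary, and there the coefficients
  vanish.
\<close>

lemma cohomology_injective:
  assumes "a \<in> cocycles alg_dga n" "alg_to_form a \<in> coboundaries form_dga n"
  shows "a \<in> coboundaries alg_dga n"
proof -
  consider "n = 0" | "n = 1" | "n \<ge> 2" by linarith
  then show ?thesis
  proof cases
    case 1
    then have "alg_to_form a = alg_to_form 0" using assms(2) alg_form.hom_0 by (simp add: coboundaries_def)
    then show ?thesis using inj_alg_to_form 1 by (auto simp: inj_def coboundaries_def)
  next
    case 2
    then have a: "alg0 a = 0" using assms(1) by (simp add: cocycles_def homog_alg)
    obtain b where b: "b \<in> homog form_dga 0" "alg_to_form a = differential form_dga b"
      using assms(2) 2 by (auto simp: coboundaries_def)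
    obtain s c m where q: "alg1 a = qring_deriv s + (\<Sum>k<m. qring_const (c k) * qring_lambda ^ k)"
      using qring_eq_deriv_plus_lambda_polynomial[of "alg1 a"] by (auto simp: reducible_def)
    have "d_t (form_1 b) = qfun (alg1 a) * omega_t" using arg_cong[OF b(2), of form_t] by simp
    then have "d_t (form_1 b - qfun s) = (\<Sum>k<m. smooth_scale (c k) (sm_lambda ^ k)) * omega_t"
      unfolding q using d_qfun[of s]
      by (simp add: d_t_diff qfun_sum distrib_right smooth_scale_simps sum_distrib_right)
    then have "c k = 0" if "k < m" for k using lambda_omega_not_exact that by blast
    then have "alg1 a = qring_deriv s" unfolding q by simp
    then have "a = differential alg_dga (Alg s 0)" using a by (simp add: alg_eq_iff)
    moreover have "Alg s 0 \<in> homog alg_dga 0" by (simp add: homog_alg)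
    ultimately show ?thesis using 2 by (auto simp: coboundaries_def)
  next
    case 3
    then have "a = 0" using assms(1) by (simp add: cocycles_def homog_alg alg_eq_iff)
    moreover have "differential alg_dga 0 = 0" by (simp add: alg_eq_iff)
    moreover have "0 \<in> homog alg_dga m" for m by (simp add: homog_alg)
    ultimately show ?thesis unfolding coboundaries_def by (cases n) (auto simp: image_iff intro: bexI[of _ 0])
  qed
qed

lemma cocycle_approximation:
  assumes a: "a \<in> cocycles form_dga n" and K: "compact K" "K \<subseteq> punctured"
  obtains b c where "\<And>k. b k \<in> cocycles alg_dga n" "\<And>k. c k \<in> coboundaries form_dga n"
    "form_conv_on K (\<lambda>k. alg_to_form (b k) + c k) a"
proof -
  have hom: "a \<in> homog form_dga n" and cl: "differential form_dga a = 0" using a by (simp_all add: cocycles_def)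
  have d: "d_zbar (form_1 a) = 0" "d_t (form_1 a) = 0" "d_zbar (form_t a) = d_t (form_zbar a)"
    using arg_cong[OF cl, of form_zbar] arg_cong[OF cl, of form_t] arg_cong[OF cl, of form_zbar_t] by simp_all
  have 0: "0 \<in> cocycles alg_dga n" "0 \<in> coboundaries form_dga n"
  proof -
    show "0 \<in> cocycles alg_dga n" by (simp add: cocycles_def homog_alg alg_eq_iff)
    have "differential form_dga 0 = 0" "0 \<in> homog form_dga m" for m by (simp_all add: homog_form form_eq_iff)
    then show "0 \<in> coboundaries form_dga n" unfolding coboundaries_def by (cases n) (auto simp: image_iff intro: bexI[of _ 0])
  qed
  consider "n = 0" | "n = 1" | "n = 2" | "n \<ge> 3" by linarith
  then show thesis
  proof cases
    case 1
    obtain c where c: "conv_on K (\<lambda>n. \<Sum>k<n. smooth_scale (c k) (sm_z ^ k)) (form_1 a)"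
      by (rule closed_function_approximation[OF d(2,1) K])
    have z: "qring_deriv (qring_z ^ k) = 0" for k
      by (induction k) (simp_all add: qring_deriv_mult qring_deriv_generators qring_deriv_const flip: qring_const_1)
    have "qring_deriv (\<Sum>k<m. qring_const (c k) * qring_z ^ k) = 0" for m
      by (induction m) (simp_all add: qring_deriv_add qring_deriv_mult qring_deriv_const z)
    then have 1: "Alg (\<Sum>k<m. qring_const (c k) * qring_z ^ k) 0 \<in> cocycles alg_dga n" for m
      using 1 by (simp add: cocycles_def homog_alg alg_eq_iff)
    show thesis
      by (rule that[of "\<lambda>m. Alg (\<Sum>k<m. qring_const (c k) * qring_z ^ k) 0" "\<lambda>_. 0", OF 1 0(2)])
         (use c hom \<open>n = 0\<close> in \<open>simp add: form_conv_on_def qfun_sum smooth_scale_simps homog_form conv_on_const\<close>)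
  next
    case 2
    obtain f c where fc: "conv_on K (\<lambda>n. d_t (f n) + (\<Sum>k<n. smooth_scale (c k) (sm_lambda ^ k)) * omega_t) (form_t a)"
      "conv_on K (\<lambda>n. d_zbar (f n) + (\<Sum>k<n. smooth_scale (c k) (sm_lambda ^ k)) * omega_zbar) (form_zbar a)"
      by (rule closed_one_form_approximation[OF d(3) K])
    have 1: "Alg 0 (\<Sum>k<m. qring_const (c k) * qring_lambda ^ k) \<in> cocycles alg_dga n" for m
      using 2 by (simp add: cocycles_def homog_alg alg_eq_iff)
    have "Form (f m) 0 0 0 \<in> homog form_dga 0" for m by (simp add: homog_form)
    then have 3: "differential form_dga (Form (f m) 0 0 0) \<in> coboundaries form_dga n" for m
      using 2 by (simp add: coboundaries_def)
    show thesis
      by (rule that[of "\<lambda>m. Alg 0 (\<Sum>k<m. qring_const (c k) * qring_lambda ^ k)"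
            "\<lambda>m. differential form_dga (Form (f m) 0 0 0)", OF 1 3])
         (use fc hom 2 in \<open>simp add: form_conv_on_def qfun_sum smooth_scale_simps homog_form conv_on_const
            add.commute d_zbar_d_t\<close>)
  next
    case 3
    obtain g where g: "conv_on K (\<lambda>n::nat. d_t g) (form_zbar_t a)" by (rule top_form_approximation[OF K])
    have "Form 0 (- g) 0 0 \<in> homog form_dga 1" by (simp add: homog_form)
    then have c: "differential form_dga (Form 0 (- g) 0 0) \<in> coboundaries form_dga n"
      using 3 by (simp add: coboundaries_def numeral_2_eq_2)
    show thesis
      by (rule that[of "\<lambda>_. 0" "\<lambda>_. differential form_dga (Form 0 (- g) 0 0)", OF 0(1) c])
         (use g hom 3 in \<open>simp add: form_conv_on_def homog_form conv_on_const d_t_minus\<close>)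
  next
    case 4
    then have "a = 0" using hom by (simp add: homog_form form_eq_iff)
    then show thesis
      by (intro that[of "\<lambda>_. 0" "\<lambda>_. 0", OF 0]) (simp add: form_conv_on_def conv_on_const)
  qed
qed

lemma alg_to_form_dense_embedding: "dense_embedding_in_cohomology alg_dga form_dga form_topology alg_to_form"
  unfolding dense_embedding_in_cohomology_def
proof (intro allI conjI)
  fix n
  show "inj_on (cohomology_map form_dga n alg_to_form) (cohomology alg_dga n)"
    by (rule alg_form.inj_on_cohomology_map) (rule cohomology_injective)
  show "cohomology_topology form_dga form_topology n closure_of
      cohomology_map form_dga n alg_to_form ` cohomology alg_dga n = cohomology form_dga n"
  proof (rule alg_form.dense_cohomology_map[OF topspace_form_topology])
    fix a V assume a: "a \<in> cocycles form_dga n" and V: "openin form_topology V" "a \<in> V"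
    obtain K where K: "compact K" "K \<subseteq> punctured" "\<And>s. form_conv_on K s a \<Longrightarrow> \<forall>\<^sub>F m in sequentially. s m \<in> V"
      using form_topology_neighbourhood[OF V] by blast
    obtain b c where bc: "\<And>k. b k \<in> cocycles alg_dga n" "\<And>k. c k \<in> coboundaries form_dga n"
      "form_conv_on K (\<lambda>k. alg_to_form (b k) + c k) a"
      using cocycle_approximation[OF a K(1,2)] by blast
    from K(3)[OF bc(3)] obtain m where "alg_to_form (b m) + c m \<in> V"
      using eventually_happens'[OF sequentially_bot] by fastforce
    then show "\<exists>b\<in>cocycles alg_dga n. \<exists>c\<in>coboundaries form_dga n. alg_to_form b + c \<in> V"
      using bc(1,2) by blast
  qed
qed

lemma form_at_generators:
  assumes "(z, t) \<in> punctured"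
  defines "r \<equiv> complex_of_real (radius z t)"
  shows "form_at (alg_to_form gen_z) (z, t) = (z, 0, 0, 0)"
    "form_at (alg_to_form gen_lambda) (z, t) = (cnj z / r\<^sup>2, 0, 0, 0)"
    "form_at (alg_to_form gen_x) (z, t) = (of_real t / r, 0, 0, 0)"
    "form_at (alg_to_form gen_omega) (z, t) = (0, of_real t / r ^ 3, - 2 * cnj z / r ^ 3, 0)"
  using assms(1)
  by (simp_all add: form_at_def gen_z_def gen_lambda_def gen_x_def gen_omega_def r_def sm_lambda_def sm_x_def
      omega_zbar_def omega_t_def divide_inverse power_inverse)

theorem proposition1p2p2:
  shows "\<exists>j :: alg \<Rightarrow> form.
    cdga_hom alg_dga form_dga j \<and>
    inj j \<and>
    (\<forall>z t. (z, t) \<in> punctured \<longrightarrow>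
      (let r = complex_of_real (radius z t); t' = complex_of_real t in
        form_at (j gen_z) (z, t) = (z, 0, 0, 0) \<and>
        form_at (j gen_lambda) (z, t) = (cnj z / r\<^sup>2, 0, 0, 0) \<and>
        form_at (j gen_x) (z, t) = (t' / r, 0, 0, 0) \<and>
        form_at (j gen_omega) (z, t) = (0, t' / r ^ 3, - 2 * cnj z / r ^ 3, 0))) \<and>
    dense_embedding_in_cohomology alg_dga form_dga form_topology j"
  using alg_form.cdga_hom_axioms inj_alg_to_form form_at_generators alg_to_form_dense_embedding
  unfolding Let_def by (intro exI[of _ alg_to_form]) blast

end
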